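(* Let $\{X_n\}_{n\ge 0}$ be a homogeneous Markov chain on a measurable space $(\mathbb{S},\mathcal{S})$ with transition operator $P$ and stationary distribution $\pi$, started from $X_0\sim\pi$. Assume that $P$ has an $L^2$-spectral gap and is uniformly integrable in $L^2$ (the $2$-U.I. condition). Let $\alpha\in(0,2)$, let $c_+,c_-\ge 0$ with $c_++c_->0$, and let $\Psi:(\mathbb{S},\mathcal{S})\to(\mathbb{R},\mathcal{B}(\mathbb{R}))$ be a measurable function such that $\pi\circ\Psi^{-1}$ belongs to the domain of attraction of the stable law $\mu_\alpha$, i.e. $$\pi(x: |\Psi(x)|>t)=t^{-\alpha}\ell(t)$$ with $\ell$ slowly varying as $t\to\infty$, and $$\lim_{t\to\infty}\frac{\pi(x:\Psi(x)>t)}{\pi(x:|\Psi(x)|>t)}=\frac{c_+}{c_++c_-},\qquad \lim_{t\to\infty}\frac{\pi(x:\Psi(x)<-t)}{\pi(x:|\Psi(x)|>t)}=\frac{c_-}{c_++c_-}.$$ Let $B_n\to\infty$ satisfy $\frac{n}{B_n^{\alpha}}\,\ell(B_n)\to c_++c_-$. (i) If $\alpha\in(0,1)$, or $\alpha=1$ and $c_+=c_-=c$, then $$\frac{\Psi(X_1)+\Psi(X_2)+\dots+\Psi(X_n)}{B_n}\longrightarrow \mu_\alpha\quad\text{in distribution.}$$ (ii) If $\alpha\in(1,2)$, then $$\frac{\sum_{j=1}^n\big(\Psi(X_j)-\mathbb{E}(\Psi(X_j)\mid\mathcal{F}_{j-1})\big)}{B_n}\longrightarrow\mu_\alpha\quad\text{in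 distribution.}$$
   Context: The transition probability $P(x,dy)$ has stationary distribution $\pi$, i.e. $\pi(A)=\int_{\mathbb{S}}\pi(dx)P(x,A)$ for $A\in\mathcal{S}$. The transition operator is $(Pf)(x)=\int_{\mathbb{S}}P(x,dy)f(y)$. $\mathcal{F}_n=\sigma\{X_j: j\le n\}$. $P$ has an $L^2$-spectral gap if there is $a<1$ such that $\|Pf\|_{L^2(\pi)}\le a$ for all $f\in L^2(\pi)$ with $\int f\,d\pi=0$ and $\|f\|_{L^2(\pi)}\le 1$. $P$ is uniformly integrable in $L^2$ ($2$-U.I.) if the family $\{|Pf|^2: f\in L^2(\pi),\ \|f\|_{L^2(\pi)}\le 1\}$ is uniformly $\pi$-integrable. For $c_+,c_-\ge 0$, $c_++c_->0$, the measure $\nu_{\alpha,c_+,c_-}$ on $\mathbb{R}\setminus\{0\}$ has density $\alpha\big(c_+x^{-(\alpha+1)}1_{\{x>0\}}+c_-|x|^{-(\alpha+1)}1_{\{x<0\}}\big)$. The stable law $\mu_\alpha$ has characteristic function $\hat\mu_\alpha(\theta)=\exp\big(\int(e^{i\theta x}-1)\,\nu_{\alpha,c_+,c_-}(dx)\big)$ if $\alpha\in(0,1)$; $\exp\big(\int(e^{i\theta x}-1)\,\nu_{1,c,c}(dx)\big)$ if $\alpha=1$ (with $c_+=c_-=c$; the integral is taken in the symmetric, principal value sense, i.e. equals $\int(\cos\theta x-1)\,\nu_{1,c,c}(dx)$); and $\exp\big(\int(e^{i\theta x}-1-i\theta x)\,\nu_{\alpha,c_+,c_-}(dx)\big)$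 if $\alpha\in(1,2)$.
   Formalization: For α = 1 the tail conditions alone do not suffice (truncated means may diverge), so it is additionally assumed that suitably scaled, uncentred sums of i.i.d. variables with law π∘Ψ⁻¹ converge in distribution to μ_1. *)

theory Defs
  imports "HOL-Probability.Probability"
begin

section \<open>Real \<open>L\<^sup>2\<close> spaces and transition operators\<close>

definition L2 :: "'s measure \<Rightarrow> ('s \<Rightarrow> real) set" where
  "L2 \<pi> = {f \<in> borel_measurable \<pi>. integrable \<pi> (\<lambda>x. (f x)\<^sup>2)}"

definition L2_norm :: "'s measure \<Rightarrow> ('s \<Rightarrow> real) \<Rightarrow> real" where
  "L2_norm \<pi> f = sqrt (\<integral>x. (f x)\<^sup>2 \<partial>\<pi>)"

text \<open>
  For stationary \<open>\<pi>\<close> and \<open>f\<close> in \<open>L\<^sup>2(\<pi>)\<close> the inner integral converges for \<open>\<pi>\<close>-almost every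
  starting point; at the exceptional points the Bochner integral is \<open>0\<close> by convention.
\<close>
definition transition_op :: "('s \<Rightarrow> 's measure) \<Rightarrow> ('s \<Rightarrow> real) \<Rightarrow> 's \<Rightarrow> real" where
  "transition_op P f = (\<lambda>x. \<integral>y. f y \<partial>P x)"

definition stationary_for :: "'s measure \<Rightarrow> ('s \<Rightarrow> 's measure) \<Rightarrow> 's measure \<Rightarrow> bool" where
  "stationary_for S P \<pi> \<longleftrightarrow>
     \<pi> \<in> space (prob_algebra S) \<and>
     (\<forall>A\<in>sets S. emeasure \<pi> A = (\<integral>\<^sup>+x. emeasure (P x) A \<partial>\<pi>))"

definition L2_spectral_gap :: "('s \<Rightarrow> 's measure) \<Rightarrow> 's measure \<Rightarrow> bool" where
  "L2_spectral_gap P \<pi> \<longleftrightarrow>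
     (\<exists>a<1. \<forall>f\<in>L2 \<pi>. (\<integral>x. f x \<partial>\<pi>) = 0 \<and> L2_norm \<pi> f \<le> 1 \<longrightarrow>
        L2_norm \<pi> (transition_op P f) \<le> a)"

definition uniformly_integrable :: "'s measure \<Rightarrow> ('s \<Rightarrow> real) set \<Rightarrow> bool" where
  "uniformly_integrable \<pi> G \<longleftrightarrow>
     G \<subseteq> borel_measurable \<pi> \<and>
     ((\<lambda>K::real. SUP g\<in>G. \<integral>\<^sup>+x. ennreal \<bar>g x\<bar> * indicator {x. \<bar>g x\<bar> > K} x \<partial>\<pi>) \<longlongrightarrow> 0) at_top"

definition L2_uniformly_integrable_op :: "('s \<Rightarrow> 's measure) \<Rightarrow> 's measure \<Rightarrow> bool" where
  "L2_uniformly_integrable_op P \<pi> \<longleftrightarrow>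
     uniformly_integrable \<pi>
       {(\<lambda>x. \<bar>transition_op P f x\<bar>\<^sup>2) | f. f \<in> L2 \<pi> \<and> L2_norm \<pi> f \<le> 1}"


section \<open>Homogeneous Markov chains\<close>

definition natural_filtration ::
    "'a measure \<Rightarrow> 's measure \<Rightarrow> (nat \<Rightarrow> 'a \<Rightarrow> 's) \<Rightarrow> nat \<Rightarrow> 'a measure" where
  "natural_filtration M S X n =
     sigma (space M) {X j -` A \<inter> space M | j A. j \<le> n \<and> A \<in> sets S}"

definition homogeneous_markov_chain ::
    "'a measure \<Rightarrow> 's measure \<Rightarrow> ('s \<Rightarrow> 's measure) \<Rightarrow> (nat \<Rightarrow> 'a \<Rightarrow> 's) \<Rightarrow> bool" where
  "homogeneous_markov_chain M S P X \<longleftrightarrow>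
     (\<forall>n. X n \<in> M \<rightarrow>\<^sub>M S) \<and>
     (\<forall>n. \<forall>A\<in>sets S. AE \<omega> in M.
        real_cond_exp M (natural_filtration M S X n)
          (\<lambda>\<omega>. indicator A (X (Suc n) \<omega>)) \<omega> = measure (P (X n \<omega>)) A)"


section \<open>Stable laws and their domains of attraction\<close>

definition stable_levy_measure :: "real \<Rightarrow> real \<Rightarrow> real \<Rightarrow> real measure" where
  "stable_levy_measure \<alpha> cp cm =
     density lborel (\<lambda>x. ennreal (\<alpha> *
       (cp * x powr (-(\<alpha> + 1)) * indicator {0<..} x +
        cm * \<bar>x\<bar> powr (-(\<alpha> + 1)) * indicator {..<0} x)))"

text \<open>
  For \<open>\<alpha> = 1\<close> the exponent is meant for \<open>cp = cm\<close> only: it is the value of the principal-value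
  integral of \<open>exp (\<i> \<theta> x) - 1\<close>, whose imaginary part cancels by symmetry.
\<close>
definition stable_exponent :: "real \<Rightarrow> real \<Rightarrow> real \<Rightarrow> real \<Rightarrow> complex" where
  "stable_exponent \<alpha> cp cm \<theta> =
     (if \<alpha> < 1 then (CLINT x | stable_levy_measure \<alpha> cp cm. iexp (\<theta> * x) - 1)
      else if \<alpha> = 1 then
        complex_of_real (LINT x | stable_levy_measure \<alpha> cp cm. cos (\<theta> * x) - 1)
      else (CLINT x | stable_levy_measure \<alpha> cp cm.
              iexp (\<theta> * x) - 1 - \<i> * complex_of_real (\<theta> * x)))"

definition is_stable_law :: "real \<Rightarrow> real \<Rightarrow> real \<Rightarrow> real measure \<Rightarrow> bool" where
  "is_stable_law \<alpha> cp cm \<mu> \<longleftrightarrow>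
     real_distribution \<mu> \<and> (\<forall>\<theta>. char \<mu> \<theta> = exp (stable_exponent \<alpha> cp cm \<theta>))"

definition slowly_varying :: "(real \<Rightarrow> real) \<Rightarrow> bool" where
  "slowly_varying l \<longleftrightarrow>
     (\<forall>\<^sub>F t in at_top. l t > 0) \<and>
     (\<forall>r>0. ((\<lambda>t. l (r * t) / l t) \<longlongrightarrow> 1) at_top)"

text \<open>
  Attraction without recentring: suitably scaled sums of independent variables with law \<open>\<rho>\<close>
  converge weakly to \<open>\<mu>\<close> itself. For \<open>\<alpha> = 1\<close> this is strictly stronger than regular
  variation and balance of the tails of \<open>\<rho>\<close>, since the truncated means of \<open>\<rho>\<close> may diverge
  even when \<open>cp = cm\<close>.
\<close>
definition in_strict_domain_of_attraction :: "real measure \<Rightarrow> real measure \<Rightarrow> bool" where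
  "in_strict_domain_of_attraction \<rho> \<mu> \<longleftrightarrow>
     (\<exists>a::nat \<Rightarrow> real. (\<forall>n. a n > 0) \<and>
        weak_conv_m
          (\<lambda>n. distr (\<Pi>\<^sub>M j\<in>{1..n}. \<rho>) borel (\<lambda>y. (\<Sum>j=1..n. y j) / a n)) \<mu>)"

end

theory Submission
  imports Defs
begin

text \<open>
  The characteristic function of the normalised sum is an iterate \<open>\<integral> Q\<^sup>n 1 d\<pi>\<close> of the twisted
  operator \<open>Q f = q P (G f)\<close>, where \<open>G = exp (i \<theta> \<Psi> / B\<^sub>n)\<close> and \<open>q\<close> is \<open>1\<close> without centring and
  \<open>exp (- i \<theta> P \<Psi> / B\<^sub>n)\<close> with centring. Write \<open>Q\<^sup>k 1 = m\<^sub>k + r\<^sub>k\<close> with \<open>m\<^sub>k\<close> the mean. By uniform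
  integrability, \<open>P |G - 1|\<close> and \<open>q - 1\<close> are \<open>o(n\<^bsup>-1/2\<^esup>)\<close> in \<open>L\<^sup>2\<close>, although \<open>G - 1\<close> is only
  \<open>O(n\<^bsup>-1/2\<^esup>)\<close>; the spectral gap makes \<open>r\<^sub>k\<close> of size \<open>o(n\<^bsup>-1/2\<^esup>)\<close> uniformly in \<open>k\<close>, and therefore
  \<open>m\<^sub>k\<^sub>+\<^sub>1 = \<lambda> m\<^sub>k + o(1/n)\<close> with \<open>\<lambda> = \<integral> q P G d\<pi>\<close>. Hence the characteristic function is
  \<open>\<lambda>\<^sup>n + o(1)\<close>, and its limit is found from the tails of \<open>\<Psi>\<close> alone, as in the independent case.
\<close>

section \<open>Integration against kernels\<close>

text \<open>No perturbation theory of a leading eigenvalue is used. The distance between the mean of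
  an iterate and \<open>lam ^ k\<close> grows per step by at most a product of two \<open>L2\<close>
  norms, one of order \<open>n powr (-1/2)\<close> coming from \<open>G - 1\<close>, the other of
  smaller order; after \<open>n\<close> steps the error is still null. The spectral gap alone would
  make both factors of the same order and leave a bounded error, so the smaller order must come from
  uniform integrability. For \<alpha> > 1 the centring \<open>Op \<Psi>\<close> need not be square
  integrable, and its size is measured by \<open>min (u^2) \<bar>u\<bar>\<close> instead of
  \<open>u^2\<close>. Scaled integrals of a test function are computed by writing the function as
  the integral of its derivative and exchanging the order of integration; tail ratios then converge
  pointwise and are dominated by a Potter bound. For \<alpha> = 1 the tail conditions leave the
  truncated means of \<Psi> undetermined. The attraction hypothesis controls them, but with a
  norming of its own that has to be compared with \<open>B\<close>.\<close>

lemma bind_integral: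
  fixes f :: "'s \<Rightarrow> 'b::{banach, second_countable_topology}"
  assumes K: "K \<in> M \<rightarrow>\<^sub>M prob_algebra S" and ne: "space M \<noteq> {}"
    and f: "integrable (M \<bind> K) f"
  shows "(AE x in M. integrable (K x) f) \<and> integrable M (\<lambda>x. \<integral>y. f y \<partial>K x) \<and>
    (\<integral>y. f y \<partial>(M \<bind> K)) = (\<integral>x. \<integral>y. f y \<partial>K x \<partial>M)"
proof -
  have Ks: "K \<in> M \<rightarrow>\<^sub>M subprob_algebra S"
    by (rule measurable_prob_algebraD[OF K])
  have sets_MK: "sets (M \<bind> K) = sets S"
    by (rule sets_bind_measurable[OF Ks ne])
  have Kx: "sets (K x) = sets S" "prob_space (K x)" if "x \<in> space M" for x
    using measurable_space[OF K that] by (auto simp: space_prob_algebra)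
  \<comment> \<open>Tonelli for the norm, outside the induction: it settles integrability at once
    and supplies the dominating function for the limit case.\<close>
  have AE_int: "(AE x in M. integrable (K x) g) \<and> integrable M (\<lambda>x. \<integral>y. norm (g y) \<partial>K x)"
    if g: "integrable (M \<bind> K) g" for g :: "'s \<Rightarrow> 'b"
  proof -
    have gm: "g \<in> borel_measurable S"
      using borel_measurable_integrable[OF g] by (simp cong: measurable_cong_sets add: sets_MK)
    have fin: "(\<integral>\<^sup>+x. \<integral>\<^sup>+y. ennreal (norm (g y)) \<partial>K x \<partial>M) < \<infinity>"
      using g gm by (subst nn_integral_bind[OF _ Ks, symmetric]) (auto simp: integrable_iff_bounded)
    have mm: "(\<lambda>x. \<integral>\<^sup>+y. ennreal (norm (g y)) \<partial>K x) \<in> borel_measurable M"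
      by (rule measurable_compose[OF Ks nn_integral_measurable_subprob_algebra]) (use gm in simp)
    have mm': "(\<lambda>x. \<integral>y. norm (g y) \<partial>K x) \<in> borel_measurable M"
      by (rule measurable_compose[OF Ks integral_measurable_subprob_algebra]) (use gm in simp)
    have "AE x in M. (\<integral>\<^sup>+y. ennreal (norm (g y)) \<partial>K x) \<noteq> \<infinity>"
      using fin by (intro nn_integral_noteq_infinite mm) auto
    then have ae: "AE x in M. integrable (K x) g"
    proof (rule AE_mp, intro AE_I2 impI)
      fix x assume "x \<in> space M" "(\<integral>\<^sup>+y. ennreal (norm (g y)) \<partial>K x) \<noteq> \<infinity>"
      then show "integrable (K x) g"
        using gm Kx(1)[of x] by (auto simp: integrable_iff_bounded top.not_eq_extremum cong: measurable_cong_sets)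
    qed
    have "integrable M (\<lambda>x. \<integral>y. norm (g y) \<partial>K x)"
    proof (rule integrableI_bounded[OF mm'])
      have "(\<integral>\<^sup>+x. ennreal (norm (\<integral>y. norm (g y) \<partial>K x)) \<partial>M) =
          (\<integral>\<^sup>+x. \<integral>\<^sup>+y. ennreal (norm (g y)) \<partial>K x \<partial>M)"
      proof (rule nn_integral_cong_AE, use ae in eventually_elim)
        fix x assume "integrable (K x) g"
        then show "ennreal (norm (\<integral>y. norm (g y) \<partial>K x)) = (\<integral>\<^sup>+y. ennreal (norm (g y)) \<partial>K x)"
          by (simp add: nn_integral_eq_integral)
      qed
      then show "(\<integral>\<^sup>+x. ennreal (norm (\<integral>y. norm (g y) \<partial>K x)) \<partial>M) < \<infinity>"
        using fin by simp
    qed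
    with ae show ?thesis by simp
  qed
  from f show ?thesis
  \<comment> \<open>Almost sure integrability of the inner function is carried along with the
    formula: where it fails, the inner Bochner integral is 0 by convention and additivity would be
    lost.\<close>
  proof (induct rule: integrable_induct)
    case (base A c)
    have A: "A \<in> sets S" using base sets_MK by simp
    have fin: "emeasure (M \<bind> K) A \<noteq> \<infinity>" using base by auto
    have i: "integrable (M \<bind> K) (\<lambda>x. indicator A x *\<^sub>R c)"
      using base by simp
    have "(\<integral>y. indicator A y *\<^sub>R c \<partial>K x) = measure (K x) A *\<^sub>R c" if "x \<in> space M" for x
      using A Kx[OF that] by (simp add: finite_measure.emeasure_finite[OF prob_space.finite_measure] top.not_eq_extremum[symmetric])
    then have eq: "x \<in> space M \<Longrightarrow> (\<integral>y. indicator A y *\<^sub>R c \<partial>K x) = measure (K x) A *\<^sub>R c" for x by simp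
    have em: "emeasure (M \<bind> K) A = (\<integral>\<^sup>+x. measure (K x) A \<partial>M)"
      using Kx by (subst emeasure_bind[OF ne Ks A])
        (auto intro!: nn_integral_cong simp: finite_measure.emeasure_eq_measure prob_space.finite_measure)
    have mA: "(\<lambda>x. measure (K x) A) \<in> borel_measurable M"
      by (rule measurable_compose[OF Ks]) (use A in measurable)
    have iA: "integrable M (\<lambda>x. measure (K x) A)"
      using fin em by (intro integrableI_nonneg mA) (auto simp: top.not_eq_extremum)
    have "measure (M \<bind> K) A = (\<integral>x. measure (K x) A \<partial>M)"
      unfolding measure_def em using iA
      by (subst nn_integral_eq_integral) (auto simp flip: measure_def)
    moreover have "A \<inter> space (M \<bind> K) = A"
      using base by (simp add: sets.Int_space_eq2)
    ultimately have "(\<integral>y. indicator A y *\<^sub>R c \<partial>(M \<bind> K)) = (\<integral>x. measure (K x) A *\<^sub>R c \<partial>M)"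
      using iA fin base(1) by (simp add: top.not_eq_extremum)
    moreover have "(\<integral>x. measure (K x) A *\<^sub>R c \<partial>M) = (\<integral>x. \<integral>y. indicator A y *\<^sub>R c \<partial>K x \<partial>M)"
      using eq by (intro Bochner_Integration.integral_cong) auto
    moreover have "integrable M (\<lambda>x. \<integral>y. indicator A y *\<^sub>R c \<partial>K x)"
      using iA eq by (subst Bochner_Integration.integrable_cong[OF refl, of _ _ "\<lambda>x. measure (K x) A *\<^sub>R c"]) auto
    ultimately show ?case
      using AE_int[OF i] by simp
  next
    case (add f g)
    have "AE x in M. integrable (K x) f" "AE x in M. integrable (K x) g"
      using add by blast+
    then have ae: "AE x in M. (\<integral>y. f y + g y \<partial>K x) = (\<integral>y. f y \<partial>K x) + (\<integral>y. g y \<partial>K x)"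
      by eventually_elim simp
    have m: "(\<lambda>x. \<integral>y. f y + g y \<partial>K x) \<in> borel_measurable M"
      by (rule measurable_compose[OF Ks integral_measurable_subprob_algebra])
        (use borel_measurable_integrable[OF add(1)] borel_measurable_integrable[OF add(3)] sets_MK
         in \<open>simp cong: measurable_cong_sets\<close>)
    have m2: "(\<lambda>x. (\<integral>y. f y \<partial>K x) + (\<integral>y. g y \<partial>K x)) \<in> borel_measurable M"
      using add by auto
    show ?case
      using AE_int[of "\<lambda>x. f x + g x"] add integrable_cong_AE[OF m m2 ae] integral_cong_AE[OF m m2 ae]
      by simp
  next
    case (lim f s)
    note si = lim(1) and lims = lim(3) and bnd = lim(4) and fi = lim(5)
    have fm: "f \<in> borel_measurable S"
      using borel_measurable_integrable[OF fi] by (simp cong: measurable_cong_sets add: sets_MK)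
    have sm: "s i \<in> borel_measurable S" for i
      using borel_measurable_integrable[OF si, of i] by (simp cong: measurable_cong_sets add: sets_MK)
    have sp: "space (M \<bind> K) = space S" by (rule sets_eq_imp_space_eq[OF sets_MK])
    have aes: "AE x in M. \<forall>i. integrable (K x) (s i)"
      using lim(2) by (simp add: AE_all_countable)
    have mI: "(\<lambda>x. \<integral>y. h y \<partial>K x) \<in> borel_measurable M" if "h \<in> borel_measurable S" for h :: "'s \<Rightarrow> 'b"
      by (rule measurable_compose[OF Ks integral_measurable_subprob_algebra]) (rule that)
    \<comment> \<open>The factor 2 is the domination of \<open>s i\<close> by \<open>f\<close> that
      the limit case of the induction rule provides.\<close>
    have conv: "(\<lambda>i. \<integral>y. s i y \<partial>K x) \<longlonglongrightarrow> (\<integral>y. f y \<partial>K x)"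
      and bd: "norm (\<integral>y. s i y \<partial>K x) \<le> (\<integral>y. 2 * norm (f y) \<partial>K x)"
      if x: "x \<in> space M" and ii: "integrable (K x) f" and si': "\<forall>i. integrable (K x) (s i)" for x i
    proof -
      have spx: "space (K x) = space S" by (rule sets_eq_imp_space_eq[OF Kx(1)[OF x]])
      show "(\<lambda>i. \<integral>y. s i y \<partial>K x) \<longlonglongrightarrow> (\<integral>y. f y \<partial>K x)"
        by (rule integral_dominated_convergence[where w = "\<lambda>y. 2 * norm (f y)"])
          (use ii si' lims bnd sp spx in \<open>auto intro!: AE_I2 borel_measurable_integrable\<close>)
      have "norm (\<integral>y. s i y \<partial>K x) \<le> (\<integral>y. norm (s i y) \<partial>K x)"
        by (rule integral_norm_bound)
      also have "\<dots> \<le> (\<integral>y. 2 * norm (f y) \<partial>K x)"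
        by (rule integral_mono) (use ii si' bnd sp spx in auto)
      finally show "norm (\<integral>y. s i y \<partial>K x) \<le> (\<integral>y. 2 * norm (f y) \<partial>K x)" .
    qed
    have w: "integrable M (\<lambda>x. \<integral>y. 2 * norm (f y) \<partial>K x)"
      using AE_int[OF fi] by simp
    have aef: "AE x in M. integrable (K x) f" using AE_int[OF fi] by simp
    have c: "AE x in M. (\<lambda>i. \<integral>y. s i y \<partial>K x) \<longlonglongrightarrow> (\<integral>y. f y \<partial>K x)"
      using aef aes AE_space by eventually_elim (rule conv)
    have b: "AE x in M. norm (\<integral>y. s i y \<partial>K x) \<le> (\<integral>y. 2 * norm (f y) \<partial>K x)" for i
      using aef aes AE_space by eventually_elim (rule bd)
    note dc = mI[OF fm] mI[OF sm] w c b
    have I: "integrable M (\<lambda>x. \<integral>y. f y \<partial>K x)"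
      by (rule integrable_dominated_convergence[OF dc])
    have L1: "(\<lambda>i. \<integral>x. \<integral>y. s i y \<partial>K x \<partial>M) \<longlonglongrightarrow> (\<integral>x. \<integral>y. f y \<partial>K x \<partial>M)"
      by (rule integral_dominated_convergence[OF dc])
    have L2: "(\<lambda>i. \<integral>y. s i y \<partial>(M \<bind> K)) \<longlonglongrightarrow> (\<integral>y. f y \<partial>(M \<bind> K))"
      by (rule integral_dominated_convergence[where w = "\<lambda>y. 2 * norm (f y)"])
        (use fi si lims bnd in \<open>auto intro!: AE_I2 borel_measurable_integrable\<close>)
    have "(\<integral>y. s i y \<partial>(M \<bind> K)) = (\<integral>x. \<integral>y. s i y \<partial>K x \<partial>M)" for i
      using lim(2) by simp
    then have "(\<integral>y. f y \<partial>(M \<bind> K)) = (\<integral>x. \<integral>y. f y \<partial>K x \<partial>M)"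
      using LIMSEQ_unique[OF L1] L2 by simp
    then show ?case using I aef by simp
  qed
qed

lemma integral_Cauchy_Schwarz:
  fixes f g :: "'a \<Rightarrow> real"
  assumes [measurable]: "f \<in> borel_measurable M" "g \<in> borel_measurable M"
    and f2: "integrable M (\<lambda>x. (f x)\<^sup>2)" and g2: "integrable M (\<lambda>x. (g x)\<^sup>2)"
  shows "integrable M (\<lambda>x. f x * g x)"
    and "\<bar>\<integral>x. f x * g x \<partial>M\<bar> \<le> sqrt (\<integral>x. (f x)\<^sup>2 \<partial>M) * sqrt (\<integral>x. (g x)\<^sup>2 \<partial>M)"
proof -
  have ineq: "2 * \<bar>a * b\<bar> \<le> a\<^sup>2 + b\<^sup>2" for a b :: real
    using sum_squares_bound[of "\<bar>a\<bar>" "\<bar>b\<bar>"] by (simp add: abs_mult)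
  show fg: "integrable M (\<lambda>x. f x * g x)"
    by (rule Bochner_Integration.integrable_bound[OF Bochner_Integration.integrable_add[OF f2 g2]])
      (auto intro!: AE_I2, use ineq in \<open>smt (verit) zero_le_power2\<close>)
  define F G I where "F = (\<integral>x. (f x)\<^sup>2 \<partial>M)" "G = (\<integral>x. (g x)\<^sup>2 \<partial>M)" "I = (\<integral>x. f x * g x \<partial>M)"
  have pos: "F \<ge> 0" "G \<ge> 0" unfolding F_G_I_def by (auto intro!: integral_nonneg_AE)
  \<comment> \<open>The quadratic form of the squared norm of \<open>s * f + t * g\<close>. The
    choice \<open>(G, -I)\<close> gives the inequality when \<open>G > 0\<close>.\<close>
  have q: "0 \<le> s\<^sup>2 * F + 2 * s * t * I + t\<^sup>2 * G" for s t
  proof -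
    have "0 \<le> (\<integral>x. (s * f x + t * g x)\<^sup>2 \<partial>M)" by (auto intro!: integral_nonneg_AE)
    also have "\<dots> = (\<integral>x. s\<^sup>2 * (f x)\<^sup>2 + 2 * s * t * (f x * g x) + t\<^sup>2 * (g x)\<^sup>2 \<partial>M)"
      by (intro Bochner_Integration.integral_cong) (auto simp: power2_eq_square algebra_simps)
    also have "\<dots> = s\<^sup>2 * F + 2 * s * t * I + t\<^sup>2 * G"
      using f2 g2 fg unfolding F_G_I_def by simp
    finally show ?thesis .
  qed
  have "I\<^sup>2 \<le> F * G"
  proof (cases "G = 0")
    case True
    show ?thesis
    proof (cases "I = 0")
      case False
      \<comment> \<open>For \<open>G = 0\<close> the form is affine in \<open>t\<close>; this
        \<open>t\<close> would make its value \<open>-1\<close>, so \<open>I\<close> must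
        vanish.\<close>
      have "0 \<le> F + 2 * (- (F + 1) / (2 * I)) * I"
        using q[of 1 "- (F + 1) / (2 * I)"] True by simp
      also have "\<dots> = - 1" using False by (simp add: field_simps)
      finally show ?thesis by simp
    qed (use pos in auto)
  next
    case False
    then have "G > 0" using pos by simp
    have "0 \<le> G * (F * G - I\<^sup>2)"
      using q[of G "-I"] by (simp add: power2_eq_square algebra_simps)
    then show ?thesis using \<open>G > 0\<close> by (simp add: zero_le_mult_iff)
  qed
  then have "\<bar>I\<bar> \<le> sqrt (F * G)"
    by (simp add: real_le_rsqrt)
  then show "\<bar>\<integral>x. f x * g x \<partial>M\<bar> \<le> sqrt (\<integral>x. (f x)\<^sup>2 \<partial>M) * sqrt (\<integral>x. (g x)\<^sup>2 \<partial>M)"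
    by (simp add: F_G_I_def real_sqrt_mult)
qed

section \<open>Spectral gap and uniform integrability\<close>

locale stationary_kernel =
  fixes S :: "'s measure" and P :: "'s \<Rightarrow> 's measure" and \<pi> :: "'s measure"
  assumes kernel: "P \<in> S \<rightarrow>\<^sub>M prob_algebra S"
    and stationary: "stationary_for S P \<pi>"
begin

abbreviation Op :: "('s \<Rightarrow> 'b::{banach, second_countable_topology}) \<Rightarrow> 's \<Rightarrow> 'b" where
  "Op f \<equiv> (\<lambda>x. \<integral>y. f y \<partial>P x)"

lemma sets_pi [measurable_cong]: "sets \<pi> = sets S"
  and prob_pi: "prob_space \<pi>"
  using stationary by (auto simp: stationary_for_def space_prob_algebra)

sublocale prob_space \<pi> by (rule prob_pi)

lemma space_pi: "space \<pi> = space S"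
  by (rule sets_eq_imp_space_eq[OF sets_pi])

lemma kernel_sub [measurable]: "P \<in> S \<rightarrow>\<^sub>M subprob_algebra S"
  by (rule measurable_prob_algebraD[OF kernel])

lemma P_prob: "x \<in> space S \<Longrightarrow> prob_space (P x)"
  and P_sets: "x \<in> space S \<Longrightarrow> sets (P x) = sets S"
  using measurable_space[OF kernel] by (auto simp: space_prob_algebra)

lemma P_space: "x \<in> space S \<Longrightarrow> space (P x) = space S"
  by (rule sets_eq_imp_space_eq[OF P_sets])

text \<open>Stationarity as a fixed point of the bind, the form in which
  \<open>bind_integral\<close> applies to \<open>Op\<close>.\<close>

lemma pi_bind: "\<pi> \<bind> P = \<pi>"
proof (rule measure_eqI)
  have K: "P \<in> \<pi> \<rightarrow>\<^sub>M subprob_algebra S" by measurable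
  show sets: "sets (\<pi> \<bind> P) = sets \<pi>"
    using sets_bind_measurable[OF K not_empty] sets_pi by simp
  show "emeasure (\<pi> \<bind> P) A = emeasure \<pi> A" if "A \<in> sets (\<pi> \<bind> P)" for A
    using that stationary sets sets_pi
    by (subst emeasure_bind[OF not_empty K]) (auto simp: stationary_for_def)
qed

lemma Op_measurable [measurable]:
  "f \<in> borel_measurable S \<Longrightarrow> Op f \<in> borel_measurable S"
  by (rule measurable_compose[OF kernel_sub integral_measurable_subprob_algebra])

lemma Op_integrable:
  assumes "integrable \<pi> f"
  shows "AE x in \<pi>. integrable (P x) f" "integrable \<pi> (Op f)" "(\<integral>x. Op f x \<partial>\<pi>) = (\<integral>x. f x \<partial>\<pi>)"
proof -
  have K: "P \<in> \<pi> \<rightarrow>\<^sub>M prob_algebra S"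
    using kernel by (simp cong: measurable_cong_sets add: sets_pi)
  show "AE x in \<pi>. integrable (P x) f" "integrable \<pi> (Op f)" "(\<integral>x. Op f x \<partial>\<pi>) = (\<integral>x. f x \<partial>\<pi>)"
    using bind_integral[OF K not_empty, of f] assms by (auto simp: pi_bind)
qed

lemma bounded_integrable:
  fixes f :: "'s \<Rightarrow> 'b::{banach, second_countable_topology}"
  assumes "f \<in> borel_measurable S" "\<And>x. x \<in> space S \<Longrightarrow> norm (f x) \<le> b"
  shows "integrable \<pi> f"
  by (rule integrable_const_bound[of _ b]) (use assms space_pi in \<open>auto cong: measurable_cong_sets simp: sets_pi\<close>)

lemma bounded_integrable_P:
  fixes f :: "'s \<Rightarrow> 'b::{banach, second_countable_topology}"
  assumes "x \<in> space S" "f \<in> borel_measurable S" "\<And>x. x \<in> space S \<Longrightarrow> norm (f x) \<le> b"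
  shows "integrable (P x) f"
proof -
  interpret px: prob_space "P x" by (rule P_prob[OF assms(1)])
  show ?thesis
    by (rule px.integrable_const_bound[of _ b])
      (use assms P_space P_sets in \<open>auto cong: measurable_cong_sets\<close>)
qed

lemma Op_bounded:
  fixes f :: "'s \<Rightarrow> 'b::{banach, second_countable_topology}"
  assumes x: "x \<in> space S" and f: "f \<in> borel_measurable S" "\<And>x. x \<in> space S \<Longrightarrow> norm (f x) \<le> b"
  shows "norm (Op f x) \<le> b"
proof -
  interpret px: prob_space "P x" by (rule P_prob[OF x])
  have "norm (Op f x) \<le> (\<integral>y. norm (f y) \<partial>P x)" by (rule integral_norm_bound)
  also have "\<dots> \<le> (\<integral>y. b \<partial>P x)"
    by (rule integral_mono) (use bounded_integrable_P[OF assms] P_space[OF x] f in auto)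
  finally show ?thesis by (simp add: px.prob_space)
qed

lemma square_bound: "\<bar>z\<bar> \<le> b \<Longrightarrow> norm (z\<^sup>2) \<le> b\<^sup>2" for z b :: real
  by (metis abs_ge_zero norm_power power_mono real_norm_def)

text \<open>Pointwise Jensen, read off from the non-negative variance of \<open>f\<close> under
  \<open>P x\<close>, followed by stationarity. The bound \<open>b\<close> secures
  integrability.\<close>

lemma Op_square_le:
  fixes f :: "'s \<Rightarrow> real"
  assumes f: "f \<in> borel_measurable S" "\<And>x. x \<in> space S \<Longrightarrow> \<bar>f x\<bar> \<le> b"
  shows "(\<integral>x. (Op f x)\<^sup>2 \<partial>\<pi>) \<le> (\<integral>x. (f x)\<^sup>2 \<partial>\<pi>)"
proof -
  have f2: "(\<lambda>x. (f x)\<^sup>2) \<in> borel_measurable S" "\<And>x. x \<in> space S \<Longrightarrow> norm ((f x)\<^sup>2) \<le> b\<^sup>2"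
    using f square_bound by auto
  have i2: "integrable \<pi> (\<lambda>x. (f x)\<^sup>2)" by (rule bounded_integrable[OF f2])
  have "(\<integral>x. (Op f x)\<^sup>2 \<partial>\<pi>) \<le> (\<integral>x. Op (\<lambda>y. (f y)\<^sup>2) x \<partial>\<pi>)"
  proof (rule integral_mono)
    show "integrable \<pi> (\<lambda>x. (Op f x)\<^sup>2)"
      by (rule bounded_integrable[of _ "b\<^sup>2"]) (use f Op_bounded[of _ f b] square_bound in auto)
    fix x assume "x \<in> space \<pi>"
    then have x: "x \<in> space S" by (simp add: space_pi)
    interpret px: prob_space "P x" by (rule P_prob[OF x])
    have "0 \<le> (\<integral>y. (f y - Op f x)\<^sup>2 \<partial>P x)" by (auto intro!: integral_nonneg_AE)
    also have "\<dots> = Op (\<lambda>y. (f y)\<^sup>2) x - (Op f x)\<^sup>2"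
      using bounded_integrable_P[OF x f(1)] bounded_integrable_P[OF x f2] f(2)
      by (intro px.variance_eq) auto
    finally show "(Op f x)\<^sup>2 \<le> Op (\<lambda>y. (f y)\<^sup>2) x" by simp
  qed (rule Op_integrable[OF i2])
  then show ?thesis by (simp add: Op_integrable[OF i2])
qed

text \<open>Scales the gap from the unit ball to all bounded centred functions. Dividing by every
  \<open>s\<close> above the norm and letting \<open>s\<close> decrease to it avoids a division by
  zero when \<open>f\<close> vanishes almost everywhere.\<close>

lemma spectral_gap_contraction:
  assumes "L2_spectral_gap P \<pi>"
  obtains a where "0 \<le> a" "a < 1"
    "\<And>(f :: 's \<Rightarrow> real) b. f \<in> borel_measurable S \<Longrightarrow> (\<And>x. x \<in> space S \<Longrightarrow> \<bar>f x\<bar> \<le> b) \<Longrightarrow> (\<integral>x. f x \<partial>\<pi>) = 0 \<Longrightarrow>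
      (\<integral>x. (Op f x)\<^sup>2 \<partial>\<pi>) \<le> a\<^sup>2 * (\<integral>x. (f x)\<^sup>2 \<partial>\<pi>)"
proof -
  from assms obtain a0 where a0: "a0 < 1" and gap: "\<And>f. f \<in> L2 \<pi> \<Longrightarrow> (\<integral>x. f x \<partial>\<pi>) = 0 \<Longrightarrow>
      L2_norm \<pi> f \<le> 1 \<Longrightarrow> L2_norm \<pi> (transition_op P f) \<le> a0"
    unfolding L2_spectral_gap_def by blast
  define a where "a = max a0 0"
  show ?thesis
  proof (rule that[of a])
    show "0 \<le> a" "a < 1" using a0 by (auto simp: a_def)
    fix f :: "'s \<Rightarrow> real" and b
    assume f: "f \<in> borel_measurable S" "\<And>x. x \<in> space S \<Longrightarrow> \<bar>f x\<bar> \<le> b" and f0: "(\<integral>x. f x \<partial>\<pi>) = 0"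
    have i2: "integrable \<pi> (\<lambda>x. (f x)\<^sup>2)"
      by (rule bounded_integrable[of _ "b\<^sup>2"]) (use f square_bound in auto)
    have s: "L2_norm \<pi> (Op f) \<le> a * s" if "s > L2_norm \<pi> f" for s
    proof -
      have "0 \<le> L2_norm \<pi> f" by (auto simp: L2_norm_def intro!: integral_nonneg_AE)
      then have s0: "s > 0" using that by simp
      have "L2_norm \<pi> (transition_op P (\<lambda>x. f x / s)) \<le> a0"
      proof (rule gap)
        show "(\<lambda>x. f x / s) \<in> L2 \<pi>"
          using f i2 by (auto simp: L2_def power_divide cong: measurable_cong_sets simp: sets_pi)
        show "(\<integral>x. f x / s \<partial>\<pi>) = 0" using f0 by simp
        show "L2_norm \<pi> (\<lambda>x. f x / s) \<le> 1"
          using that s0 by (simp add: L2_norm_def power_divide real_sqrt_divide)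
      qed
      also have "L2_norm \<pi> (transition_op P (\<lambda>x. f x / s)) = L2_norm \<pi> (Op f) / s"
        using s0 by (simp add: L2_norm_def transition_op_def power_divide real_sqrt_divide)
      finally have "L2_norm \<pi> (Op f) \<le> a0 * s" using s0 by (simp add: field_simps)
      also have "\<dots> \<le> a * s" using s0 by (simp add: a_def)
      finally show ?thesis .
    qed
    have "L2_norm \<pi> (Op f) \<le> a * L2_norm \<pi> f"
    proof (rule tendsto_lowerbound)
      show "((\<lambda>s. a * s) \<longlongrightarrow> a * L2_norm \<pi> f) (at_right (L2_norm \<pi> f))"
        by (intro tendsto_intros)
      show "\<forall>\<^sub>F s in at_right (L2_norm \<pi> f). L2_norm \<pi> (Op f) \<le> a * s"
        using s by (auto simp: eventually_at_right_field intro: gt_ex)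
    qed simp
    then have "(L2_norm \<pi> (Op f))\<^sup>2 \<le> (a * L2_norm \<pi> f)\<^sup>2"
      by (intro power_mono) (auto simp: L2_norm_def intro!: integral_nonneg_AE)
    then show "(\<integral>x. (Op f x)\<^sup>2 \<partial>\<pi>) \<le> a\<^sup>2 * (\<integral>x. (f x)\<^sup>2 \<partial>\<pi>)"
      by (simp add: L2_norm_def power_mult_distrib integral_nonneg_AE)
  qed
qed

lemma Op_Re_Im:
  fixes f :: "'s \<Rightarrow> complex"
  assumes "x \<in> space S" "f \<in> borel_measurable S" "\<And>x. x \<in> space S \<Longrightarrow> norm (f x) \<le> b"
  shows "Op (\<lambda>y. Re (f y)) x = Re (Op f x)" "Op (\<lambda>y. Im (f y)) x = Im (Op f x)"
  using bounded_integrable_P[OF assms] by simp_all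

lemma integral_cmod_power2:
  fixes f :: "'s \<Rightarrow> complex"
  assumes f: "f \<in> borel_measurable S" "\<And>x. x \<in> space S \<Longrightarrow> norm (f x) \<le> b"
  shows "(\<integral>x. (cmod (f x))\<^sup>2 \<partial>\<pi>) = (\<integral>x. (Re (f x))\<^sup>2 \<partial>\<pi>) + (\<integral>x. (Im (f x))\<^sup>2 \<partial>\<pi>)"
proof -
  have "integrable \<pi> (\<lambda>x. (Re (f x))\<^sup>2)"
    by (rule bounded_integrable[of _ "b\<^sup>2"])
      (use f square_bound order_trans[OF abs_Re_le_cmod] in auto)
  moreover have "integrable \<pi> (\<lambda>x. (Im (f x))\<^sup>2)"
    by (rule bounded_integrable[of _ "b\<^sup>2"])
      (use f square_bound order_trans[OF abs_Im_le_cmod] in auto)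
  ultimately show ?thesis by (simp add: cmod_power2)
qed

text \<open>\<open>Op\<close> acts separately on real and imaginary parts and the squared modulus is
  the sum of their squares, so the constant does not deteriorate.\<close>

lemma contraction_complex:
  fixes f :: "'s \<Rightarrow> complex"
  assumes gap: "\<And>(f :: 's \<Rightarrow> real) b. f \<in> borel_measurable S \<Longrightarrow> (\<And>x. x \<in> space S \<Longrightarrow> \<bar>f x\<bar> \<le> b) \<Longrightarrow>
      (\<integral>x. f x \<partial>\<pi>) = 0 \<Longrightarrow> (\<integral>x. (Op f x)\<^sup>2 \<partial>\<pi>) \<le> a\<^sup>2 * (\<integral>x. (f x)\<^sup>2 \<partial>\<pi>)"
    and f: "f \<in> borel_measurable S" "\<And>x. x \<in> space S \<Longrightarrow> norm (f x) \<le> b" and f0: "(\<integral>x. f x \<partial>\<pi>) = 0"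
  shows "(\<integral>x. (cmod (Op f x))\<^sup>2 \<partial>\<pi>) \<le> a\<^sup>2 * (\<integral>x. (cmod (f x))\<^sup>2 \<partial>\<pi>)"
proof -
  have i: "integrable \<pi> f" by (rule bounded_integrable[OF f])
  have "(\<integral>x. (cmod (Op f x))\<^sup>2 \<partial>\<pi>) = (\<integral>x. (Re (Op f x))\<^sup>2 \<partial>\<pi>) + (\<integral>x. (Im (Op f x))\<^sup>2 \<partial>\<pi>)"
    by (rule integral_cmod_power2[OF _ Op_bounded[OF _ f]]) (use f in auto)
  also have "(\<integral>x. (Re (Op f x))\<^sup>2 \<partial>\<pi>) = (\<integral>x. (Op (\<lambda>y. Re (f y)) x)\<^sup>2 \<partial>\<pi>)"
    by (intro Bochner_Integration.integral_cong refl) (simp add: Op_Re_Im[OF _ f] space_pi del: integral_Re)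
  also have "(\<integral>x. (Im (Op f x))\<^sup>2 \<partial>\<pi>) = (\<integral>x. (Op (\<lambda>y. Im (f y)) x)\<^sup>2 \<partial>\<pi>)"
    by (intro Bochner_Integration.integral_cong refl) (simp add: Op_Re_Im[OF _ f] space_pi del: integral_Im)
  also have "(\<integral>x. (Op (\<lambda>y. Re (f y)) x)\<^sup>2 \<partial>\<pi>) \<le> a\<^sup>2 * (\<integral>x. (Re (f x))\<^sup>2 \<partial>\<pi>)"
    by (rule gap[of _ b]) (use f order_trans[OF abs_Re_le_cmod] f0 i in auto)
  also have "(\<integral>x. (Op (\<lambda>y. Im (f y)) x)\<^sup>2 \<partial>\<pi>) \<le> a\<^sup>2 * (\<integral>x. (Im (f x))\<^sup>2 \<partial>\<pi>)"
    by (rule gap[of _ b]) (use f order_trans[OF abs_Im_le_cmod] f0 i in auto)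
  finally have "(\<integral>x. (cmod (Op f x))\<^sup>2 \<partial>\<pi>) \<le> a\<^sup>2 * ((\<integral>x. (Re (f x))\<^sup>2 \<partial>\<pi>) + (\<integral>x. (Im (f x))\<^sup>2 \<partial>\<pi>))"
    by (simp add: distrib_left)
  then show ?thesis
    by (subst integral_cmod_power2[of f, OF f])
qed

lemma variance_complex:
  fixes f :: "'s \<Rightarrow> complex"
  assumes f: "f \<in> borel_measurable S" "\<And>x. x \<in> space S \<Longrightarrow> norm (f x) \<le> b"
  shows "(\<integral>x. (cmod (f x - (\<integral>x. f x \<partial>\<pi>)))\<^sup>2 \<partial>\<pi>) \<le> (\<integral>x. (cmod (f x))\<^sup>2 \<partial>\<pi>)"
proof -
  have i: "integrable \<pi> f" by (rule bounded_integrable[OF f])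
  have var: "(\<integral>x. (g x - (\<integral>x. g x \<partial>\<pi>))\<^sup>2 \<partial>\<pi>) \<le> (\<integral>x. (g x)\<^sup>2 \<partial>\<pi>)"
    if g: "g \<in> borel_measurable S" "\<And>x. x \<in> space S \<Longrightarrow> \<bar>g x\<bar> \<le> b" for g :: "'s \<Rightarrow> real"
  proof -
    have "integrable \<pi> g" by (rule bounded_integrable) (use g in auto)
    moreover have "integrable \<pi> (\<lambda>x. (g x)\<^sup>2)"
      by (rule bounded_integrable[of _ "b\<^sup>2"]) (use g square_bound in auto)
    ultimately show ?thesis by (subst variance_eq) auto
  qed
  have b: "norm (\<integral>x. f x \<partial>\<pi>) \<le> b"
  proof -
    have "norm (\<integral>x. f x \<partial>\<pi>) \<le> (\<integral>x. b \<partial>\<pi>)"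
      by (rule order_trans[OF integral_norm_bound integral_mono]) (use i f space_pi in auto)
    then show ?thesis by (simp add: prob_space)
  qed
  have bb: "norm (f x - (\<integral>x. f x \<partial>\<pi>)) \<le> b + b" if "x \<in> space S" for x
    using norm_triangle_ineq4 add_mono[OF f(2)[OF that] b] by (rule order_trans)
  have "(\<integral>x. (cmod (f x - (\<integral>x. f x \<partial>\<pi>)))\<^sup>2 \<partial>\<pi>) =
      (\<integral>x. (Re (f x) - (\<integral>x. Re (f x) \<partial>\<pi>))\<^sup>2 \<partial>\<pi>) + (\<integral>x. (Im (f x) - (\<integral>x. Im (f x) \<partial>\<pi>))\<^sup>2 \<partial>\<pi>)"
    using i by (subst integral_cmod_power2[where b = "b + b"])
      (use f bb in auto)
  also have "\<dots> \<le> (\<integral>x. (Re (f x))\<^sup>2 \<partial>\<pi>) + (\<integral>x. (Im (f x))\<^sup>2 \<partial>\<pi>)"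
    by (intro add_mono var)
      (use f order_trans[OF abs_Im_le_cmod] order_trans[OF abs_Re_le_cmod] in auto)
  finally show ?thesis by (subst integral_cmod_power2[of f, OF f])
qed

text \<open>This is where 2-U.I. enters. The square of \<open>Op (g n)\<close> is split at a level
  \<open>K\<close>: above it uniform integrability makes the integral small for all \<open>n\<close>
  at once, below it the square is at most \<open>sqrt K\<close> times the modulus, and
  \<open>Op\<close> does not increase the \<open>L1\<close> norm.\<close>

lemma Op_square_null_of_UI:
  fixes f :: "nat \<Rightarrow> 's \<Rightarrow> real"
  assumes UI: "L2_uniformly_integrable_op P \<pi>"
    and f: "\<And>n. f n \<in> borel_measurable S" "\<And>n x. x \<in> space S \<Longrightarrow> \<bar>f n x\<bar> \<le> b n"
    and C: "\<And>n. (\<integral>x. (f n x)\<^sup>2 \<partial>\<pi>) \<le> C"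
    and L1: "(\<lambda>n. \<integral>x. \<bar>f n x\<bar> \<partial>\<pi>) \<longlonglongrightarrow> 0"
  shows "(\<lambda>n. \<integral>x. (Op (f n) x)\<^sup>2 \<partial>\<pi>) \<longlonglongrightarrow> 0"
proof -
  \<comment> \<open>Division by \<open>sqrt D\<close> moves the family into the unit ball of
    \<open>L2\<close>; the maximum keeps \<open>D\<close> positive.\<close>
  define D where "D = max C 1"
  have D: "D > 0" "\<And>n. (\<integral>x. (f n x)\<^sup>2 \<partial>\<pi>) \<le> D"
    using C by (auto simp: D_def max_def intro: order_trans)
  define g where "g n x = f n x / sqrt D" for n x
  have gm: "g n \<in> borel_measurable S" and gb: "x \<in> space S \<Longrightarrow> \<bar>g n x\<bar> \<le> b n / sqrt D" for n x
    unfolding g_def using f D by (auto simp: divide_right_mono)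
  have g2: "(\<integral>x. (g n x)\<^sup>2 \<partial>\<pi>) \<le> 1" for n
    using D by (simp add: g_def power_divide)
  have gL2: "g n \<in> L2 \<pi>" for n
    unfolding L2_def
    by (auto intro!: bounded_integrable[of _ "(b n / sqrt D)\<^sup>2"] simp: gm measurable_cong_sets[OF sets_pi refl])
       (use gm[of n] gb[of _ n] square_bound in auto)
  have gN: "L2_norm \<pi> (g n) \<le> 1" for n
    using g2[of n] by (simp add: L2_norm_def)
  have Opg: "integrable \<pi> (\<lambda>x. (Op (g n) x)\<^sup>2)" "integrable \<pi> (\<lambda>x. \<bar>Op (g n) x\<bar>)"
    "integrable \<pi> (\<lambda>x. \<bar>g n x\<bar>)" for n
    by (rule bounded_integrable[of _ "(b n / sqrt D)\<^sup>2"] bounded_integrable[of _ "b n / sqrt D"],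
      use gm[of n] gb[of _ n] Op_bounded[of _ "g n" "b n / sqrt D"] square_bound in auto)+
  have gL1: "(\<lambda>n. \<integral>x. \<bar>g n x\<bar> \<partial>\<pi>) \<longlonglongrightarrow> 0"
    using tendsto_divide[OF L1 tendsto_const[of "sqrt D"]] D by (simp add: g_def)
  have OpL1: "(\<integral>x. \<bar>Op (g n) x\<bar> \<partial>\<pi>) \<le> (\<integral>x. \<bar>g n x\<bar> \<partial>\<pi>)" for n
  proof -
    have "(\<integral>x. \<bar>Op (g n) x\<bar> \<partial>\<pi>) \<le> (\<integral>x. Op (\<lambda>y. \<bar>g n y\<bar>) x \<partial>\<pi>)"
      using Opg[of n] by (intro integral_mono Op_integrable integral_abs_bound) auto
    then show ?thesis using Op_integrable[OF Opg(3)] by simp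
  qed
  define Fam where "Fam = {(\<lambda>x. \<bar>transition_op P f x\<bar>\<^sup>2) | f. f \<in> L2 \<pi> \<and> L2_norm \<pi> f \<le> 1}"
  have lim: "((\<lambda>K::real. SUP g\<in>Fam. \<integral>\<^sup>+x. ennreal \<bar>g x\<bar> * indicator {x. \<bar>g x\<bar> > K} x \<partial>\<pi>) \<longlongrightarrow> 0) at_top"
    using UI unfolding L2_uniformly_integrable_op_def uniformly_integrable_def Fam_def by simp
  have "(\<lambda>n. \<integral>x. (Op (g n) x)\<^sup>2 \<partial>\<pi>) \<longlonglongrightarrow> 0"
  proof (rule LIMSEQ_I, goal_cases)
    case (1 e)
    have "\<forall>\<^sub>F K::real in at_top. (SUP g\<in>Fam. \<integral>\<^sup>+x. ennreal \<bar>g x\<bar> * indicator {x. \<bar>g x\<bar> > K} x \<partial>\<pi>) < ennreal (e/2)"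
      using 1 by (intro order_tendstoD[OF lim]) auto
    then have "\<forall>\<^sub>F K::real in at_top. (SUP g\<in>Fam. \<integral>\<^sup>+x. ennreal \<bar>g x\<bar> * indicator {x. \<bar>g x\<bar> > K} x \<partial>\<pi>) < ennreal (e/2) \<and> K > 0"
      using eventually_gt_at_top[of "0::real"] by eventually_elim simp
    from eventually_happens[OF this] obtain K :: real where K: "K > 0" "(SUP g\<in>Fam. \<integral>\<^sup>+x. ennreal \<bar>g x\<bar> * indicator {x. \<bar>g x\<bar> > K} x \<partial>\<pi>) < ennreal (e/2)"
      by auto
    have bd: "(\<integral>x. (Op (g n) x)\<^sup>2 \<partial>\<pi>) \<le> e/2 + sqrt K * (\<integral>x. \<bar>g n x\<bar> \<partial>\<pi>)" for n
    proof -
      have mem: "(\<lambda>x. \<bar>transition_op P (g n) x\<bar>\<^sup>2) \<in> Fam"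
        unfolding Fam_def using gL2[of n] gN[of n] by blast
      let ?T = "\<lambda>x. (Op (g n) x)\<^sup>2"
      have A: "(\<integral>\<^sup>+x. ennreal (?T x) * indicator {x. ?T x > K} x \<partial>\<pi>) \<le> ennreal (e/2)"
        using SUP_upper[OF mem, of "\<lambda>g. \<integral>\<^sup>+x. ennreal \<bar>g x\<bar> * indicator {x. \<bar>g x\<bar> > K} x \<partial>\<pi>"] K(2)
        by (simp add: transition_op_def)
      have iT: "integrable \<pi> (\<lambda>x. ?T x * indicator {x. ?T x > K} x)"
        by (rule Bochner_Integration.integrable_bound[OF Opg(1)[of n]])
          (use gm in \<open>auto simp: indicator_def cong: measurable_cong_sets simp: sets_pi\<close>)
      have "ennreal (\<integral>x. ?T x * indicator {x. ?T x > K} x \<partial>\<pi>) = (\<integral>\<^sup>+x. ennreal (?T x * indicator {x. ?T x > K} x) \<partial>\<pi>)"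
        by (rule nn_integral_eq_integral[symmetric, OF iT]) auto
      also have "\<dots> = (\<integral>\<^sup>+x. ennreal (?T x) * indicator {x. ?T x > K} x \<partial>\<pi>)"
        by (intro nn_integral_cong) (auto simp: indicator_def)
      finally have "ennreal (\<integral>x. ?T x * indicator {x. ?T x > K} x \<partial>\<pi>) \<le> ennreal (e/2)"
        using A by simp
      then have A': "(\<integral>x. ?T x * indicator {x. ?T x > K} x \<partial>\<pi>) \<le> e/2"
        using 1 by (subst (asm) ennreal_le_iff) auto
      have "(\<integral>x. ?T x \<partial>\<pi>) \<le> (\<integral>x. ?T x * indicator {x. ?T x > K} x + sqrt K * \<bar>Op (g n) x\<bar> \<partial>\<pi>)"
      proof (rule integral_mono)
        fix x
        show "?T x \<le> ?T x * indicator {x. ?T x > K} x + sqrt K * \<bar>Op (g n) x\<bar>"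
        proof (cases "?T x > K")
          case False
          then have "\<bar>Op (g n) x\<bar> \<le> sqrt K" by (simp add: real_le_rsqrt)
          then have "\<bar>Op (g n) x\<bar> * \<bar>Op (g n) x\<bar> \<le> sqrt K * \<bar>Op (g n) x\<bar>"
            by (intro mult_right_mono) auto
          then show ?thesis using False by (simp add: power2_eq_square)
        qed (use K in auto)
      qed (use Opg[of n] iT in auto)
      also have "\<dots> = (\<integral>x. ?T x * indicator {x. ?T x > K} x \<partial>\<pi>) + sqrt K * (\<integral>x. \<bar>Op (g n) x\<bar> \<partial>\<pi>)"
        using iT Opg[of n] by simp
      also have "\<dots> \<le> e/2 + sqrt K * (\<integral>x. \<bar>g n x\<bar> \<partial>\<pi>)"
        using A' OpL1[of n] K by (intro add_mono mult_left_mono) auto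
      finally show ?thesis .
    qed
    have "(\<lambda>n. sqrt K * (\<integral>x. \<bar>g n x\<bar> \<partial>\<pi>)) \<longlonglongrightarrow> 0"
      using tendsto_mult[OF tendsto_const gL1] by fastforce
    then have "\<forall>\<^sub>F n in sequentially. sqrt K * (\<integral>x. \<bar>g n x\<bar> \<partial>\<pi>) < e/2"
      using 1 by (intro order_tendstoD) auto
    then obtain N where N: "\<And>n. n \<ge> N \<Longrightarrow> sqrt K * (\<integral>x. \<bar>g n x\<bar> \<partial>\<pi>) < e/2"
      by (auto simp: eventually_sequentially)
    have "norm ((\<integral>x. (Op (g n) x)\<^sup>2 \<partial>\<pi>) - 0) < e" if "n \<ge> N" for n
    proof -
      have "0 \<le> (\<integral>x. (Op (g n) x)\<^sup>2 \<partial>\<pi>)" by (auto intro!: integral_nonneg_AE)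
      then show ?thesis using bd[of n] N[OF that] by simp
    qed
    then show ?case by blast
  qed
  from tendsto_mult[OF this tendsto_const[of D]] show ?thesis
    using D by (simp add: g_def power_divide)
qed

end

section \<open>Iterates of twisted transition operators\<close>

text \<open>For a chain started at \<open>x\<close> this is the expectation of the product of
  \<open>q (X (j - 1)) * G (X j)\<close> over \<open>k\<close> steps. The factor \<open>q\<close>
  stands outside the kernel integral because the centring of a step depends on the state before
  it.\<close>

fun twisted_iter :: "('s \<Rightarrow> 's measure) \<Rightarrow> ('s \<Rightarrow> complex) \<Rightarrow> ('s \<Rightarrow> complex) \<Rightarrow> nat \<Rightarrow> 's \<Rightarrow> complex" where
  "twisted_iter P q G 0 = (\<lambda>_. 1)"
| "twisted_iter P q G (Suc k) = (\<lambda>x. q x * (\<integral>y. G y * twisted_iter P q G k y \<partial>P x))"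

text \<open>Convexity of the square at the points \<open>x / t\<close> and
  \<open>y / (1 - t)\<close> with weights \<open>t\<close> and \<open>1 - t\<close>. With
  \<open>t\<close> close to 1 the cross term costs only a part of the spectral gap.\<close>

lemma weighted_square_sum:
  fixes x y :: real
  assumes "0 < t" "t < 1"
  shows "(x + y)\<^sup>2 \<le> x\<^sup>2 / t + y\<^sup>2 / (1 - t)"
proof -
  have "x\<^sup>2 / t + y\<^sup>2 / (1 - t) - (x + y)\<^sup>2 = (x * (1 - t) - y * t)\<^sup>2 / (t * (1 - t))"
    using assms by (simp add: field_simps power2_eq_square)
  also have "\<dots> \<ge> 0" using assms by simp
  finally show ?thesis by simp
qed

context stationary_kernel
begin

lemma twisted_iter_bounded:
  assumes qm: "q \<in> borel_measurable S" and qb: "\<And>x. x \<in> space S \<Longrightarrow> norm (q x) \<le> 1"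
    and Gm: "G \<in> borel_measurable S" and Gb: "\<And>x. x \<in> space S \<Longrightarrow> norm (G x) \<le> 1"
  shows "twisted_iter P q G k \<in> borel_measurable S \<and> (\<forall>x\<in>space S. norm (twisted_iter P q G k x) \<le> 1)"
proof (induction k)
  case (Suc k)
  have m: "(\<lambda>y. G y * twisted_iter P q G k y) \<in> borel_measurable S" using Suc Gm by auto
  have b: "norm (G x * twisted_iter P q G k x) \<le> 1" if "x \<in> space S" for x
    using Suc Gb that by (auto simp: norm_mult intro!: mult_le_one)
  have "norm (q x * Op (\<lambda>y. G y * twisted_iter P q G k y) x) \<le> 1" if "x \<in> space S" for x
    unfolding norm_mult using qb[OF that] Op_bounded[OF that m b] by (intro mult_le_one) auto
  then show ?case using m qm by simp
qed auto

lemma square_integrable: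
  fixes f :: "'s \<Rightarrow> real"
  assumes "f \<in> borel_measurable S" "\<And>x. x \<in> space S \<Longrightarrow> \<bar>f x\<bar> \<le> b"
  shows "integrable \<pi> (\<lambda>x. (f x)\<^sup>2)"
  by (rule bounded_integrable[of _ "b\<^sup>2"]) (use assms square_bound in auto)

lemma norm_square_integrable:
  fixes f :: "'s \<Rightarrow> 'b::{banach, second_countable_topology}"
  assumes "f \<in> borel_measurable S" "\<And>x. x \<in> space S \<Longrightarrow> norm (f x) \<le> b"
  shows "integrable \<pi> (\<lambda>x. (norm (f x))\<^sup>2)"
  by (rule square_integrable[of _ b]) (use assms in auto)

lemma norm_integral_mult_le:
  fixes f g :: "'s \<Rightarrow> complex"
  assumes f: "f \<in> borel_measurable S" "\<And>x. x \<in> space S \<Longrightarrow> norm (f x) \<le> b"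
    and g: "g \<in> borel_measurable S" "\<And>x. x \<in> space S \<Longrightarrow> norm (g x) \<le> c"
  shows "norm (\<integral>x. f x * g x \<partial>\<pi>) \<le> sqrt (\<integral>x. (norm (f x))\<^sup>2 \<partial>\<pi>) * sqrt (\<integral>x. (norm (g x))\<^sup>2 \<partial>\<pi>)"
proof -
  have fg2: "integrable \<pi> (\<lambda>x. (norm (f x))\<^sup>2)" "integrable \<pi> (\<lambda>x. (norm (g x))\<^sup>2)"
    using norm_square_integrable[OF f] norm_square_integrable[OF g] by auto
  have "norm (\<integral>x. f x * g x \<partial>\<pi>) \<le> (\<integral>x. norm (f x) * norm (g x) \<partial>\<pi>)"
    using integral_norm_bound[of \<pi> "\<lambda>x. f x * g x"] by (simp add: norm_mult)
  also have "\<dots> \<le> \<bar>\<integral>x. norm (f x) * norm (g x) \<partial>\<pi>\<bar>" by simp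
  also have "\<dots> \<le> sqrt (\<integral>x. (norm (f x))\<^sup>2 \<partial>\<pi>) * sqrt (\<integral>x. (norm (g x))\<^sup>2 \<partial>\<pi>)"
    by (rule integral_Cauchy_Schwarz) (use f g fg2 in auto)
  finally show ?thesis .
qed

lemma integral_norm_le_1:
  fixes f :: "'s \<Rightarrow> complex"
  assumes "f \<in> borel_measurable S" "\<And>x. x \<in> space S \<Longrightarrow> norm (f x) \<le> 1"
  shows "norm (\<integral>x. f x \<partial>\<pi>) \<le> 1"
proof -
  have "norm (\<integral>x. f x \<partial>\<pi>) \<le> (\<integral>x. 1 \<partial>\<pi>)"
    by (rule order_trans[OF integral_norm_bound integral_mono])
      (use bounded_integrable[OF assms] assms space_pi in auto)
  then show ?thesis by (simp add: prob_space)
qed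

text \<open>Splitting an iterate into its mean and a centred remainder, the spectral gap keeps the
  remainder of the size of one perturbation step, so that the mean evolves by the factor
  \<open>\<lambda>\<close> up to a product of two small norms.\<close>

lemma twisted_iter_mean:
  assumes a: "0 \<le> a" "a < 1"
    and gap: "\<And>(f :: 's \<Rightarrow> real) b. f \<in> borel_measurable S \<Longrightarrow> (\<And>x. x \<in> space S \<Longrightarrow> \<bar>f x\<bar> \<le> b) \<Longrightarrow>
      (\<integral>x. f x \<partial>\<pi>) = 0 \<Longrightarrow> (\<integral>x. (Op f x)\<^sup>2 \<partial>\<pi>) \<le> a\<^sup>2 * (\<integral>x. (f x)\<^sup>2 \<partial>\<pi>)"
    and qm [measurable]: "q \<in> borel_measurable S" and qb: "\<And>x. x \<in> space S \<Longrightarrow> norm (q x) \<le> 1"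
    and Gm [measurable]: "G \<in> borel_measurable S" and Gb: "\<And>x. x \<in> space S \<Longrightarrow> norm (G x) \<le> 1"
  defines "lam \<equiv> \<integral>x. q x * Op G x \<partial>\<pi>"
    and "Q \<equiv> \<integral>x. (norm (q x - 1))\<^sup>2 \<partial>\<pi>"
    and "U \<equiv> \<integral>x. (Op (\<lambda>y. norm (G y - 1)) x)\<^sup>2 \<partial>\<pi>"
    and "V \<equiv> \<integral>x. (norm (G x - 1))\<^sup>2 \<partial>\<pi>"
  shows "norm ((\<integral>x. twisted_iter P q G k x \<partial>\<pi>) - lam ^ k) \<le>
    real k * ((sqrt Q + sqrt V) * sqrt (8 / (1 - a)\<^sup>2 * (Q + U)))"
proof -
  define v where "v = twisted_iter P q G"
  define m where "m k = (\<integral>x. v k x \<partial>\<pi>)" for k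
  define r where "r k x = v k x - m k" for k x
  define R where "R k = (\<integral>x. (norm (r k x))\<^sup>2 \<partial>\<pi>)" for k
  \<comment> \<open>The difference between a twisted step and a plain step. Since iterates have
    modulus at most 1, it is bounded by
    \<open>norm (q x - 1) + Op (\<lambda>y. norm (G y - 1)) x\<close>, uniformly in
    \<open>k\<close>.\<close>
  define E where "E k x = (q x - 1) * Op (\<lambda>y. G y * v k y) x + Op (\<lambda>y. (G y - 1) * v k y) x" for k x
  \<comment> \<open>The midpoint between \<open>a\<close> and 1: \<open>a^2 / t \<le> t\<close>
    keeps a contraction after \<open>weighted_square_sum\<close>, and
    \<open>1 - t = (1 - a) / 2\<close> produces the constant \<open>8 / (1 - a)^2\<close>.\<close>
  define t where "t = (1 + a) / 2"
  have t: "0 < t" "t < 1" "a \<le> t" using a by (auto simp: t_def)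
  have vm [measurable]: "v k \<in> borel_measurable S"
    and vb: "x \<in> space S \<Longrightarrow> norm (v k x) \<le> 1" for k x
    using twisted_iter_bounded[OF qm qb Gm Gb] unfolding v_def by auto
  have vi: "integrable \<pi> (v k)" for k by (rule bounded_integrable[OF vm vb])
  have mb: "norm (m k) \<le> 1" for k unfolding m_def by (rule integral_norm_le_1[OF vm vb])
  have rm [measurable]: "r k \<in> borel_measurable S" for k unfolding r_def by measurable
  have rb: "norm (r k x) \<le> 2" if "x \<in> space S" for k x
    using norm_triangle_ineq4[of "v k x" "m k"] vb[OF that, of k] mb[of k] by (simp add: r_def)
  have r0: "(\<integral>x. r k x \<partial>\<pi>) = 0" for k
    unfolding r_def using vi[of k] by (simp add: prob_space m_def)
  have Gv: "norm (G x * v k x) \<le> 1" "norm (G x * r k x) \<le> 2" "norm (G x - 1) \<le> 2"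
    "norm ((G x - 1) * v k x) \<le> 2" "norm ((G x - 1) * r k x) \<le> 4" "norm (q x - 1) \<le> 2"
    if "x \<in> space S" for x k
  proof -
    note b = Gb[OF that] vb[OF that, of k] rb[OF that, of k] qb[OF that]
    show g2: "norm (G x - 1) \<le> 2" using norm_triangle_ineq4[of "G x" 1] b by simp
    show "norm (q x - 1) \<le> 2" using norm_triangle_ineq4[of "q x" 1] b by simp
    show "norm (G x * v k x) \<le> 1" unfolding norm_mult using b by (intro mult_le_one) auto
    show "norm (G x * r k x) \<le> 2" unfolding norm_mult using b mult_mono[of "norm (G x)" 1 "norm (r k x)" 2] by simp
    show "norm ((G x - 1) * v k x) \<le> 2" unfolding norm_mult using b g2 mult_mono[of "norm (G x - 1)" 2 "norm (v k x)" 1] by simp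
    show "norm ((G x - 1) * r k x) \<le> 4" unfolding norm_mult using b g2 mult_mono[of "norm (G x - 1)" 2 "norm (r k x)" 2] by simp
  qed
  have Q0: "Q \<ge> 0" "U \<ge> 0" "V \<ge> 0" unfolding Q_def U_def V_def by (auto intro!: integral_nonneg_AE)
  have Em [measurable]: "E k \<in> borel_measurable S" for k unfolding E_def by measurable
  have Eb: "norm (E k x) \<le> norm (q x - 1) + Op (\<lambda>y. norm (G y - 1)) x"
    and vE: "v (Suc k) x = Op (v k) x + E k x" if x: "x \<in> space S" for k x
  proof -
    have i1: "integrable (P x) (\<lambda>y. G y * v k y)"
      by (rule bounded_integrable_P[OF x _ Gv(1)]) auto
    have i2: "integrable (P x) (v k)"
      by (rule bounded_integrable_P[OF x _ vb]) auto
    have i3: "integrable (P x) (\<lambda>y. norm (G y - 1))"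
      by (rule bounded_integrable_P[OF x, of _ 2]) (use Gv(3) in auto)
    have "Op (\<lambda>y. (G y - 1) * v k y) x = Op (\<lambda>y. G y * v k y) x - Op (v k) x"
      using i1 i2 by (simp add: left_diff_distrib)
    then show "v (Suc k) x = Op (v k) x + E k x"
      by (simp add: v_def E_def algebra_simps)
    have A: "norm ((q x - 1) * Op (\<lambda>y. G y * v k y) x) \<le> norm (q x - 1)"
      unfolding norm_mult using Op_bounded[OF x _ Gv(1)[of _ k]] by (intro mult_left_le) auto
    have "norm (Op (\<lambda>y. (G y - 1) * v k y) x) \<le> (\<integral>y. norm ((G y - 1) * v k y) \<partial>P x)"
      by (rule integral_norm_bound)
    also have "\<dots> \<le> Op (\<lambda>y. norm (G y - 1)) x"
    proof (rule integral_mono)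
      show "integrable (P x) (\<lambda>y. norm ((G y - 1) * v k y))"
        by (rule bounded_integrable_P[OF x, of _ 2]) (use Gv(4) in auto)
      show "norm ((G y - 1) * v k y) \<le> norm (G y - 1)" if "y \<in> space (P x)" for y
        unfolding norm_mult using vb[of y k] that P_space[OF x] by (intro mult_left_le) auto
    qed (rule i3)
    finally show "norm (E k x) \<le> norm (q x - 1) + Op (\<lambda>y. norm (G y - 1)) x"
      unfolding E_def using A by (intro order_trans[OF norm_triangle_ineq] add_mono)
  qed
  have OGb: "\<bar>Op (\<lambda>y. norm (G y - 1)) x\<bar> \<le> 2" if "x \<in> space S" for x
    using Op_bounded[OF that, of "\<lambda>y. norm (G y - 1)" 2] Gv(3) by auto
  have Eb4: "norm (E k x) \<le> 4" if "x \<in> space S" for k x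
    using Eb[OF that, of k] OGb[OF that] Gv(6)[OF that] by simp
  have iQ: "integrable \<pi> (\<lambda>x. (norm (q x - 1))\<^sup>2)"
    by (rule norm_square_integrable[OF _ Gv(6)]) auto
  have iU: "integrable \<pi> (\<lambda>x. (Op (\<lambda>y. norm (G y - 1)) x)\<^sup>2)"
    by (rule square_integrable[OF _ OGb]) auto
  have iE: "integrable \<pi> (E k)" for k by (rule bounded_integrable[OF Em Eb4])
  have iE2: "integrable \<pi> (\<lambda>x. (norm (E k x))\<^sup>2)" for k
    by (rule norm_square_integrable[OF Em Eb4])
  have E2: "(\<integral>x. (norm (E k x))\<^sup>2 \<partial>\<pi>) \<le> 2 * (Q + U)" for k
  proof -
    have "(\<integral>x. (norm (E k x))\<^sup>2 \<partial>\<pi>) \<le> (\<integral>x. 2 * (norm (q x - 1))\<^sup>2 + 2 * (Op (\<lambda>y. norm (G y - 1)) x)\<^sup>2 \<partial>\<pi>)"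
    proof (rule integral_mono)
      fix x assume "x \<in> space \<pi>"
      then have x: "x \<in> space S" by (simp add: space_pi)
      have "(norm (E k x))\<^sup>2 \<le> (norm (q x - 1) + Op (\<lambda>y. norm (G y - 1)) x)\<^sup>2"
        by (intro power_mono Eb[OF x]) auto
      also have "\<dots> \<le> 2 * (norm (q x - 1))\<^sup>2 + 2 * (Op (\<lambda>y. norm (G y - 1)) x)\<^sup>2"
        using weighted_square_sum[of "1/2" "norm (q x - 1)" "Op (\<lambda>y. norm (G y - 1)) x"] by simp
      finally show "(norm (E k x))\<^sup>2 \<le> 2 * (norm (q x - 1))\<^sup>2 + 2 * (Op (\<lambda>y. norm (G y - 1)) x)\<^sup>2" .
    qed (use iQ iU iE2 in auto)
    then show ?thesis using iQ iU by (simp add: Q_def U_def)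
  qed
  define D where "D = 2 * (Q + U) / (1 - t)"
  have D0: "D \<ge> 0" using Q0 t by (simp add: D_def)
  \<comment> \<open>Subtracting means in \<open>vE\<close> gives
    \<open>r (Suc k) = Op (r k) + e\<close> with \<open>e\<close> the centred error. The gap
    contracts the first term, and centring does not increase the second moment of
    \<open>E k\<close>.\<close>
  have R_step: "R (Suc k) \<le> t * R k + D" for k
  proof -
    define e where "e x = E k x - (\<integral>x. E k x \<partial>\<pi>)" for x
    have em: "e \<in> borel_measurable S" unfolding e_def by measurable
    have mS: "m (Suc k) = m k + (\<integral>x. E k x \<partial>\<pi>)"
    proof -
      have "m (Suc k) = (\<integral>x. Op (v k) x + E k x \<partial>\<pi>)"
        unfolding m_def by (intro Bochner_Integration.integral_cong refl vE) (simp add: space_pi)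
      also have "\<dots> = m k + (\<integral>x. E k x \<partial>\<pi>)"
        using Op_integrable[OF vi] iE by (simp add: m_def)
      finally show ?thesis .
    qed
    have rS: "r (Suc k) x = Op (r k) x + e x" if x: "x \<in> space S" for x
    proof -
      interpret px: prob_space "P x" by (rule P_prob[OF x])
      have "Op (r k) x = Op (v k) x - m k"
        unfolding r_def using bounded_integrable_P[OF x vm vb, of k] by (simp add: px.prob_space)
      then show ?thesis by (simp add: r_def e_def mS vE[OF x])
    qed
    have Orb: "norm (Op (r k) x) \<le> 2" if "x \<in> space S" for x
      by (rule Op_bounded[OF that rm rb])
    have Eib: "norm (\<integral>x. E k x \<partial>\<pi>) \<le> 4"
      by (rule order_trans[OF integral_norm_bound order_trans[OF integral_mono[of _ _ "\<lambda>_. 4"]]])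
        (use iE Eb4 space_pi in \<open>auto simp: prob_space\<close>)
    have eb: "norm (e x) \<le> 8" if "x \<in> space S" for x
      using norm_triangle_ineq4[of "E k x" "\<integral>x. E k x \<partial>\<pi>"] Eb4[OF that, of k] Eib by (simp add: e_def)
    have i1: "integrable \<pi> (\<lambda>x. (norm (Op (r k) x))\<^sup>2)"
      by (rule norm_square_integrable[OF _ Orb]) auto
    have i2: "integrable \<pi> (\<lambda>x. (norm (e x))\<^sup>2)"
      by (rule norm_square_integrable[OF em eb])
    have i3: "integrable \<pi> (\<lambda>x. (norm (r (Suc k) x))\<^sup>2)"
      by (rule norm_square_integrable[OF rm rb])
    have "R (Suc k) \<le> (\<integral>x. (norm (Op (r k) x))\<^sup>2 / t + (norm (e x))\<^sup>2 / (1 - t) \<partial>\<pi>)"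
      unfolding R_def
    proof (rule integral_mono)
      fix x assume "x \<in> space \<pi>"
      then have x: "x \<in> space S" by (simp add: space_pi)
      have "(norm (r (Suc k) x))\<^sup>2 \<le> (norm (Op (r k) x) + norm (e x))\<^sup>2"
        unfolding rS[OF x] by (intro power_mono norm_triangle_ineq) auto
      also have "\<dots> \<le> (norm (Op (r k) x))\<^sup>2 / t + (norm (e x))\<^sup>2 / (1 - t)"
        by (rule weighted_square_sum) (use t in auto)
      finally show "(norm (r (Suc k) x))\<^sup>2 \<le> (norm (Op (r k) x))\<^sup>2 / t + (norm (e x))\<^sup>2 / (1 - t)" .
    qed (use i1 i2 i3 in auto)
    also have "\<dots> = (\<integral>x. (norm (Op (r k) x))\<^sup>2 \<partial>\<pi>) / t + (\<integral>x. (norm (e x))\<^sup>2 \<partial>\<pi>) / (1 - t)"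
      using i1 i2 by simp
    also have "\<dots> \<le> (a\<^sup>2 * R k) / t + 2 * (Q + U) / (1 - t)"
    proof (intro add_mono divide_right_mono)
      show "(\<integral>x. (norm (Op (r k) x))\<^sup>2 \<partial>\<pi>) \<le> a\<^sup>2 * R k"
        unfolding R_def by (rule contraction_complex[OF gap rm rb r0])
      show "(\<integral>x. (norm (e x))\<^sup>2 \<partial>\<pi>) \<le> 2 * (Q + U)"
        unfolding e_def by (rule order_trans[OF variance_complex[OF Em Eb4] E2])
    qed (use t in auto)
    also have "(a\<^sup>2 * R k) / t \<le> t * R k"
    proof -
      have "R k \<ge> 0" by (auto simp: R_def intro!: integral_nonneg_AE)
      moreover have "a\<^sup>2 \<le> t * t" unfolding power2_eq_square using a t by (intro mult_mono) auto
      ultimately have "a\<^sup>2 * R k \<le> t * t * R k" by (rule mult_right_mono[rotated])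
      then show ?thesis using t by (simp add: field_simps)
    qed
    finally show ?thesis by (simp add: D_def)
  qed
  have R_le: "R k \<le> 8 / (1 - a)\<^sup>2 * (Q + U)" for k
  proof -
    \<comment> \<open>This is the fixed point of the affine recursion \<open>R_step\<close>; the
      induction starts from \<open>R 0 = 0\<close> because the zeroth iterate is constant.\<close>
    have "R k \<le> D / (1 - t)"
    proof (induction k)
      case 0
      have "r 0 x = 0" for x by (simp add: r_def m_def v_def prob_space)
      then show ?case using D0 t by (simp add: R_def)
    next
      case (Suc k)
      have "R (Suc k) \<le> t * (D / (1 - t)) + D"
        using R_step[of k] mult_left_mono[OF Suc, of t] t by simp
      also have "\<dots> = D / (1 - t)" using t by (simp add: field_simps)
      finally show ?case .
    qed
    also have "D / (1 - t) = 2 * (Q + U) / (1 - t)\<^sup>2" by (simp add: D_def power2_eq_square)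
    also have "1 - t = (1 - a) / 2" by (simp add: t_def field_simps)
    also have "2 * (Q + U) / ((1 - a) / 2)\<^sup>2 = 8 / (1 - a)\<^sup>2 * (Q + U)"
      by (simp add: power_divide)
    finally show ?thesis .
  qed
  define d where "d = (sqrt Q + sqrt V) * sqrt (8 / (1 - a)\<^sup>2 * (Q + U))"
  \<comment> \<open>Inserting \<open>v k = m k + r k\<close> gives \<open>lam * m k\<close> plus the
    contribution of \<open>r k\<close>. In the latter \<open>q\<close> is split as
    \<open>(q - 1) + 1\<close>, and stationarity removes \<open>Op\<close> from the part with
    1.\<close>
  have m_step: "norm (m (Suc k) - lam * m k) \<le> d" for k
  proof -
    have O1: "Op (\<lambda>y. G y * v k y) x = m k * Op G x + Op (\<lambda>y. G y * r k y) x" if x: "x \<in> space S" for x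
    proof -
      have eq: "G y * v k y = m k * G y + G y * r k y" for y
        by (simp add: r_def algebra_simps)
      have i: "integrable (P x) G"
        by (rule bounded_integrable_P[OF x Gm Gb])
      have i': "integrable (P x) (\<lambda>y. G y * r k y)"
        by (rule bounded_integrable_P[OF x _ Gv(2)]) auto
      show ?thesis
        unfolding eq using i i' by simp
    qed
    have GOb: "norm (Op G x) \<le> 1" "norm (Op (\<lambda>y. G y * r k y) x) \<le> 2" if x: "x \<in> space S" for x
      using Op_bounded[OF x Gm Gb] Op_bounded[OF x _ Gv(2)[of _ k]] by auto
    have i1: "integrable \<pi> (\<lambda>x. q x * Op G x)"
      by (rule bounded_integrable[of _ 1]) (auto simp: norm_mult qb GOb intro!: mult_le_one)
    have i2: "integrable \<pi> (\<lambda>x. (q x - 1) * Op (\<lambda>y. G y * r k y) x)"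
    proof (rule bounded_integrable)
      show "norm ((q x - 1) * Op (\<lambda>y. G y * r k y) x) \<le> 2 * 2" if "x \<in> space S" for x
        unfolding norm_mult by (intro mult_mono GOb Gv(6) that) auto
    qed auto
    have i3: "integrable \<pi> (\<lambda>x. G x * r k x)"
      by (rule bounded_integrable[OF _ Gv(2)]) auto
    have i3': "integrable \<pi> (Op (\<lambda>y. G y * r k y))" by (rule Op_integrable[OF i3])
    have i4: "integrable \<pi> (r k)" by (rule bounded_integrable[OF rm rb])
    have "m (Suc k) = (\<integral>x. m k * (q x * Op G x) + ((q x - 1) * Op (\<lambda>y. G y * r k y) x + Op (\<lambda>y. G y * r k y) x) \<partial>\<pi>)"
      unfolding m_def[of "Suc k"]
    proof (intro Bochner_Integration.integral_cong refl)
      fix x assume "x \<in> space \<pi>"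
      then have "v (Suc k) x = q x * (m k * Op G x + Op (\<lambda>y. G y * r k y) x)"
        using O1[of x] by (simp add: v_def space_pi)
      then show "v (Suc k) x = m k * (q x * Op G x) + ((q x - 1) * Op (\<lambda>y. G y * r k y) x + Op (\<lambda>y. G y * r k y) x)"
        by (simp add: left_diff_distrib distrib_left)
    qed
    also have "\<dots> = m k * lam + ((\<integral>x. (q x - 1) * Op (\<lambda>y. G y * r k y) x \<partial>\<pi>) + (\<integral>x. G x * r k x \<partial>\<pi>))"
      using i1 i2 i3' Op_integrable[OF i3] by (simp add: lam_def)
    \<comment> \<open>The mean of \<open>r k\<close> vanishes, so 1 may be subtracted from
      \<open>G\<close>; this turns the term into a product of two small factors.\<close>
    also have "(\<integral>x. G x * r k x \<partial>\<pi>) = (\<integral>x. (G x - 1) * r k x \<partial>\<pi>)"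
      using i3 i4 r0[of k] by (simp add: left_diff_distrib)
    finally have "m (Suc k) - lam * m k =
        (\<integral>x. (q x - 1) * Op (\<lambda>y. G y * r k y) x \<partial>\<pi>) + (\<integral>x. (G x - 1) * r k x \<partial>\<pi>)" by simp
    also have "norm \<dots> \<le> sqrt Q * sqrt (R k) + sqrt V * sqrt (R k)"
    proof (intro order_trans[OF norm_triangle_ineq] add_mono)
      show "norm (\<integral>x. (G x - 1) * r k x \<partial>\<pi>) \<le> sqrt V * sqrt (R k)"
        unfolding V_def R_def by (rule norm_integral_mult_le[OF _ Gv(3) _ rb]) auto
      have "norm (\<integral>x. (q x - 1) * Op (\<lambda>y. G y * r k y) x \<partial>\<pi>) \<le>
          sqrt Q * sqrt (\<integral>x. (norm (Op (\<lambda>y. G y * r k y) x))\<^sup>2 \<partial>\<pi>)"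
        unfolding Q_def by (rule norm_integral_mult_le[OF _ Gv(6) _ GOb(2)]) auto
      also have "(\<integral>x. (norm (Op (\<lambda>y. G y * r k y) x))\<^sup>2 \<partial>\<pi>) \<le> (\<integral>x. (Op (\<lambda>y. norm (r k y)) x)\<^sup>2 \<partial>\<pi>)"
      proof (rule integral_mono)
        show "integrable \<pi> (\<lambda>x. (norm (Op (\<lambda>y. G y * r k y) x))\<^sup>2)"
          by (rule norm_square_integrable[OF _ GOb(2)]) auto
        have "\<bar>Op (\<lambda>y. norm (r k y)) x\<bar> \<le> 2" if "x \<in> space S" for x
          using Op_bounded[OF that, of "\<lambda>y. norm (r k y)" 2] rb by auto
        then show "integrable \<pi> (\<lambda>x. (Op (\<lambda>y. norm (r k y)) x)\<^sup>2)"
          by (intro square_integrable[of _ 2]) auto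
        fix x assume "x \<in> space \<pi>"
        then have x: "x \<in> space S" by (simp add: space_pi)
        have "norm (Op (\<lambda>y. G y * r k y) x) \<le> (\<integral>y. norm (G y * r k y) \<partial>P x)"
          by (rule integral_norm_bound)
        also have "\<dots> \<le> Op (\<lambda>y. norm (r k y)) x"
        proof (rule integral_mono)
          show "integrable (P x) (\<lambda>y. norm (G y * r k y))" "integrable (P x) (\<lambda>y. norm (r k y))"
            by (rule bounded_integrable_P[OF x, of _ 2]; use Gv(2) rb in auto)+
          show "norm (G y * r k y) \<le> norm (r k y)" if "y \<in> space (P x)" for y
            unfolding norm_mult using Gb[of y] that P_space[OF x] by (intro mult_left_le_one_le) auto
        qed
        finally show "(norm (Op (\<lambda>y. G y * r k y) x))\<^sup>2 \<le> (Op (\<lambda>y. norm (r k y)) x)\<^sup>2"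
          by (intro power_mono) auto
      qed
      also have "\<dots> \<le> R k"
        unfolding R_def by (rule Op_square_le[of _ 2]) (use rb in auto)
      finally show "norm (\<integral>x. (q x - 1) * Op (\<lambda>y. G y * r k y) x \<partial>\<pi>) \<le> sqrt Q * sqrt (R k)"
        using Q0 by (simp add: mult_left_mono)
    qed
    also have "\<dots> = (sqrt Q + sqrt V) * sqrt (R k)" by (simp add: algebra_simps)
    also have "\<dots> \<le> d"
      unfolding d_def by (intro mult_left_mono) (use R_le Q0 in auto)
    finally show ?thesis .
  qed
  \<comment> \<open>A modulus at most 1 lets the errors of the single steps add up without
    amplification, hence the linear factor \<open>real k\<close>.\<close>
  have lam1: "norm lam \<le> 1"
    unfolding lam_def
    by (rule integral_norm_le_1)
      (use qb Op_bounded[OF _ Gm Gb] in \<open>auto simp: norm_mult intro!: mult_le_one\<close>)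
  have "norm (m k - lam ^ k) \<le> real k * d"
  proof (induction k)
    case 0
    show ?case by (simp add: m_def v_def prob_space)
  next
    case (Suc k)
    have "m (Suc k) - lam ^ Suc k = (m (Suc k) - lam * m k) + lam * (m k - lam ^ k)"
      by (simp add: algebra_simps)
    also have "norm \<dots> \<le> d + real k * d"
    proof (intro order_trans[OF norm_triangle_ineq] add_mono m_step)
      show "norm (lam * (m k - lam ^ k)) \<le> real k * d"
        unfolding norm_mult using mult_mono[OF lam1 Suc] by simp
    qed
    finally show ?case by (simp add: algebra_simps)
  qed
  then show ?thesis by (simp add: m_def v_def d_def)
qed

end

section \<open>The stationary Markov chain\<close>

lemma abs_Re_Im_le: "norm z \<le> b \<Longrightarrow> \<bar>Re z\<bar> \<le> b" "norm z \<le> b \<Longrightarrow> \<bar>Im z\<bar> \<le> b"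
  using abs_Re_le_cmod[of z] abs_Im_le_cmod[of z] by linarith+

locale stationary_chain = stationary_kernel S P \<pi>
  for S :: "'s measure" and P \<pi> +
  fixes M :: "'a measure" and X :: "nat \<Rightarrow> 'a \<Rightarrow> 's"
  assumes prob_M: "prob_space M"
    and chain: "homogeneous_markov_chain M S P X"
    and initial: "distr M S (X 0) = \<pi>"
begin

interpretation M: prob_space M by (rule prob_M)

abbreviation F :: "nat \<Rightarrow> 'a measure" where
  "F n \<equiv> natural_filtration M S X n"

lemma X_measurable [measurable]: "X n \<in> M \<rightarrow>\<^sub>M S"
  using chain by (simp add: homogeneous_markov_chain_def)

lemma space_F: "space (F n) = space M"
  by (simp add: natural_filtration_def space_measure_of_conv)

lemma F_gen: "{X j -` A \<inter> space M | j A. j \<le> n \<and> A \<in> sets S} \<subseteq> sets M"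
  by (auto intro!: measurable_sets[OF X_measurable])

lemma sets_F: "sets (F n) = sigma_sets (space M) {X j -` A \<inter> space M | j A. j \<le> n \<and> A \<in> sets S}"
  unfolding natural_filtration_def by (rule sets_measure_of) blast

lemma F_subalgebra: "subalgebra M (F n)"
proof -
  have "sets (F n) \<subseteq> sets M"
    unfolding sets_F by (rule sets.sigma_sets_subset[OF F_gen])
  then show ?thesis by (simp add: subalgebra_def space_F)
qed

lemma X_measurable_F:
  assumes "j \<le> n"
  shows "X j \<in> F n \<rightarrow>\<^sub>M S"
proof (rule measurableI)
  show "X j x \<in> space S" if "x \<in> space (F n)" for x
    using that measurable_space[OF X_measurable] by (simp add: space_F)
  show "X j -` A \<inter> space (F n) \<in> sets (F n)" if "A \<in> sets S" for A
    unfolding space_F sets_F by (rule sigma_sets.Basic) (use assms that in blast)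
qed

lemma F_cond: "sigma_finite_subalgebra M (F n)"
proof -
  interpret finite_measure_subalgebra M "F n"
    by unfold_locales (rule F_subalgebra)
  show ?thesis ..
qed

text \<open>Turns the almost sure identity in the definition of the chain into an exact identity of
  non-negative integrals over a past event, the form needed for densities and binds.\<close>

lemma transition_step:
  assumes A: "A \<in> sets (F n)" and B: "B \<in> sets S"
  shows "(\<integral>\<^sup>+\<omega>. indicator A \<omega> * indicator B (X (Suc n) \<omega>) \<partial>M) =
    (\<integral>\<^sup>+\<omega>. indicator A \<omega> * emeasure (P (X n \<omega>)) B \<partial>M)"
proof -
  interpret c: sigma_finite_subalgebra M "F n" by (rule F_cond)
  have AM [measurable]: "A \<in> sets M"
    using A F_subalgebra by (auto simp: subalgebra_def)
  note B [measurable]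
  have Pm: "(\<lambda>\<omega>. measure (P (X n \<omega>)) B) \<in> borel_measurable M"
    by (rule measurable_compose[OF X_measurable]) (use kernel_sub B in measurable)
  let ?h = "\<lambda>\<omega>. indicator B (X (Suc n) \<omega>) :: real"
  have ce: "AE \<omega> in M. real_cond_exp M (F n) ?h \<omega> = measure (P (X n \<omega>)) B"
    using chain B by (simp add: homogeneous_markov_chain_def)
  have i: "integrable M (\<lambda>\<omega>. indicator A \<omega> * ?h \<omega>)"
    by (rule M.integrable_const_bound[of _ 1]) (auto simp: indicator_def)
  have pb: "measure (P (X n \<omega>)) B \<le> 1" if "\<omega> \<in> space M" for \<omega>
    using P_prob measurable_space[OF X_measurable that] by (intro prob_space.prob_le_1) auto
  have i': "integrable M (\<lambda>\<omega>. indicator A \<omega> * measure (P (X n \<omega>)) B)"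
    by (rule M.integrable_const_bound[of _ 1]) (use pb Pm in \<open>auto simp: indicator_def intro!: AE_I2\<close>)
  have "(\<integral>\<omega>. indicator A \<omega> * ?h \<omega> \<partial>M) = (\<integral>\<omega>. indicator A \<omega> * real_cond_exp M (F n) ?h \<omega> \<partial>M)"
    by (rule c.real_cond_exp_intg(2)[symmetric, OF i]) (use A in auto)
  also have "\<dots> = (\<integral>\<omega>. indicator A \<omega> * measure (P (X n \<omega>)) B \<partial>M)"
    using ce Pm by (intro integral_cong_AE) auto
  finally have eq: "(\<integral>\<omega>. indicator A \<omega> * ?h \<omega> \<partial>M) = (\<integral>\<omega>. indicator A \<omega> * measure (P (X n \<omega>)) B \<partial>M)" .
  have "(\<integral>\<^sup>+\<omega>. indicator A \<omega> * indicator B (X (Suc n) \<omega>) \<partial>M) = (\<integral>\<^sup>+\<omega>. ennreal (indicator A \<omega> * ?h \<omega>) \<partial>M)"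
    by (intro nn_integral_cong) (auto simp: indicator_def)
  also have "\<dots> = (\<integral>\<^sup>+\<omega>. ennreal (indicator A \<omega> * measure (P (X n \<omega>)) B) \<partial>M)"
    using i i' eq by (simp add: nn_integral_eq_integral)
  also have "\<dots> = (\<integral>\<^sup>+\<omega>. indicator A \<omega> * emeasure (P (X n \<omega>)) B \<partial>M)"
    using P_prob measurable_space[OF X_measurable]
    by (intro nn_integral_cong)
      (auto simp: indicator_def finite_measure.emeasure_eq_measure prob_space.finite_measure)
  finally show ?thesis .
qed

text \<open>After restriction to a past event the Markov property says that one step acts on laws by
  \<open>bind\<close>. The whole space as event gives stationarity of all marginals; arbitrary
  events characterise conditional expectations.\<close>

lemma law_step:
  assumes A: "A \<in> sets (F n)"
  defines "D \<equiv> density M (\<lambda>\<omega>. ennreal (indicator A \<omega>))"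
  shows "distr D S (X (Suc n)) = distr D S (X n) \<bind> P"
proof -
  have AM [measurable]: "A \<in> sets M"
    using A F_subalgebra by (auto simp: subalgebra_def)
  have XD [measurable]: "X k \<in> D \<rightarrow>\<^sub>M S" for k unfolding D_def by measurable
  have spD: "space D = space M" by (simp add: D_def)
  have ne: "space (distr D S (X n)) \<noteq> {}"
    using measurable_space[OF X_measurable] M.not_empty by auto
  have K: "P \<in> distr D S (X n) \<rightarrow>\<^sub>M subprob_algebra S" by measurable
  show ?thesis
  proof (rule measure_eqI)
    show sets: "sets (distr D S (X (Suc n))) = sets (distr D S (X n) \<bind> P)"
      using sets_bind_measurable[OF K ne] by simp
    fix B assume "B \<in> sets (distr D S (X (Suc n)))"
    then have B [measurable]: "B \<in> sets S" by simp
    have PB: "(\<lambda>x. emeasure (P x) B) \<in> borel_measurable S"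
      using kernel_sub B by measurable
    have "emeasure (distr D S (X (Suc n))) B = (\<integral>\<^sup>+x. indicator B x \<partial>distr D S (X (Suc n)))"
      by simp
    also have "\<dots> = (\<integral>\<^sup>+\<omega>. indicator B (X (Suc n) \<omega>) \<partial>D)"
      by (rule nn_integral_distr) auto
    also have "\<dots> = (\<integral>\<^sup>+\<omega>. indicator A \<omega> * indicator B (X (Suc n) \<omega>) \<partial>M)"
      unfolding D_def by (subst nn_integral_density) (auto simp: ennreal_indicator)
    also have "\<dots> = (\<integral>\<^sup>+\<omega>. indicator A \<omega> * emeasure (P (X n \<omega>)) B \<partial>M)"
      by (rule transition_step[OF A B])
    also have "\<dots> = (\<integral>\<^sup>+\<omega>. emeasure (P (X n \<omega>)) B \<partial>D)"
      unfolding D_def using measurable_compose[OF X_measurable PB]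
      by (subst nn_integral_density) (auto simp: ennreal_indicator)
    also have "\<dots> = (\<integral>\<^sup>+x. emeasure (P x) B \<partial>distr D S (X n))"
      by (rule nn_integral_distr[symmetric]) (use PB in auto)
    also have "\<dots> = emeasure (distr D S (X n) \<bind> P) B"
      by (rule emeasure_bind[OF ne K B, symmetric])
    finally show "emeasure (distr D S (X (Suc n))) B = emeasure (distr D S (X n) \<bind> P) B" .
  qed
qed

lemma law_X: "distr M S (X n) = \<pi>"
proof (induction n)
  case (Suc n)
  have "density M (\<lambda>\<omega>. ennreal (indicator (space M) \<omega>)) = density M (\<lambda>_. 1)"
    by (rule density_cong) (auto simp: ennreal_indicator)
  then have "density M (\<lambda>\<omega>. ennreal (indicator (space M) \<omega>)) = M"
    by (simp add: density_1)
  moreover have "space M \<in> sets (F n)" using sets.top[of "F n"] by (simp add: space_F)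
  ultimately show ?case
    using law_step[of "space M" n] Suc by (simp add: pi_bind)
qed (rule initial)

lemma X_integrable:
  fixes g :: "'s \<Rightarrow> 'b::{banach, second_countable_topology}"
  assumes "integrable \<pi> g"
  shows "integrable M (\<lambda>\<omega>. g (X n \<omega>))" "(\<integral>\<omega>. g (X n \<omega>) \<partial>M) = (\<integral>x. g x \<partial>\<pi>)"
proof -
  have g: "g \<in> borel_measurable S"
    using borel_measurable_integrable[OF assms] by (simp cong: measurable_cong_sets add: sets_pi)
  show "integrable M (\<lambda>\<omega>. g (X n \<omega>))"
    using assms g by (subst (asm) law_X[of n, symmetric]) (simp add: integrable_distr_eq)
  show "(\<integral>\<omega>. g (X n \<omega>) \<partial>M) = (\<integral>x. g x \<partial>\<pi>)"
    using g by (subst law_X[of n, symmetric]) (simp add: integral_distr)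
qed

text \<open>The chain is given by conditional probabilities of sets. Applying
  \<open>bind_integral\<close> to the laws restricted to past events reaches every integrable
  \<open>g\<close> at once, without approximation by simple functions.\<close>

lemma cond_exp_X:
  fixes g :: "'s \<Rightarrow> real"
  assumes g: "integrable \<pi> g"
  shows "AE \<omega> in M. real_cond_exp M (F n) (\<lambda>\<omega>. g (X (Suc n) \<omega>)) \<omega> = Op g (X n \<omega>)"
proof -
  interpret c: sigma_finite_subalgebra M "F n" by (rule F_cond)
  have gm [measurable]: "g \<in> borel_measurable S"
    using borel_measurable_integrable[OF g] by (simp cong: measurable_cong_sets add: sets_pi)
  show ?thesis
  proof (rule c.real_cond_exp_charact)
    show "integrable M (\<lambda>\<omega>. g (X (Suc n) \<omega>))" "integrable M (\<lambda>\<omega>. Op g (X n \<omega>))"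
      using X_integrable(1)[OF g] X_integrable(1)[OF Op_integrable(2)[OF g]] by auto
    show "(\<lambda>\<omega>. Op g (X n \<omega>)) \<in> borel_measurable (F n)"
      by (rule measurable_compose[OF X_measurable_F]) auto
    fix A assume A: "A \<in> sets (F n)"
    then have AM [measurable]: "A \<in> sets M"
      using F_subalgebra by (auto simp: subalgebra_def)
    define D where "D = density M (\<lambda>\<omega>. ennreal (indicator A \<omega>))"
    have XD [measurable]: "X k \<in> D \<rightarrow>\<^sub>M S" for k unfolding D_def by measurable
    have K: "P \<in> distr D S (X n) \<rightarrow>\<^sub>M prob_algebra S" using kernel by simp
    have ne: "space (distr D S (X n)) \<noteq> {}"
      using measurable_space[OF X_measurable] M.not_empty by auto
    note ls = law_step[OF A, folded D_def]
    have tr: "(\<integral>x. h x \<partial>distr D S (X k)) = (\<integral>\<omega>\<in>A. h (X k \<omega>) \<partial>M)" if "h \<in> borel_measurable S" for h :: "'s \<Rightarrow> real" and k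
      using that measurable_compose[OF X_measurable that]
      by (simp add: integral_distr) (simp add: D_def integral_density set_lebesgue_integral_def)
    have "integrable D (\<lambda>\<omega>. g (X (Suc n) \<omega>))"
      unfolding D_def using integrable_mult_indicator[OF AM X_integrable(1)[OF g, of "Suc n"]]
      by (subst integrable_density) auto
    then have "integrable (distr D S (X n) \<bind> P) g"
      unfolding ls[symmetric] by (subst integrable_distr_eq) auto
    from bind_integral[OF K ne this]
    have "(\<integral>x. g x \<partial>distr D S (X (Suc n))) = (\<integral>x. Op g x \<partial>distr D S (X n))"
      unfolding ls by simp
    then show "(\<integral>\<omega>\<in>A. g (X (Suc n) \<omega>) \<partial>M) = (\<integral>\<omega>\<in>A. Op g (X n \<omega>) \<partial>M)"
      by (simp add: tr)
  qed
qed

lemma markov_real: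
  fixes y :: "'a \<Rightarrow> real" and g :: "'s \<Rightarrow> real"
  assumes y: "y \<in> borel_measurable (F n)" "\<And>\<omega>. \<omega> \<in> space M \<Longrightarrow> \<bar>y \<omega>\<bar> \<le> b"
    and g: "g \<in> borel_measurable S" "\<And>x. x \<in> space S \<Longrightarrow> \<bar>g x\<bar> \<le> c"
  shows "integrable M (\<lambda>\<omega>. y \<omega> * g (X m \<omega>))"
    and "(\<integral>\<omega>. y \<omega> * g (X (Suc n) \<omega>) \<partial>M) = (\<integral>\<omega>. y \<omega> * Op g (X n \<omega>) \<partial>M)"
proof -
  interpret c: sigma_finite_subalgebra M "F n" by (rule F_cond)
  have yM [measurable]: "y \<in> borel_measurable M"
    by (rule measurable_from_subalg[OF F_subalgebra y(1)])
  note g(1) [measurable]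
  have gi: "integrable \<pi> g" by (rule bounded_integrable) (use g in auto)
  show i: "integrable M (\<lambda>\<omega>. y \<omega> * g (X m \<omega>))" for m
  proof (rule M.integrable_const_bound[of _ "b * c"])
    show "AE \<omega> in M. norm (y \<omega> * g (X m \<omega>)) \<le> b * c"
      unfolding norm_mult unfolding real_norm_def
      by (intro AE_I2 mult_mono' y(2) g(2) measurable_space[OF X_measurable] abs_ge_zero)
  qed auto
  have "(\<integral>\<omega>. y \<omega> * g (X (Suc n) \<omega>) \<partial>M) = (\<integral>\<omega>. y \<omega> * real_cond_exp M (F n) (\<lambda>\<omega>. g (X (Suc n) \<omega>)) \<omega> \<partial>M)"
    by (rule c.real_cond_exp_intg(2)[symmetric, OF i]) (use y in auto)
  also have "\<dots> = (\<integral>\<omega>. y \<omega> * Op g (X n \<omega>) \<partial>M)"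
  proof (rule integral_cong_AE)
    show "AE \<omega> in M. y \<omega> * real_cond_exp M (F n) (\<lambda>\<omega>. g (X (Suc n) \<omega>)) \<omega> = y \<omega> * Op g (X n \<omega>)"
      using cond_exp_X[OF gi, of n] by eventually_elim simp
  qed auto
  finally show "(\<integral>\<omega>. y \<omega> * g (X (Suc n) \<omega>) \<partial>M) = (\<integral>\<omega>. y \<omega> * Op g (X n \<omega>) \<partial>M)" .
qed

text \<open>Conditional expectations are real valued here, so the product is decomposed into its
  four real products.\<close>

lemma markov_complex:
  fixes y :: "'a \<Rightarrow> complex" and g :: "'s \<Rightarrow> complex"
  assumes y [measurable]: "y \<in> borel_measurable (F n)" and yb: "\<And>\<omega>. \<omega> \<in> space M \<Longrightarrow> norm (y \<omega>) \<le> b"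
    and g [measurable]: "g \<in> borel_measurable S" and gb: "\<And>x. x \<in> space S \<Longrightarrow> norm (g x) \<le> c"
  shows "(\<integral>\<omega>. y \<omega> * g (X (Suc n) \<omega>) \<partial>M) = (\<integral>\<omega>. y \<omega> * Op g (X n \<omega>) \<partial>M)"
proof -
  have yr: "(\<lambda>\<omega>. Re (y \<omega>)) \<in> borel_measurable (F n)" "\<And>\<omega>. \<omega> \<in> space M \<Longrightarrow> \<bar>Re (y \<omega>)\<bar> \<le> b"
    "(\<lambda>\<omega>. Im (y \<omega>)) \<in> borel_measurable (F n)" "\<And>\<omega>. \<omega> \<in> space M \<Longrightarrow> \<bar>Im (y \<omega>)\<bar> \<le> b"
    using abs_Re_Im_le[OF yb] by auto
  have gr: "(\<lambda>x. Re (g x)) \<in> borel_measurable S" "\<And>x. x \<in> space S \<Longrightarrow> \<bar>Re (g x)\<bar> \<le> c"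
    "(\<lambda>x. Im (g x)) \<in> borel_measurable S" "\<And>x. x \<in> space S \<Longrightarrow> \<bar>Im (g x)\<bar> \<le> c"
    using abs_Re_Im_le[OF gb] by auto
  have Og: "Op g \<in> borel_measurable S" "\<And>x. x \<in> space S \<Longrightarrow> norm (Op g x) \<le> c"
    using Op_bounded[OF _ g gb] by auto
  have yM [measurable]: "y \<in> borel_measurable M"
    by (rule measurable_from_subalg[OF F_subalgebra y])
  have int: "integrable M (\<lambda>\<omega>. y \<omega> * h (X m \<omega>))"
    if [measurable]: "h \<in> borel_measurable S" and hb: "\<And>x. x \<in> space S \<Longrightarrow> norm (h x) \<le> c" for h :: "'s \<Rightarrow> complex" and m
  proof (rule M.integrable_const_bound[of _ "b * c"])
    show "AE \<omega> in M. norm (y \<omega> * h (X m \<omega>)) \<le> b * c"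
      unfolding norm_mult
      by (intro AE_I2 mult_mono' yb hb measurable_space[OF X_measurable] norm_ge_zero)
  qed auto
  have Oeq: "Op (\<lambda>x. Re (g x)) (X n \<omega>) = Re (Op g (X n \<omega>))" "Op (\<lambda>x. Im (g x)) (X n \<omega>) = Im (Op g (X n \<omega>))"
    if "\<omega> \<in> space M" for \<omega>
    using Op_Re_Im[OF measurable_space[OF X_measurable that] g gb] by auto
  note I = markov_real(1)
  note E = markov_real(2)
  have rr: "(\<integral>\<omega>. Re (y \<omega>) * Re (g (X (Suc n) \<omega>)) \<partial>M) = (\<integral>\<omega>. Re (y \<omega>) * Re (Op g (X n \<omega>)) \<partial>M)"
    by (subst E[OF yr(1,2) gr(1,2)]) (auto intro!: Bochner_Integration.integral_cong simp: Oeq simp del: integral_Re integral_Im)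
  have ri: "(\<integral>\<omega>. Re (y \<omega>) * Im (g (X (Suc n) \<omega>)) \<partial>M) = (\<integral>\<omega>. Re (y \<omega>) * Im (Op g (X n \<omega>)) \<partial>M)"
    by (subst E[OF yr(1,2) gr(3,4)]) (auto intro!: Bochner_Integration.integral_cong simp: Oeq simp del: integral_Re integral_Im)
  have ir: "(\<integral>\<omega>. Im (y \<omega>) * Re (g (X (Suc n) \<omega>)) \<partial>M) = (\<integral>\<omega>. Im (y \<omega>) * Re (Op g (X n \<omega>)) \<partial>M)"
    by (subst E[OF yr(3,4) gr(1,2)]) (auto intro!: Bochner_Integration.integral_cong simp: Oeq simp del: integral_Re integral_Im)
  have ii: "(\<integral>\<omega>. Im (y \<omega>) * Im (g (X (Suc n) \<omega>)) \<partial>M) = (\<integral>\<omega>. Im (y \<omega>) * Im (Op g (X n \<omega>)) \<partial>M)"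
    by (subst E[OF yr(3,4) gr(3,4)]) (auto intro!: Bochner_Integration.integral_cong simp: Oeq simp del: integral_Re integral_Im)
  have parts: "Re (\<integral>\<omega>. y \<omega> * h (X m \<omega>) \<partial>M) =
        (\<integral>\<omega>. Re (y \<omega>) * Re (h (X m \<omega>)) \<partial>M) - (\<integral>\<omega>. Im (y \<omega>) * Im (h (X m \<omega>)) \<partial>M)"
      "Im (\<integral>\<omega>. y \<omega> * h (X m \<omega>) \<partial>M) =
        (\<integral>\<omega>. Re (y \<omega>) * Im (h (X m \<omega>)) \<partial>M) + (\<integral>\<omega>. Im (y \<omega>) * Re (h (X m \<omega>)) \<partial>M)"
    if h [measurable]: "h \<in> borel_measurable S" and hb: "\<And>x. x \<in> space S \<Longrightarrow> norm (h x) \<le> c" for h :: "'s \<Rightarrow> complex" and m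
  proof -
    have hr: "(\<lambda>x. Re (h x)) \<in> borel_measurable S" "\<And>x. x \<in> space S \<Longrightarrow> \<bar>Re (h x)\<bar> \<le> c"
      "(\<lambda>x. Im (h x)) \<in> borel_measurable S" "\<And>x. x \<in> space S \<Longrightarrow> \<bar>Im (h x)\<bar> \<le> c"
      using abs_Re_Im_le[OF hb] by auto
    show "Re (\<integral>\<omega>. y \<omega> * h (X m \<omega>) \<partial>M) =
        (\<integral>\<omega>. Re (y \<omega>) * Re (h (X m \<omega>)) \<partial>M) - (\<integral>\<omega>. Im (y \<omega>) * Im (h (X m \<omega>)) \<partial>M)"
      using I[OF yr(1,2) hr(1,2)] I[OF yr(3,4) hr(3,4)]
      by (simp add: integral_Re[OF int[OF h hb], symmetric])
    show "Im (\<integral>\<omega>. y \<omega> * h (X m \<omega>) \<partial>M) =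
        (\<integral>\<omega>. Re (y \<omega>) * Im (h (X m \<omega>)) \<partial>M) + (\<integral>\<omega>. Im (y \<omega>) * Re (h (X m \<omega>)) \<partial>M)"
      using I[OF yr(1,2) hr(3,4)] I[OF yr(3,4) hr(1,2)]
      by (simp add: integral_Im[OF int[OF h hb], symmetric])
  qed
  show ?thesis
    by (rule complex_eqI) (simp_all add: parts[OF g gb] parts[OF Og] rr ri ir ii)
qed

lemma expectation_prod:
  assumes qm [measurable]: "q \<in> borel_measurable S" and qb: "\<And>x. x \<in> space S \<Longrightarrow> norm (q x) \<le> 1"
    and Gm [measurable]: "G \<in> borel_measurable S" and Gb: "\<And>x. x \<in> space S \<Longrightarrow> norm (G x) \<le> 1"
  shows "(\<integral>\<omega>. (\<Prod>j=1..n. q (X (j - 1) \<omega>) * G (X j \<omega>)) \<partial>M) = (\<integral>x. twisted_iter P q G n x \<partial>\<pi>)"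
proof -
  let ?v = "twisted_iter P q G"
  define W where "W m \<omega> = (\<Prod>j=1..m. q (X (j - 1) \<omega>) * G (X j \<omega>))" for m \<omega>
  have v: "?v k \<in> borel_measurable S" "\<And>x. x \<in> space S \<Longrightarrow> norm (?v k x) \<le> 1" for k
    using twisted_iter_bounded[OF qm qb Gm Gb] by auto
  have Xs: "X j \<omega> \<in> space S" if "\<omega> \<in> space M" for j \<omega>
    by (rule measurable_space[OF X_measurable that])
  have qX: "(\<lambda>\<omega>. q (X j \<omega>)) \<in> borel_measurable (F m)" and GX: "(\<lambda>\<omega>. G (X j \<omega>)) \<in> borel_measurable (F m)"
    if "j \<le> m" for j m
    by (rule measurable_compose[OF X_measurable_F[OF that] qm],
        rule measurable_compose[OF X_measurable_F[OF that] Gm])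
  have Wm: "W m \<in> borel_measurable (F m)" for m
    unfolding W_def by (intro borel_measurable_prod borel_measurable_times qX GX) auto
  have Wb: "norm (W m \<omega>) \<le> 1" if "\<omega> \<in> space M" for m \<omega>
    unfolding W_def prod_norm[symmetric]
    by (intro prod_le_1) (use qb Gb Xs[OF that] in \<open>auto simp: norm_mult intro!: mult_le_one\<close>)
  \<comment> \<open>The last \<open>k\<close> factors are replaced by the iterate seen from time
    \<open>m\<close>. Each step conditions on the past of \<open>m\<close>, where \<open>W m\<close>
    and \<open>q (X m)\<close> are known, so \<open>m\<close> has to vary in the induction.\<close>
  have "(\<integral>\<omega>. W (m + k) \<omega> \<partial>M) = (\<integral>\<omega>. W m \<omega> * ?v k (X m \<omega>) \<partial>M)" for m k
  proof (induction k arbitrary: m)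
    case (Suc k)
    have "(\<integral>\<omega>. W (m + Suc k) \<omega> \<partial>M) = (\<integral>\<omega>. W (Suc m) \<omega> * ?v k (X (Suc m) \<omega>) \<partial>M)"
      using Suc[of "Suc m"] by simp
    also have "\<dots> = (\<integral>\<omega>. (W m \<omega> * q (X m \<omega>)) * (G (X (Suc m) \<omega>) * ?v k (X (Suc m) \<omega>)) \<partial>M)"
      by (simp add: W_def algebra_simps)
    also have "\<dots> = (\<integral>\<omega>. (W m \<omega> * q (X m \<omega>)) * Op (\<lambda>y. G y * ?v k y) (X m \<omega>) \<partial>M)"
    proof (rule markov_complex[of _ _ 1 "\<lambda>y. G y * ?v k y" 1])
      show "(\<lambda>\<omega>. W m \<omega> * q (X m \<omega>)) \<in> borel_measurable (F m)"
        by (intro borel_measurable_times Wm qX) auto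
    qed (use v(1)[of k] v(2)[of _ k] Wb qb Gb Xs in \<open>auto simp: norm_mult intro!: mult_le_one\<close>)
    also have "\<dots> = (\<integral>\<omega>. W m \<omega> * ?v (Suc k) (X m \<omega>) \<partial>M)" by (simp add: mult.assoc)
    finally show ?case .
  qed simp
  from this[of 0 n] have "(\<integral>\<omega>. W n \<omega> \<partial>M) = (\<integral>\<omega>. ?v n (X 0 \<omega>) \<partial>M)"
    by (simp add: W_def)
  also have "\<dots> = (\<integral>x. ?v n x \<partial>\<pi>)"
    by (rule X_integrable(2)[OF bounded_integrable[OF v]])
  finally show ?thesis by (simp add: W_def)
qed

end

section \<open>Regularly varying tails\<close>

text \<open>\<open>h (Z x)\<close> is the integral of \<open>k s\<close> over those
  \<open>s > 0\<close> with \<open>Z x > s\<close>, and Fubini integrates over \<open>x\<close>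
  first. Only the tails beyond positive levels need be finite, so the lemma covers a probability
  measure and the infinite Levy measure alike.\<close>

lemma layer_cake:
  fixes k :: "real \<Rightarrow> complex" and Z :: "'s \<Rightarrow> real"
  assumes sf: "sigma_finite_measure M" and Z [measurable]: "Z \<in> borel_measurable M"
    and k [measurable]: "k \<in> borel_measurable borel"
    and fin: "\<And>s. s > 0 \<Longrightarrow> emeasure M {x \<in> space M. Z x > s} < \<infinity>"
    and int: "integrable lborel (\<lambda>s. indicator {0<..} s * (norm (k s) * measure M {x \<in> space M. Z x > s}))"
  defines "h \<equiv> \<lambda>x. \<integral>s. indicator {0<..<x} s *\<^sub>R k s \<partial>lborel"
  shows "integrable M (\<lambda>x. h (Z x))"
    and "(\<integral>x. h (Z x) \<partial>M) = (\<integral>s. indicator {0<..} s *\<^sub>R (measure M {x \<in> space M. Z x > s} *\<^sub>R k s) \<partial>lborel)"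
proof -
  interpret M: sigma_finite_measure M by (rule sf)
  interpret L: sigma_finite_measure "lborel :: real measure" by (rule sigma_finite_lborel)
  interpret pm: pair_sigma_finite M "lborel :: real measure" ..
  interpret mp: pair_sigma_finite "lborel :: real measure" M ..
  define f where "f x s = indicator {0<..<Z x} s *\<^sub>R k s" for x s
  have fm: "case_prod f \<in> borel_measurable (M \<Otimes>\<^sub>M lborel)"
  proof -
    have ks: "(\<lambda>p. k (snd p)) \<in> borel_measurable (M \<Otimes>\<^sub>M lborel)"
      by (rule measurable_compose[OF measurable_snd]) (use k in simp)
    have "Measurable.pred (M \<Otimes>\<^sub>M lborel) (\<lambda>p. snd p \<in> {0<..<Z (fst p)})"
      unfolding greaterThanLessThan_iff by measurable
    then show ?thesis
      unfolding f_def indicator_def case_prod_beta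
      by (intro borel_measurable_scaleR measurable_of_bool ks measurable_If) auto
  qed
  have f_eq: "f x s = (indicator {0<..} s * indicator {x \<in> space M. Z x > s} x) *\<^sub>R k s" if "x \<in> space M" for x s
    using that by (auto simp: f_def indicator_def)
  have iM: "integrable M (\<lambda>x. f x s) \<and> (\<integral>x. f x s \<partial>M) = indicator {0<..} s *\<^sub>R (measure M {x \<in> space M. Z x > s} *\<^sub>R k s) \<and>
      (\<integral>x. norm (f x s) \<partial>M) = indicator {0<..} s * (norm (k s) * measure M {x \<in> space M. Z x > s})" for s
  proof (cases "s > 0")
    case False
    then have "f x s = 0" for x by (auto simp: f_def indicator_def)
    then show ?thesis using False by (simp add: indicator_def)
  next
    case True
    have A: "{x \<in> space M. Z x > s} \<in> sets M" by measurable
    have ii: "integrable M (\<lambda>x. indicator {x \<in> space M. Z x > s} x *\<^sub>R c)" for c :: "'b::{banach, second_countable_topology}"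
      using A fin[OF True] by (intro integrable_scaleR_left integrable_real_indicator) auto
    have e1: "f x s = indicator {x \<in> space M. Z x > s} x *\<^sub>R k s" if "x \<in> space M" for x
      using f_eq[OF that, of s] True by simp
    have e2: "norm (f x s) = indicator {x \<in> space M. Z x > s} x *\<^sub>R norm (k s)" if "x \<in> space M" for x
      by (simp add: e1[OF that] indicator_def)
    have v: "(\<integral>x. indicator {x \<in> space M. Z x > s} x *\<^sub>R c \<partial>M) = measure M {x \<in> space M. Z x > s} *\<^sub>R c"
      for c :: "'b::{banach, second_countable_topology}"
      using A fin[OF True] by (subst integral_scaleR_left) (auto simp: sets.Int_space_eq2)
    show ?thesis
      using ii[of "k s"] v[of "k s"] v[of "norm (k s)"] True
      by (simp add: e1 e2 cong: Bochner_Integration.integrable_cong Bochner_Integration.integral_cong)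
  qed
  \<comment> \<open>With \<open>s\<close> as the outer variable the inner integral is the tail
    weighted by \<open>norm (k s)\<close>, which is exactly the integrand of
    \<open>int\<close>.\<close>
  have int2: "integrable (lborel \<Otimes>\<^sub>M M) (\<lambda>(s, x). f x s)"
  proof (rule mp.Fubini_integrable)
    show "(\<lambda>(s, x). f x s) \<in> borel_measurable (lborel \<Otimes>\<^sub>M M)"
      using measurable_pair_swap[OF fm] by (simp add: case_prod_beta)
    show "integrable lborel (\<lambda>s. \<integral>x. norm (case (s, x) of (s, x) \<Rightarrow> f x s) \<partial>M)"
      using int iM by simp
  qed (use iM in simp)
  then have int1: "integrable (M \<Otimes>\<^sub>M lborel) (case_prod f)"
    using mp.integrable_product_swap[of "\<lambda>(s, x). f x s"] by (simp add: case_prod_beta')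
  have h: "h (Z x) = (\<integral>s. f x s \<partial>lborel)" for x by (simp add: h_def f_def)
  show "integrable M (\<lambda>x. h (Z x))"
    unfolding h by (rule pm.integrable_fst[OF int1])
  show "(\<integral>x. h (Z x) \<partial>M) = (\<integral>s. indicator {0<..} s *\<^sub>R (measure M {x \<in> space M. Z x > s} *\<^sub>R k s) \<partial>lborel)"
    unfolding h using pm.integral_fst[OF int1] pm.integral_snd[OF int1] iM by simp
qed

text \<open>A Potter bound has exponent \<open>-(\<alpha> + \<delta>)\<close> for
  \<open>s < 1\<close> and \<open>-(\<alpha> - \<delta>)\<close> for \<open>s > 1\<close>; the sum
  dominates both and spares the case distinction.\<close>

definition potter :: "real \<Rightarrow> real \<Rightarrow> real \<Rightarrow> real" where
  "potter \<alpha> \<delta> s = s powr (-(\<alpha> + \<delta>)) + s powr (-(\<alpha> - \<delta>))"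

text \<open>A power of two is interpolated by monotonicity, so only the ratio \<open>H (2 * t) / H t\<close> matters.\<close>

lemma potter_bound:
  fixes H :: "real \<Rightarrow> real"
  assumes anti: "\<And>s t. s \<le> t \<Longrightarrow> H t \<le> H s" and pos: "\<And>t. H t > 0" and le1: "\<And>t. H t \<le> 1"
    and ratio: "((\<lambda>t. H (2 * t) / H t) \<longlongrightarrow> 2 powr (-\<alpha>)) at_top"
    and \<delta>: "0 < \<delta>" "\<delta> \<le> \<alpha>"
  obtains C where "C > 0" "\<forall>\<^sub>F t in at_top. \<forall>s>0. H (s * t) \<le> C * potter \<alpha> \<delta> s * H t"
proof -
  define u where "u = \<alpha> + \<delta>"
  define w where "w = \<alpha> - \<delta>"
  have uw: "u > 0" "w \<ge> 0" using \<delta> by (auto simp: u_def w_def)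
  have "\<forall>\<^sub>F t in at_top. H (2 * t) / H t > 2 powr (-u) \<and> H (2 * t) / H t < 2 powr (-w)"
    using \<delta> by (intro eventually_conj order_tendstoD[OF ratio]) (auto simp: u_def w_def)
  then obtain t0 where t0': "\<And>t. t \<ge> t0 \<Longrightarrow> H (2 * t) / H t > 2 powr (-u) \<and> H (2 * t) / H t < 2 powr (-w)"
    by (auto simp: eventually_at_top_linorder)
  define T where "T = max t0 1"
  have T: "T > 0" by (simp add: T_def)
  have dbl: "H t \<le> 2 powr u * H (2 * t)" "H (2 * t) \<le> 2 powr (-w) * H t" if "t \<ge> T" for t
  proof -
    have r: "2 powr (-u) < H (2 * t) / H t" "H (2 * t) / H t < 2 powr (-w)" using t0'[of t] that by (auto simp: T_def)
    from r(2) show "H (2 * t) \<le> 2 powr (-w) * H t" using pos[of t] by (simp add: field_simps)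
    from r(1) have "2 powr (-u) * H t \<le> H (2 * t)" using pos[of t] by (simp add: field_simps)
    then have "2 powr u * (2 powr (-u) * H t) \<le> 2 powr u * H (2 * t)" by (intro mult_left_mono) auto
    then show "H t \<le> 2 powr u * H (2 * t)" by (simp add: mult.assoc[symmetric] powr_add[symmetric])
  qed
  have itT: "2 ^ k * t \<ge> T" if "t \<ge> T" for k t
  proof -
    have "1 * t \<le> 2 ^ k * t" using that T by (intro mult_right_mono) auto
    then show ?thesis using that by simp
  qed
  have it1: "H t \<le> (2 powr u) ^ k * H (2 ^ k * t)" if "t \<ge> T" for k t
  proof (induction k)
    case (Suc k)
    have "(2 powr u) ^ k * H (2 ^ k * t) \<le> (2 powr u) ^ k * (2 powr u * H (2 * (2 ^ k * t)))"
      by (intro mult_left_mono dbl itT that) auto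
    with Suc have "H t \<le> (2 powr u) ^ k * (2 powr u * H (2 * (2 ^ k * t)))" by (rule order_trans)
    then show ?case by (simp add: mult_ac)
  qed simp
  have it2: "H (2 ^ k * t) \<le> (2 powr (-w)) ^ k * H t" if "t \<ge> T" for k t
  proof (induction k)
    case (Suc k)
    have "H (2 * (2 ^ k * t)) \<le> 2 powr (-w) * H (2 ^ k * t)" by (intro dbl itT that)
    also have "\<dots> \<le> 2 powr (-w) * ((2 powr (-w)) ^ k * H t)" by (intro mult_left_mono Suc) auto
    finally show ?case by (simp add: algebra_simps)
  qed simp
  have dyadic: "\<exists>k. 2 ^ k \<le> s \<and> s < 2 ^ Suc k" if "s \<ge> 1" for s :: real
  proof -
    define k where "k = nat \<lfloor>log 2 s\<rfloor>"
    have l: "log 2 s \<ge> 0" using that by simp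
    have "real k \<le> log 2 s" "log 2 s < real (Suc k)" using l real_of_int_floor_add_one_gt[of "log 2 s"] by (auto simp: k_def add.commute simp del: real_of_int_floor_add_one_gt)
    then have "2 powr real k \<le> s" "s < 2 powr real (Suc k)"
      using that by (auto simp: le_log_iff log_less_iff)
    then show ?thesis by (auto simp: powr_realpow simp del: of_nat_Suc)
  qed
  \<comment> \<open>Rounding \<open>s\<close> down to a power of two costs the factor
    \<open>2 powr w\<close>; in \<open>dn\<close> the ratio \<open>t / y\<close> is rounded up at
    the cost of \<open>2 powr u\<close>.\<close>
  have up: "H (s * t) \<le> 2 powr w * s powr (-w) * H t" if t: "t \<ge> T" and s: "s \<ge> 1" for s t
  proof -
    obtain k where k: "2 ^ k \<le> s" "s < 2 ^ Suc k" using dyadic[OF s] by blast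
    have "H (s * t) \<le> H (2 ^ k * t)" using k t T by (intro anti mult_right_mono) auto
    also have "\<dots> \<le> (2 powr (-w)) ^ k * H t" by (rule it2[OF t])
    also have "(2 powr (-w)) ^ k \<le> 2 powr w * s powr (-w)"
    proof -
      have "(2 powr (-w)) ^ k = (2 ^ k) powr (-w)"
        by (simp add: powr_powr powr_realpow[symmetric] mult.commute)
      also have "\<dots> = 2 powr w * (2 ^ Suc k) powr (-w)"
        by (simp add: powr_mult mult.assoc[symmetric] powr_add[symmetric])
      also have "\<dots> \<le> 2 powr w * s powr (-w)"
        using k s uw by (intro mult_left_mono powr_mono2') auto
      finally show ?thesis .
    qed
    finally show ?thesis using pos[of t] by (simp add: mult_right_mono)
  qed
  have dn: "H y \<le> 2 powr u * (t / y) powr u * H t" if y: "y \<ge> T" and t: "t \<ge> y" for y t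
  proof -
    obtain k where k: "2 ^ k \<le> t / y" "t / y < 2 ^ Suc k" using dyadic[of "t / y"] y t T by auto
    have "H y \<le> (2 powr u) ^ Suc k * H (2 ^ Suc k * y)" by (rule it1[OF y])
    also have "\<dots> \<le> (2 powr u) ^ Suc k * H t"
      using k y T by (intro mult_left_mono anti) (auto simp: field_simps)
    also have "(2 powr u) ^ Suc k \<le> 2 powr u * (t / y) powr u"
    proof -
      have "(2 powr u) ^ k = (2 ^ k) powr u"
        by (simp add: powr_powr powr_realpow[symmetric] mult.commute)
      also have "\<dots> \<le> (t / y) powr u" using k uw by (intro powr_mono2) auto
      finally show ?thesis by simp
    qed
    finally show ?thesis using pos[of t] by (simp add: mult_right_mono)
  qed
  \<comment> \<open>One summand for each case of \<open>main\<close>. In the last case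
    \<open>s * t < T\<close> is out of reach of \<open>dn\<close>: there \<open>H\<close> is at most
    1 and \<open>dn\<close> is applied at \<open>T\<close> instead, whence the division by
    \<open>H T\<close>.\<close>
  define C where "C = 2 powr w + 2 powr u + 2 powr u / H T"
  have C: "C > 0" "2 powr w \<le> C" "2 powr u \<le> C" "2 powr u / H T \<le> C"
    using pos[of T] by (auto simp: C_def intro!: add_pos_pos add_nonneg_nonneg)
  have main: "H (s * t) \<le> C * potter \<alpha> \<delta> s * H t" if t: "t \<ge> T" and s: "s > 0" for s t
  proof -
    have pu: "s powr (-u) \<le> potter \<alpha> \<delta> s" "s powr (-w) \<le> potter \<alpha> \<delta> s" by (auto simp: potter_def u_def w_def)
    have fin: "H (s * t) \<le> C * potter \<alpha> \<delta> s * H t" if "H (s * t) \<le> c * p * H t" "c \<le> C" "p \<le> potter \<alpha> \<delta> s" "0 \<le> c" "0 \<le> p" for c p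
    proof -
      have "c * p \<le> C * potter \<alpha> \<delta> s" using that C by (intro mult_mono) auto
      then have "c * p * H t \<le> C * potter \<alpha> \<delta> s * H t" using pos[of t] by (intro mult_right_mono) auto
      then show ?thesis using that(1) by linarith
    qed
    consider "s \<ge> 1" | "s < 1" "s * t \<ge> T" | "s < 1" "s * t < T" by linarith
    then show ?thesis
    proof cases
      case 1
      show ?thesis by (rule fin[OF up[OF t 1] C(2) pu(2)]) auto
    next
      case 2
      have "s * t \<le> t" using 2 t T by (simp add: mult_le_cancel_right1)
      from dn[OF 2(2) this] have "H (s * t) \<le> 2 powr u * s powr (-u) * H t"
        using s t T by (simp add: powr_divide powr_minus_divide)
      from fin[OF this C(3) pu(1)] show ?thesis by simp
    next
      case 3
      have "H (s * t) \<le> H T / H T" using le1[of "s * t"] pos[of T] by simp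
      also have "\<dots> \<le> (2 powr u * (t / T) powr u * H t) / H T"
        using dn[of T t] t pos[of T] by (intro divide_right_mono) auto
      also have "\<dots> \<le> (2 powr u * (1 / s) powr u * H t) / H T"
        using 3 s t T pos[of T] pos[of t] uw
        by (intro divide_right_mono mult_right_mono mult_left_mono powr_mono2) (auto simp: field_simps)
      also have "\<dots> = 2 powr u / H T * s powr (-u) * H t"
        using s by (simp add: powr_divide powr_minus_divide)
      finally have "H (s * t) \<le> 2 powr u / H T * s powr (-u) * H t" .
      from fin[OF this C(4) pu(1)] show ?thesis using pos[of T] by simp
    qed
  qed
  show ?thesis
    by (rule that[OF C(1)]) (use main in \<open>auto simp: eventually_at_top_linorder\<close>)
qed

section \<open>Power integrals and the stable Levy measure\<close>

lemma set_integrable_powr_0: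
  fixes e a :: real
  assumes "e > -1"
  shows "set_integrable lborel {0<..<a} (\<lambda>x. x powr e)"
proof -
  have "set_integrable lborel {0..max a 0} (\<lambda>x. x powr e)"
    using nonnegative_absolutely_integrable_1[OF integrable_on_powr_from_0[of e "max a 0"]] assms
    unfolding set_integrable_def by (simp add: integrable_completion)
  then show ?thesis by (rule set_integrable_subset) auto
qed

lemma set_integrable_powr_inf:
  fixes e a :: real
  assumes "e < -1" "a > 0"
  shows "set_integrable lborel {a..} (\<lambda>x. x powr e)"
    and "(\<integral>x. indicator {a..} x *\<^sub>R x powr e \<partial>lborel) = -(a powr (e+1)) / (e+1)"
proof -
  have h: "((\<lambda>x. x powr e) has_integral -(a powr (e+1)) / (e+1)) {a..}"
    by (rule has_integral_powr_to_inf[OF assms])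
  have ai: "(\<lambda>x. x powr e) absolutely_integrable_on {a..}"
    by (rule nonnegative_absolutely_integrable_1) (use h in auto)
  then show si: "set_integrable lborel {a..} (\<lambda>x. x powr e)"
    unfolding set_integrable_def by (simp add: integrable_completion)
  have "(\<integral>x. indicator {a..} x *\<^sub>R x powr e \<partial>lborel) = (\<integral>x. indicator {a..} x *\<^sub>R x powr e \<partial>lebesgue)"
    using si unfolding set_integrable_def by (simp add: integral_completion)
  also have "\<dots> = integral {a..} (\<lambda>x. x powr e)"
    using set_lebesgue_integral_eq_integral(2)[OF ai] by (simp add: set_lebesgue_integral_def)
  finally show "(\<integral>x. indicator {a..} x *\<^sub>R x powr e \<partial>lborel) = -(a powr (e+1)) / (e+1)"
    using h by (simp add: integral_unique)
qed

lemma integral_indicator_FTC: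
  fixes f g :: "real \<Rightarrow> complex"
  assumes "0 \<le> x" and f: "\<And>s. 0 \<le> s \<Longrightarrow> s \<le> x \<Longrightarrow> (f has_vector_derivative g s) (at s)"
    and g: "continuous_on UNIV g"
  shows "(\<integral>s. indicator {0<..<x} s *\<^sub>R g s \<partial>lborel) = f x - f 0"
proof -
  have gm: "g \<in> borel_measurable borel" using g by (rule borel_measurable_continuous_onI)
  have "(\<integral>s. indicator {0<..<x} s *\<^sub>R g s \<partial>lborel) = (\<integral>s. indicator {0..x} s *\<^sub>R g s \<partial>lborel)"
  proof (rule integral_cong_AE)
    show "AE s in lborel. indicator {0<..<x} s *\<^sub>R g s = indicator {0..x} s *\<^sub>R g s"
      using AE_lborel_singleton[of 0] AE_lborel_singleton[of x]
      by eventually_elim (auto simp: indicator_def)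
  qed (use gm in auto)
  also have "\<dots> = f x - f 0"
    by (rule integral_FTC_atLeastAtMost)
      (use assms in \<open>auto intro: has_vector_derivative_at_within continuous_on_subset\<close>)
  finally show ?thesis .
qed

text \<open>The factor \<alpha> in the density makes the tail exactly
  \<open>s powr -\<alpha>\<close>, the limit of the tail ratios of a regularly varying variable.
  Through \<open>layer_cake\<close> both sides of the limit then take the same form.\<close>

lemma emeasure_stable_levy_measure:
  assumes \<alpha>: "\<alpha> > 0" and s: "s > 0"
  shows "emeasure (stable_levy_measure \<alpha> 1 0) {x. x > s} = ennreal (s powr -\<alpha>)"
proof -
  let ?f = "\<lambda>x. \<alpha> * x powr (-(\<alpha> + 1))"
  have "emeasure (stable_levy_measure \<alpha> 1 0) {x. x > s} =
      (\<integral>\<^sup>+x. ennreal (\<alpha> * (1 * x powr (-(\<alpha> + 1)) * indicator {0<..} x + 0 * \<bar>x\<bar> powr (-(\<alpha> + 1)) * indicator {..<0} x)) * indicator {x. x > s} x \<partial>lborel)"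
    unfolding stable_levy_measure_def by (subst emeasure_density) auto
  also have "\<dots> = (\<integral>\<^sup>+x. ennreal (?f x) * indicator {s..} x \<partial>lborel)"
  proof (rule nn_integral_cong_AE)
    show "AE x in lborel. ennreal (\<alpha> * (1 * x powr (-(\<alpha> + 1)) * indicator {0<..} x + 0 * \<bar>x\<bar> powr (-(\<alpha> + 1)) * indicator {..<0} x)) * indicator {x. x > s} x =
      ennreal (?f x) * indicator {s..} x"
      using AE_lborel_singleton[of s] by eventually_elim (use s in \<open>auto simp: indicator_def\<close>)
  qed
  also have "\<dots> = ennreal (0 - (- (s powr -\<alpha>)))"
  proof (rule nn_integral_FTC_atLeast)
    show "DERIV (\<lambda>x. - (x powr -\<alpha>)) x :> ?f x" if "s \<le> x" for x
      using that s by (auto intro!: derivative_eq_intros)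
    have "((\<lambda>x. x powr -\<alpha>) \<longlongrightarrow> 0) at_top"
      using \<alpha> by (intro tendsto_neg_powr filterlim_ident) auto
    then show "((\<lambda>x. - (x powr -\<alpha>)) \<longlongrightarrow> 0) at_top"
      using tendsto_minus by fastforce
  qed (use \<alpha> in auto)
  finally show ?thesis by simp
qed

lemma sigma_finite_stable_levy_measure: "sigma_finite_measure (stable_levy_measure \<alpha> cp cm)"
  unfolding stable_levy_measure_def
  by (subst sigma_finite_measure.sigma_finite_iff_density_finite[OF sigma_finite_lborel]) auto

lemma sets_stable_levy_measure [measurable_cong, simp]: "sets (stable_levy_measure \<alpha> cp cm) = sets borel"
  and space_stable_levy_measure [simp]: "space (stable_levy_measure \<alpha> cp cm) = UNIV"
  by (simp_all add: stable_levy_measure_def)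

text \<open>The measure with parameters \<open>cp = 1\<close>, \<open>cm = 0\<close> serves for both half-lines.\<close>

lemma stable_levy_split:
  fixes f :: "real \<Rightarrow> complex"
  assumes \<alpha>: "\<alpha> > 0" and c: "cp \<ge> 0" "cm \<ge> 0" and f [measurable]: "f \<in> borel_measurable borel"
    and i1: "integrable (stable_levy_measure \<alpha> 1 0) (\<lambda>x. indicator {0<..} x *\<^sub>R f x)"
    and i2: "integrable (stable_levy_measure \<alpha> 1 0) (\<lambda>x. indicator {0<..} x *\<^sub>R f (-x))"
  shows "(\<integral>x. f x \<partial>stable_levy_measure \<alpha> cp cm) =
      cp *\<^sub>R (\<integral>x. indicator {0<..} x *\<^sub>R f x \<partial>stable_levy_measure \<alpha> 1 0) +
      cm *\<^sub>R (\<integral>x. indicator {0<..} x *\<^sub>R f (-x) \<partial>stable_levy_measure \<alpha> 1 0)"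
proof -
  define d where "d cp cm x = \<alpha> * (cp * x powr (-(\<alpha> + 1)) * indicator {0<..} x + cm * \<bar>x\<bar> powr (-(\<alpha> + 1)) * indicator {..<0} x)" for cp cm x :: real
  have d0: "d cp cm x \<ge> 0" if "cp \<ge> 0" "cm \<ge> 0" for cp cm x using \<alpha> that by (simp add: d_def)
  have dm [measurable]: "d cp cm \<in> borel_measurable lborel" for cp cm unfolding d_def by measurable
  have lev: "stable_levy_measure \<alpha> cp cm = density lborel (\<lambda>x. ennreal (d cp cm x))" for cp cm
    by (simp add: stable_levy_measure_def d_def)
  define g where "g h x = (\<alpha> * x powr (-(\<alpha> + 1)) * indicator {0<..} x) *\<^sub>R h x" for h :: "real \<Rightarrow> complex" and x :: real
  have gi: "integrable (stable_levy_measure \<alpha> 1 0) (\<lambda>x. indicator {0<..} x *\<^sub>R h x) \<longleftrightarrow> integrable lborel (g h)"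
    and gv: "(\<integral>x. indicator {0<..} x *\<^sub>R h x \<partial>stable_levy_measure \<alpha> 1 0) = integral\<^sup>L lborel (g h)"
    if [measurable]: "h \<in> borel_measurable borel" for h
  proof -
    have eq: "(d 1 0 x * indicator {0<..} x) *\<^sub>R h x = g h x" for x
      by (auto simp: d_def g_def indicator_def)
    show "integrable (stable_levy_measure \<alpha> 1 0) (\<lambda>x. indicator {0<..} x *\<^sub>R h x) \<longleftrightarrow> integrable lborel (g h)"
      unfolding lev by (subst integrable_density) (auto simp: d0 eq)
    show "(\<integral>x. indicator {0<..} x *\<^sub>R h x \<partial>stable_levy_measure \<alpha> 1 0) = integral\<^sup>L lborel (g h)"
      unfolding lev by (subst integral_density) (auto simp: d0 eq)
  qed
  have f': "(\<lambda>x. f (-x)) \<in> borel_measurable borel" by measurable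
  have I1: "integrable lborel (g f)" using i1 gi[OF f] by simp
  have I2: "integrable lborel (g (\<lambda>x. f (-x)))" using i2 gi[OF f'] by simp
  have I2': "integrable lborel (\<lambda>x. g (\<lambda>x. f (-x)) (-x))"
    using lborel_integrable_real_affine[OF I2, of "-1" 0] by simp
  have V2: "(\<integral>x. g (\<lambda>x. f (-x)) (-x) \<partial>lborel) = integral\<^sup>L lborel (g (\<lambda>x. f (-x)))"
    using lborel_integral_real_affine[of "-1" "g (\<lambda>x. f (-x))" 0] by simp
  have eq: "d cp cm x *\<^sub>R f x = cp *\<^sub>R g f x + cm *\<^sub>R g (\<lambda>x. f (-x)) (-x)" for x
    by (auto simp: d_def g_def indicator_def)
  have "(\<integral>x. f x \<partial>stable_levy_measure \<alpha> cp cm) = (\<integral>x. cp *\<^sub>R g f x + cm *\<^sub>R g (\<lambda>x. f (-x)) (-x) \<partial>lborel)"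
    unfolding lev by (subst integral_density) (auto simp: d0 c eq)
  also have "\<dots> = cp *\<^sub>R integral\<^sup>L lborel (g f) + cm *\<^sub>R integral\<^sup>L lborel (g (\<lambda>x. f (-x)))"
    using I1 I2' V2 by simp
  finally show "(\<integral>x. f x \<partial>stable_levy_measure \<alpha> cp cm) =
      cp *\<^sub>R (\<integral>x. indicator {0<..} x *\<^sub>R f x \<partial>stable_levy_measure \<alpha> 1 0) +
      cm *\<^sub>R (\<integral>x. indicator {0<..} x *\<^sub>R f (-x) \<partial>stable_levy_measure \<alpha> 1 0)"
    by (simp add: gv)
qed

section \<open>Integrals of a variable with regularly varying tails\<close>

lemma potter_nonneg: "0 \<le> potter \<alpha> \<delta> s" by (simp add: potter_def)

lemma potter_measurable [measurable]: "potter \<alpha> \<delta> \<in> borel_measurable borel"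
  unfolding potter_def by measurable

lemma powr_le_potter: "s > 0 \<Longrightarrow> \<delta> \<ge> 0 \<Longrightarrow> s powr -\<alpha> \<le> potter \<alpha> \<delta> s"
proof -
  assume s: "s > 0" and \<delta>: "\<delta> \<ge> 0"
  show ?thesis
  proof (cases "s \<ge> 1")
    case True
    have "s powr -\<alpha> \<le> s powr (-(\<alpha> - \<delta>))" using True \<delta> by (intro powr_mono) auto
    then show ?thesis by (simp add: potter_def add_increasing)
  next
    case False
    have "s powr -\<alpha> \<le> s powr (-(\<alpha> + \<delta>))" using False s \<delta> by (intro powr_mono') auto
    then show ?thesis by (simp add: potter_def add_increasing2)
  qed
qed

text \<open>Regular variation is expressed through tail ratios, in which the slowly varying factor
  cancels in the limit.\<close>

locale heavy_tail = prob_space N for N :: "'s measure" +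
  fixes \<Psi> :: "'s \<Rightarrow> real" and \<alpha> cp cm :: real
  assumes Psi [measurable]: "\<Psi> \<in> borel_measurable N"
    and alpha: "0 < \<alpha>" "\<alpha> < 2"
    and c_nonneg: "cp \<ge> 0" "cm \<ge> 0" and c_pos: "cp + cm > 0"
    and ratio: "\<And>r. r > 0 \<Longrightarrow> ((\<lambda>t. prob {x \<in> space N. \<bar>\<Psi> x\<bar> > r * t} / prob {x \<in> space N. \<bar>\<Psi> x\<bar> > t})
        \<longlongrightarrow> r powr -\<alpha>) at_top"
    and right: "((\<lambda>t. prob {x \<in> space N. \<Psi> x > t} / prob {x \<in> space N. \<bar>\<Psi> x\<bar> > t}) \<longlongrightarrow> cp / (cp + cm)) at_top"
    and left: "((\<lambda>t. prob {x \<in> space N. \<Psi> x < -t} / prob {x \<in> space N. \<bar>\<Psi> x\<bar> > t}) \<longlongrightarrow> cm / (cp + cm)) at_top"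
begin

definition H :: "real \<Rightarrow> real" where "H t = prob {x \<in> space N. \<bar>\<Psi> x\<bar> > t}"

lemma H_anti: "s \<le> t \<Longrightarrow> H t \<le> H s"
  unfolding H_def by (intro finite_measure_mono) auto

lemma H_le_1: "H t \<le> 1" unfolding H_def by simp

lemma H_ratio: "r > 0 \<Longrightarrow> ((\<lambda>t. H (r * t) / H t) \<longlongrightarrow> r powr -\<alpha>) at_top"
  unfolding H_def by (rule ratio)

text \<open>If \<open>H\<close> vanished somewhere it would vanish from there on, and the ratios,
  being \<open>0 / 0 = 0\<close>, could not have a positive limit.\<close>

lemma H_pos: "H t > 0"
proof -
  have "\<forall>\<^sub>F s in at_top. H (2 * s) / H s > 0"
    by (rule order_tendstoD(1)[OF H_ratio]) auto
  then have "\<forall>\<^sub>F s in at_top. H (2 * s) / H s > 0 \<and> s \<ge> t"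
    using eventually_ge_at_top[of t] by eventually_elim simp
  from eventually_happens[OF this] obtain s where s: "H (2 * s) / H s > 0" "s \<ge> t" by auto
  have "H s \<noteq> 0" using s(1) by auto
  then have "H s > 0" unfolding H_def by (simp add: zero_less_measure_iff)
  then show ?thesis using H_anti[OF s(2)] by linarith
qed

lemma H_potter:
  assumes "0 < \<delta>" "\<delta> \<le> \<alpha>"
  obtains C where "C > 0" "\<forall>\<^sub>F t in at_top. \<forall>s>0. H (s * t) \<le> C * potter \<alpha> \<delta> s * H t"
  using potter_bound[of H \<alpha> \<delta>] H_anti H_pos H_le_1 H_ratio[of 2] assms by auto

text \<open>Treats \<Psi>, its negative and its modulus alike: \<open>p\<close> is the limiting
  share in the tail of the modulus, and domination by \<open>H\<close> lets one Potter bound serve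
  all three.\<close>

definition one_sided :: "('s \<Rightarrow> real) \<Rightarrow> real \<Rightarrow> bool" where
  "one_sided Z p \<longleftrightarrow> Z \<in> borel_measurable N \<and> (\<forall>t>0. prob {x \<in> space N. Z x > t} \<le> H t) \<and>
     ((\<lambda>t. prob {x \<in> space N. Z x > t} / H t) \<longlongrightarrow> p) at_top"

lemma one_sided_pos: "one_sided \<Psi> (cp / (cp + cm))"
  unfolding one_sided_def using right
  by (auto simp: H_def intro!: finite_measure_mono)

lemma one_sided_neg: "one_sided (\<lambda>x. - \<Psi> x) (cm / (cp + cm))"
  unfolding one_sided_def using left
  by (auto simp: H_def less_minus_iff minus_less_iff intro!: finite_measure_mono)

lemma one_sided_abs: "one_sided (\<lambda>x. \<bar>\<Psi> x\<bar>) 1"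
proof -
  have "((\<lambda>t. H t / H t) \<longlongrightarrow> 1) at_top" using H_pos by (simp add: less_imp_neq[symmetric])
  then show ?thesis unfolding one_sided_def by (auto simp: H_def)
qed

lemma one_sided_ratio:
  assumes Z: "one_sided Z p" and s: "s > 0"
  shows "((\<lambda>t. prob {x \<in> space N. Z x > s * t} / H t) \<longlongrightarrow> p * s powr -\<alpha>) at_top"
proof -
  have "filterlim (\<lambda>t. s * t) at_top at_top"
    using s by (intro filterlim_tendsto_pos_mult_at_top[OF tendsto_const _ filterlim_ident])
  then have "((\<lambda>t. prob {x \<in> space N. Z x > s * t} / H (s * t)) \<longlongrightarrow> p) at_top"
    using Z unfolding one_sided_def by (auto intro: filterlim_compose)
  from tendsto_mult[OF this H_ratio[OF s]] show ?thesis
    using H_pos by (simp add: less_imp_neq[symmetric])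
qed

text \<open>In the layer-cake formula divided by \<open>H t\<close> the tail ratio converges
  pointwise to \<open>p * s powr -\<alpha>\<close> and is dominated by a multiple of the Potter
  weight. The limit is \<open>p\<close> times the layer-cake formula for the one-sided Levy
  measure.\<close>

lemma tail_functional:
  fixes k :: "real \<Rightarrow> complex"
  assumes Z: "one_sided Z p" and k [measurable]: "k \<in> borel_measurable borel"
    and \<delta>: "0 < \<delta>" "\<delta> \<le> \<alpha>"
    and int: "integrable lborel (\<lambda>s. indicator {0<..} s * (norm (k s) * potter \<alpha> \<delta> s))"
  defines "h \<equiv> \<lambda>x. \<integral>s. indicator {0<..<x} s *\<^sub>R k s \<partial>lborel"
  shows "\<forall>\<^sub>F t in at_top. integrable N (\<lambda>x. h (Z x / t))"
    and "integrable (stable_levy_measure \<alpha> 1 0) h"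
    and "(\<integral>x. h x \<partial>stable_levy_measure \<alpha> 1 0) = (\<integral>s. indicator {0<..} s *\<^sub>R (s powr -\<alpha> *\<^sub>R k s) \<partial>lborel)"
    and "((\<lambda>t. (\<integral>x. h (Z x / t) \<partial>N) /\<^sub>R H t) \<longlongrightarrow> p *\<^sub>R (\<integral>x. h x \<partial>stable_levy_measure \<alpha> 1 0)) at_top"
proof -
  have Zm [measurable]: "Z \<in> borel_measurable N" using Z by (simp add: one_sided_def)
  obtain C where C: "C > 0" "\<forall>\<^sub>F t in at_top. \<forall>s>0. H (s * t) \<le> C * potter \<alpha> \<delta> s * H t"
    using H_potter[OF \<delta>] by blast
  define T where "T s t = prob {x \<in> space N. Z x > s * t}" for s t
  have T_meas [measurable]: "(\<lambda>s. T s t) \<in> borel_measurable borel" if "t > 0" for t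
  proof -
    have "antimono (\<lambda>s. T s t)"
      unfolding T_def by (intro antimonoI finite_measure_mono) (use that in \<open>auto elim!: order_le_less_trans[rotated] simp: mult_right_mono\<close>)
    then have "mono (\<lambda>s. - T s t)" by (auto simp: mono_def antimono_def)
    from borel_measurable_uminus[OF borel_measurable_mono[OF this]] show ?thesis by simp
  qed
  have T_le: "\<forall>\<^sub>F t in at_top. t > 0 \<and> (\<forall>s>0. T s t \<le> C * potter \<alpha> \<delta> s * H t)"
    using C(2) eventually_gt_at_top[of 0]
  proof eventually_elim
    case (elim t)
    have "T s t \<le> H (s * t)" if "s > 0" for s
      using Z elim that by (auto simp: T_def one_sided_def)
    then show ?case using elim by (auto intro: order_trans)
  qed
  have set_eq: "{x \<in> space N. Z x / t > s} = {x \<in> space N. Z x > s * t}" if "t > 0" for s t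
    using that by (auto simp: pos_less_divide_eq)
  have good: "\<forall>\<^sub>F t in at_top. integrable N (\<lambda>x. h (Z x / t)) \<and>
      (\<integral>x. h (Z x / t) \<partial>N) = (\<integral>s. indicator {0<..} s *\<^sub>R (T s t *\<^sub>R k s) \<partial>lborel)"
    using T_le
  proof eventually_elim
    case (elim t)
    have t: "t > 0" using elim by simp
    note [measurable] = T_meas[OF t]
    have "integrable lborel (\<lambda>s. indicator {0<..} s * (norm (k s) * T s t))"
    proof (rule Bochner_Integration.integrable_bound)
      show "integrable lborel (\<lambda>s. C * H t * (indicator {0<..} s * (norm (k s) * potter \<alpha> \<delta> s)))"
        using int by simp
      show "AE s in lborel. norm (indicator {0<..} s * (norm (k s) * T s t)) \<le> norm (C * H t * (indicator {0<..} s * (norm (k s) * potter \<alpha> \<delta> s)))"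
      proof (rule AE_I2)
        fix s
        have "norm (k s) * T s t \<le> norm (k s) * (C * potter \<alpha> \<delta> s * H t)" if "s > 0"
          using elim that by (intro mult_left_mono) auto
        then show "norm (indicator {0<..} s * (norm (k s) * T s t)) \<le> norm (C * H t * (indicator {0<..} s * (norm (k s) * potter \<alpha> \<delta> s)))"
          using C(1) H_pos[of t] potter_nonneg[of \<alpha> \<delta> s]
          by (auto simp: indicator_def abs_mult T_def mult_ac)
      qed
    qed measurable
    then have i: "integrable lborel (\<lambda>s. indicator {0<..} s * (norm (k s) * prob {x \<in> space N. Z x / t > s}))"
      by (simp add: set_eq[OF t] T_def)
    have "sigma_finite_measure N" by unfold_locales
    moreover have "emeasure N {x \<in> space N. Z x / t > s} < \<infinity>" for s
      by (simp add: top.not_eq_extremum[symmetric])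
    ultimately show ?case
      unfolding h_def using layer_cake[OF _ _ k _ i] by (simp add: set_eq[OF t] T_def)
  qed
  then show "\<forall>\<^sub>F t in at_top. integrable N (\<lambda>x. h (Z x / t))"
    by eventually_elim simp
  have meas_levy: "emeasure (stable_levy_measure \<alpha> 1 0) {x. x > s} = ennreal (s powr -\<alpha>)"
    "measure (stable_levy_measure \<alpha> 1 0) {x. x > s} = s powr -\<alpha>" if "s > 0" for s
    using emeasure_stable_levy_measure[OF alpha(1) that] by (simp_all add: measure_def)
  have ilev: "integrable lborel (\<lambda>s. indicator {0<..} s * (norm (k s) * measure (stable_levy_measure \<alpha> 1 0) {x \<in> space (stable_levy_measure \<alpha> 1 0). x > s}))"
  proof -
    have "integrable lborel (\<lambda>s. indicator {0<..} s * (norm (k s) * s powr -\<alpha>))"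
    proof (rule Bochner_Integration.integrable_bound[OF int])
      show "AE s in lborel. norm (indicator {0<..} s * (norm (k s) * s powr -\<alpha>)) \<le> norm (indicator {0<..} s * (norm (k s) * potter \<alpha> \<delta> s))"
        using powr_le_potter[of _ \<delta> \<alpha>] \<delta> by (auto simp: indicator_def abs_mult potter_nonneg intro!: AE_I2 mult_left_mono)
    qed measurable
    moreover have "indicator {0<..} s * (norm (k s) * measure (stable_levy_measure \<alpha> 1 0) {x \<in> space (stable_levy_measure \<alpha> 1 0). x > s}) =
        indicator {0<..} s * (norm (k s) * s powr -\<alpha>)" for s :: real
      by (auto simp: indicator_def meas_levy)
    ultimately show ?thesis by (simp only:)
  qed
  have fin: "s > 0 \<Longrightarrow> emeasure (stable_levy_measure \<alpha> 1 0) {x \<in> space (stable_levy_measure \<alpha> 1 0). x > s} < \<infinity>" for s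
    by (simp add: meas_levy)
  note lc = layer_cake[OF sigma_finite_stable_levy_measure _ k fin ilev]
  show "integrable (stable_levy_measure \<alpha> 1 0) h"
    unfolding h_def by (rule lc(1)) auto
  show lev: "(\<integral>x. h x \<partial>stable_levy_measure \<alpha> 1 0) = (\<integral>s. indicator {0<..} s *\<^sub>R (s powr -\<alpha> *\<^sub>R k s) \<partial>lborel)"
    unfolding h_def by (subst lc(2)) (auto intro!: Bochner_Integration.integral_cong simp: indicator_def meas_levy)
  have lim: "((\<lambda>t. \<integral>s. indicator {0<..} s *\<^sub>R ((T s t / H t) *\<^sub>R k s) \<partial>lborel) \<longlongrightarrow>
      (\<integral>s. indicator {0<..} s *\<^sub>R ((p * s powr -\<alpha>) *\<^sub>R k s) \<partial>lborel)) at_top"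
  proof (rule tendsto_at_topI_sequentially)
    fix X :: "nat \<Rightarrow> real" assume X: "filterlim X at_top sequentially"
    \<comment> \<open>The Potter bound holds for large \<open>t\<close> only; dropping the first
      \<open>n0\<close> terms makes it available at every index, as dominated convergence
      requires.\<close>
    from filterlim_iff[THEN iffD1, OF X, rule_format, OF T_le]
    obtain n0 where n0: "\<And>n. n \<ge> n0 \<Longrightarrow> X n > 0 \<and> (\<forall>s>0. T s (X n) \<le> C * potter \<alpha> \<delta> s * H (X n))"
      by (auto simp: eventually_sequentially)
    show "(\<lambda>n. \<integral>s. indicator {0<..} s *\<^sub>R ((T s (X n) / H (X n)) *\<^sub>R k s) \<partial>lborel) \<longlonglongrightarrow>
      (\<integral>s. indicator {0<..} s *\<^sub>R ((p * s powr -\<alpha>) *\<^sub>R k s) \<partial>lborel)"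
    proof (rule LIMSEQ_offset[of _ n0], rule integral_dominated_convergence)
      show "(\<lambda>s. indicator {0<..} s *\<^sub>R ((T s (X (n + n0)) / H (X (n + n0))) *\<^sub>R k s)) \<in> borel_measurable lborel" for n
        using T_meas[of "X (n + n0)"] n0[of "n + n0"] k
        by (intro borel_measurable_scaleR borel_measurable_indicator borel_measurable_divide) auto
      show "integrable lborel (\<lambda>s. C * (indicator {0<..} s * (norm (k s) * potter \<alpha> \<delta> s)))"
        using int by simp
      show "AE s in lborel. (\<lambda>n. indicator {0<..} s *\<^sub>R ((T s (X (n + n0)) / H (X (n + n0))) *\<^sub>R k s)) \<longlonglongrightarrow>
          indicator {0<..} s *\<^sub>R ((p * s powr -\<alpha>) *\<^sub>R k s)"
      proof (rule AE_I2)
        fix s :: real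
        show "(\<lambda>n. indicator {0<..} s *\<^sub>R ((T s (X (n + n0)) / H (X (n + n0))) *\<^sub>R k s)) \<longlonglongrightarrow>
          indicator {0<..} s *\<^sub>R ((p * s powr -\<alpha>) *\<^sub>R k s)"
        proof (cases "s > 0")
          case True
          have "(\<lambda>n. T s (X (n + n0)) / H (X (n + n0))) \<longlonglongrightarrow> p * s powr -\<alpha>"
            using filterlim_compose[OF one_sided_ratio[OF Z True] X]
            unfolding T_def by (rule LIMSEQ_ignore_initial_segment)
          then show ?thesis by (intro tendsto_intros)
        qed simp
      qed
      show "AE s in lborel. norm (indicator {0<..} s *\<^sub>R ((T s (X (n + n0)) / H (X (n + n0))) *\<^sub>R k s)) \<le>
          C * (indicator {0<..} s * (norm (k s) * potter \<alpha> \<delta> s))" for n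
      proof (rule AE_I2)
        fix s :: real
        let ?t = "X (n + n0)"
        have "T s ?t / H ?t * norm (k s) \<le> C * potter \<alpha> \<delta> s * norm (k s)" if "s > 0"
          using n0[of "n + n0"] that H_pos[of ?t] by (intro mult_right_mono) (auto simp: pos_divide_le_eq)
        then show "norm (indicator {0<..} s *\<^sub>R ((T s ?t / H ?t) *\<^sub>R k s)) \<le>
          C * (indicator {0<..} s * (norm (k s) * potter \<alpha> \<delta> s))"
          using H_pos[of ?t] by (auto simp: indicator_def T_def mult_ac)
      qed
    qed measurable
  qed
  have "((\<lambda>t. (\<integral>x. h (Z x / t) \<partial>N) /\<^sub>R H t) \<longlongrightarrow> (\<integral>s. indicator {0<..} s *\<^sub>R ((p * s powr -\<alpha>) *\<^sub>R k s) \<partial>lborel)) at_top"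
  proof (rule Lim_transform_eventually[OF lim], use good in eventually_elim)
    case (elim t)
    have "(\<integral>s. indicator {0<..} s *\<^sub>R ((T s t / H t) *\<^sub>R k s) \<partial>lborel) =
        (\<integral>s. inverse (H t) *\<^sub>R (indicator {0<..} s *\<^sub>R (T s t *\<^sub>R k s)) \<partial>lborel)"
      by (intro Bochner_Integration.integral_cong) (auto simp: divide_inverse mult_ac)
    also have "\<dots> = inverse (H t) *\<^sub>R (\<integral>s. indicator {0<..} s *\<^sub>R (T s t *\<^sub>R k s) \<partial>lborel)"
      by (rule integral_scaleR_right)
    finally show ?case using elim by simp
  qed
  also have "(\<integral>s. indicator {0<..} s *\<^sub>R ((p * s powr -\<alpha>) *\<^sub>R k s) \<partial>lborel) =
      (\<integral>s. p *\<^sub>R (indicator {0<..} s *\<^sub>R (s powr -\<alpha> *\<^sub>R k s)) \<partial>lborel)"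
    by (intro Bochner_Integration.integral_cong) (auto simp: mult_ac)
  also have "\<dots> = p *\<^sub>R (\<integral>x. h x \<partial>stable_levy_measure \<alpha> 1 0)"
    unfolding lev by (rule integral_scaleR_right)
  finally show "((\<lambda>t. (\<integral>x. h (Z x / t) \<partial>N) /\<^sub>R H t) \<longlongrightarrow> p *\<^sub>R (\<integral>x. h x \<partial>stable_levy_measure \<alpha> 1 0)) at_top" .
qed

end

text \<open>In the applications to characteristic functions \<open>e\<close> is the order to which
  the derivative of the test function vanishes at 0: order 0 for \<open>iexp - 1\<close>, which
  confines it to \<alpha> < 1, and order 1 for the cosine or after subtracting the linear term,
  which reaches all \<alpha> < 2.\<close>

lemma integrable_potter_near_0:
  fixes k :: "real \<Rightarrow> 'b::{banach, second_countable_topology}"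
  assumes [measurable]: "k \<in> borel_measurable borel" and k: "\<And>s. 0 < s \<Longrightarrow> s < m \<Longrightarrow> norm (k s) \<le> K * s powr e"
    and e: "\<alpha> + \<delta> < e + 1" and \<delta>: "\<delta> \<ge> 0"
  shows "integrable lborel (\<lambda>s. indicator {0<..<m} s * (norm (k s) * potter \<alpha> \<delta> s))"
proof (rule Bochner_Integration.integrable_bound)
  have "set_integrable lborel {0<..<m} (\<lambda>s. s powr (e - (\<alpha> + \<delta>)))"
    "set_integrable lborel {0<..<m} (\<lambda>s. s powr (e - (\<alpha> - \<delta>)))"
    by (rule set_integrable_powr_0; use e \<delta> in simp)+
  then show "integrable lborel (\<lambda>s. K * (indicator {0<..<m} s *\<^sub>R s powr (e - (\<alpha> + \<delta>)) + indicator {0<..<m} s *\<^sub>R s powr (e - (\<alpha> - \<delta>))))"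
    unfolding set_integrable_def by auto
  show "AE s in lborel. norm (indicator {0<..<m} s * (norm (k s) * potter \<alpha> \<delta> s)) \<le>
      norm (K * (indicator {0<..<m} s *\<^sub>R s powr (e - (\<alpha> + \<delta>)) + indicator {0<..<m} s *\<^sub>R s powr (e - (\<alpha> - \<delta>))))"
  proof (rule AE_I2)
    fix s :: real
    have "norm (norm (k s) * potter \<alpha> \<delta> s) \<le> norm (K * (s powr (e - (\<alpha> + \<delta>)) + s powr (e - (\<alpha> - \<delta>))))" if s: "0 < s" "s < m"
    proof -
      have "norm (norm (k s) * potter \<alpha> \<delta> s) = norm (k s) * potter \<alpha> \<delta> s" using potter_nonneg[of \<alpha> \<delta> s] by simp
      also have "\<dots> \<le> K * s powr e * potter \<alpha> \<delta> s"
        using k[OF s] potter_nonneg[of \<alpha> \<delta> s] by (rule mult_right_mono)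
      also have "\<dots> = K * (s powr (e - (\<alpha> + \<delta>)) + s powr (e - (\<alpha> - \<delta>)))"
      proof -
        have "s powr e * s powr (-u) = s powr (e - u)" for u by (simp add: powr_add[symmetric])
        then show ?thesis by (simp only: potter_def distrib_left mult.assoc)
      qed
      finally show ?thesis by simp
    qed
    then show "norm (indicator {0<..<m} s * (norm (k s) * potter \<alpha> \<delta> s)) \<le>
      norm (K * (indicator {0<..<m} s *\<^sub>R s powr (e - (\<alpha> + \<delta>)) + indicator {0<..<m} s *\<^sub>R s powr (e - (\<alpha> - \<delta>))))"
      by (auto simp: indicator_def)
  qed
qed measurable

lemma integrable_potter_near_inf:
  fixes k :: "real \<Rightarrow> 'b::{banach, second_countable_topology}"
  assumes [measurable]: "k \<in> borel_measurable borel" and k: "\<And>s. a \<le> s \<Longrightarrow> norm (k s) \<le> K"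
    and a: "a > 0" and e: "1 < \<alpha> - \<delta>" and \<delta>: "\<delta> \<ge> 0"
  shows "integrable lborel (\<lambda>s. indicator {a..} s * (norm (k s) * potter \<alpha> \<delta> s))"
proof (rule Bochner_Integration.integrable_bound)
  have "set_integrable lborel {a..} (\<lambda>s. s powr (-(\<alpha> + \<delta>)))"
    "set_integrable lborel {a..} (\<lambda>s. s powr (-(\<alpha> - \<delta>)))"
    by (rule set_integrable_powr_inf; use e \<delta> a in simp)+
  then show "integrable lborel (\<lambda>s. K * (indicator {a..} s *\<^sub>R s powr (-(\<alpha> + \<delta>)) + indicator {a..} s *\<^sub>R s powr (-(\<alpha> - \<delta>))))"
    unfolding set_integrable_def by auto
  show "AE s in lborel. norm (indicator {a..} s * (norm (k s) * potter \<alpha> \<delta> s)) \<le>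
      norm (K * (indicator {a..} s *\<^sub>R s powr (-(\<alpha> + \<delta>)) + indicator {a..} s *\<^sub>R s powr (-(\<alpha> - \<delta>))))"
  proof (rule AE_I2)
    fix s :: real
    have "norm (norm (k s) * potter \<alpha> \<delta> s) \<le> norm (K * potter \<alpha> \<delta> s)" if s: "a \<le> s"
    proof -
      have "norm (k s) * potter \<alpha> \<delta> s \<le> K * potter \<alpha> \<delta> s"
        using k[OF s] potter_nonneg[of \<alpha> \<delta> s] by (rule mult_right_mono)
      then show ?thesis using potter_nonneg[of \<alpha> \<delta> s] by simp
    qed
    then show "norm (indicator {a..} s * (norm (k s) * potter \<alpha> \<delta> s)) \<le>
      norm (K * (indicator {a..} s *\<^sub>R s powr (-(\<alpha> + \<delta>)) + indicator {a..} s *\<^sub>R s powr (-(\<alpha> - \<delta>))))"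
      by (auto simp: indicator_def potter_def)
  qed
qed measurable

lemma iexp_lipschitz: "norm (iexp x - 1) \<le> \<bar>x\<bar>" "norm (iexp x - 1) \<le> 2"
  using iexp_approx1[of x 0] norm_triangle_ineq4[of "iexp x" 1] by auto

lemma has_vector_derivative_iexp_scaled:
  "((\<lambda>x. iexp (\<theta> * x)) has_vector_derivative \<i> * \<theta> * iexp (\<theta> * s)) (at s)"
proof -
  have "((\<lambda>x. \<theta> * x) has_vector_derivative \<theta>) (at s)"
    by (auto intro!: derivative_eq_intros)
  from vector_diff_chain_at[OF this has_vector_derivative_iexp] show ?thesis
    by (simp add: o_def scaleR_conv_of_real mult_ac)
qed

section \<open>Test functions and their Levy integrals\<close>

context heavy_tail
begin

text \<open>Stated on the positive half-line and for every one-sided \<open>Z\<close>, so that a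
  two-sided limit is the sum of the case of \<open>f\<close> with \<Psi> and the case of the
  reflected \<open>f\<close> with the negative of \<Psi>.\<close>

definition tail_test :: "(real \<Rightarrow> complex) \<Rightarrow> bool" where
  "tail_test f \<longleftrightarrow> f \<in> borel_measurable borel \<and>
     integrable (stable_levy_measure \<alpha> 1 0) (\<lambda>x. indicator {0<..} x *\<^sub>R f x) \<and>
     (\<forall>Z p. one_sided Z p \<longrightarrow>
       (\<forall>\<^sub>F t in at_top. integrable N (\<lambda>x. indicator {0<..} (Z x / t) *\<^sub>R f (Z x / t))) \<and>
       ((\<lambda>t. (\<integral>x. indicator {0<..} (Z x / t) *\<^sub>R f (Z x / t) \<partial>N) /\<^sub>R H t) \<longlongrightarrow>
         p *\<^sub>R (\<integral>x. indicator {0<..} x *\<^sub>R f x \<partial>stable_levy_measure \<alpha> 1 0)) at_top)"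

text \<open>\<open>tail_functional\<close> with the derivative as density. The function itself may
  grow linearly, provided that the derivative is integrable at infinity against the Potter weight,
  as happens for \<alpha> > 1.\<close>

lemma tail_test_unbounded:
  assumes f: "\<And>s. (f has_vector_derivative g s) (at s)" "f 0 = 0" and g: "continuous_on UNIV g"
    and \<delta>: "0 < \<delta>" "\<delta> \<le> \<alpha>"
    and int: "integrable lborel (\<lambda>s. indicator {0<..} s * (norm (g s) * potter \<alpha> \<delta> s))"
  shows "tail_test f"
proof -
  have gm: "g \<in> borel_measurable borel" using g by (rule borel_measurable_continuous_onI)
  have fm: "f \<in> borel_measurable borel"
    using f(1) by (intro borel_measurable_continuous_onI) (auto simp: continuous_on_eq_continuous_at intro!: has_vector_derivative_continuous)
  have h: "(\<integral>s. indicator {0<..<x} s *\<^sub>R g s \<partial>lborel) = indicator {0<..} x *\<^sub>R f x" for x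
  proof (cases "x > 0")
    case True
    then show ?thesis using integral_indicator_FTC[of x f g] f g by simp
  qed simp
  show ?thesis
    unfolding tail_test_def
    using fm tail_functional[OF _ gm \<delta> int, unfolded h] one_sided_abs by blast
qed

text \<open>Here \<open>g\<close> need not be integrable against the tail at infinity; cutting \<open>g\<close> off at \<open>m\<close> changes
  the integrals by at most \<open>2 b\<close> times the mass beyond \<open>m\<close>.\<close>

lemma tail_test_bounded:
  assumes f: "\<And>s. (f has_vector_derivative g s) (at s)" "f 0 = 0" and g: "continuous_on UNIV g"
    and b: "\<And>x. norm (f x) \<le> b" and \<delta>: "0 < \<delta>" "\<delta> \<le> \<alpha>"
    and int: "\<And>m. integrable lborel (\<lambda>s. indicator {0<..<m} s * (norm (g s) * potter \<alpha> \<delta> s))"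
  shows "tail_test f"
proof -
  let ?L = "stable_levy_measure \<alpha> 1 0"
  have b0: "b \<ge> 0" using b[of 0] by (rule order_trans[OF norm_ge_zero])
  have gm [measurable]: "g \<in> borel_measurable borel" using g by (rule borel_measurable_continuous_onI)
  have fm [measurable]: "f \<in> borel_measurable borel"
    using f(1) by (intro borel_measurable_continuous_onI) (auto simp: continuous_on_eq_continuous_at intro!: has_vector_derivative_continuous)
  define h where "h x = indicator {0<..} x *\<^sub>R f x" for x :: real
  define hm where "hm m x = indicator {0<..} x *\<^sub>R f (min x m)" for m x :: real
  have hmm [measurable]: "h \<in> borel_measurable borel" "hm m \<in> borel_measurable borel" for m
    unfolding h_def hm_def by measurable
  have hb: "norm (h x) \<le> b" "norm (h x - hm m x) \<le> 2 * b * indicator {m<..} x" for x m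
  proof -
    show "norm (h x) \<le> b" using b[of x] b0 by (simp add: h_def indicator_def)
    have "norm (f x - f (min x m)) \<le> 2 * b * indicator {m<..} x"
    proof (cases "x > m")
      case True
      then show ?thesis using norm_triangle_ineq4[of "f x" "f (min x m)"] b[of x] b[of "min x m"] by simp
    qed (simp add: min_def)
    then show "norm (h x - hm m x) \<le> 2 * b * indicator {m<..} x"
      using b0 by (auto simp: h_def hm_def indicator_def)
  qed
  have hm_eq: "(\<integral>s. indicator {0<..<x} s *\<^sub>R (indicator {..<m} s *\<^sub>R g s) \<partial>lborel) = hm m x" if m: "m > 0" for m x
  proof -
    have "(\<integral>s. indicator {0<..<x} s *\<^sub>R (indicator {..<m} s *\<^sub>R g s) \<partial>lborel) = (\<integral>s. indicator {0<..<min x m} s *\<^sub>R g s \<partial>lborel)"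
      by (intro Bochner_Integration.integral_cong) (auto simp: indicator_def)
    also have "\<dots> = hm m x"
      using integral_indicator_FTC[of "min x m" f g] f g m by (cases "x > 0") (auto simp: hm_def)
    finally show ?thesis .
  qed
  have intm: "integrable lborel (\<lambda>s. indicator {0<..} s * (norm (indicator {..<m} s *\<^sub>R g s) * potter \<alpha> \<delta> s))" for m
    by (rule Bochner_Integration.integrable_cong[THEN iffD1, OF refl _ int[of m]]) (auto simp: indicator_def)
  have km: "(\<lambda>s. indicator {..<m} s *\<^sub>R g s) \<in> borel_measurable borel" for m :: real by measurable
  note tf = tail_functional[OF _ km \<delta> intm, unfolded h_def]
  have hmL: "integrable ?L (hm m)" if "m > 0" for m
    using tail_functional(2)[OF one_sided_abs km \<delta> intm, of m] hm_eq[OF that] by simp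
  have mL: "emeasure ?L {m<..} = ennreal (m powr -\<alpha>)" "measure ?L {m<..} = m powr -\<alpha>" if "m > 0" for m
    using emeasure_stable_levy_measure[OF alpha(1) that] by (auto simp: greaterThan_def measure_def)
  have iL: "integrable ?L (\<lambda>x. 2 * b * indicator {m<..} x)" if "m > 0" for m
    using mL[OF that] by (intro integrable_mult_right integrable_real_indicator) auto
  have dL: "integrable ?L (\<lambda>x. h x - hm m x)" if "m > 0" for m
    using b0 hb(2) by (intro Bochner_Integration.integrable_bound[OF iL[OF that]]) auto
  have hL: "integrable ?L h"
    using Bochner_Integration.integrable_add[OF dL[of 1] hmL[of 1]] by simp
  have L_diff: "norm ((\<integral>x. h x \<partial>?L) - (\<integral>x. hm m x \<partial>?L)) \<le> 2 * b * m powr -\<alpha>" if m: "m > 0" for m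
  proof -
    have "norm ((\<integral>x. h x \<partial>?L) - (\<integral>x. hm m x \<partial>?L)) = norm (\<integral>x. h x - hm m x \<partial>?L)"
      using hL hmL[OF m] by simp
    also have "\<dots> \<le> (\<integral>x. 2 * b * indicator {m<..} x \<partial>?L)"
      by (rule order_trans[OF integral_norm_bound integral_mono]) (use dL[OF m] iL[OF m] hb in auto)
    also have "\<dots> = 2 * b * m powr -\<alpha>" using mL[OF m] by simp
    finally show ?thesis .
  qed
  have main: "(\<forall>\<^sub>F t in at_top. integrable N (\<lambda>x. h (Z x / t))) \<and>
      ((\<lambda>t. (\<integral>x. h (Z x / t) \<partial>N) /\<^sub>R H t) \<longlongrightarrow> p *\<^sub>R (\<integral>x. h x \<partial>?L)) at_top"
    if Z: "one_sided Z p" for Z p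
  proof
    have Zm [measurable]: "Z \<in> borel_measurable N" using Z by (simp add: one_sided_def)
    have hN: "integrable N (\<lambda>x. h (Z x / t))" for t
      by (rule integrable_const_bound[of _ b]) (use hb in auto)
    then show "\<forall>\<^sub>F t in at_top. integrable N (\<lambda>x. h (Z x / t))" by simp
    have p0: "p \<ge> 0"
    proof (rule tendsto_lowerbound)
      show "((\<lambda>t. prob {x \<in> space N. Z x > t} / H t) \<longlongrightarrow> p) at_top" using Z by (simp add: one_sided_def)
      show "\<forall>\<^sub>F t in at_top. 0 \<le> prob {x \<in> space N. Z x > t} / H t"
        using H_pos by (auto intro!: always_eventually divide_nonneg_pos)
    qed simp
    define A where "A t = (\<integral>x. h (Z x / t) \<partial>N) /\<^sub>R H t" for t
    define Am where "Am m t = (\<integral>x. hm m (Z x / t) \<partial>N) /\<^sub>R H t" for m t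
    show "((\<lambda>t. (\<integral>x. h (Z x / t) \<partial>N) /\<^sub>R H t) \<longlongrightarrow> p *\<^sub>R (\<integral>x. h x \<partial>?L)) at_top"
      unfolding A_def[symmetric]
    proof (rule tendstoI, goal_cases)
      case (1 e)
      have "((\<lambda>m. 2 * b * (p + 1) * m powr -\<alpha>) \<longlongrightarrow> 2 * b * (p + 1) * 0) at_top"
        using alpha by (intro tendsto_intros tendsto_neg_powr filterlim_ident) auto
      then have "\<forall>\<^sub>F m in at_top. 2 * b * (p + 1) * m powr -\<alpha> < e / 4"
        using 1 by (intro order_tendstoD) auto
      then have "\<forall>\<^sub>F m in at_top. 2 * b * (p + 1) * m powr -\<alpha> < e / 4 \<and> m > 0"
        using eventually_gt_at_top[of 0] by eventually_elim simp
      from eventually_happens[OF this] obtain m where m: "2 * b * (p + 1) * m powr -\<alpha> < e / 4" "m > 0" by auto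
      have lim1: "((\<lambda>t. Am m t) \<longlongrightarrow> p *\<^sub>R (\<integral>x. hm m x \<partial>?L)) at_top"
        using tail_functional(4)[OF Z km \<delta> intm, of m] unfolding hm_eq[OF m(2)] Am_def .
      have lim2: "((\<lambda>t. 2 * b * (prob {x \<in> space N. Z x > m * t} / H t)) \<longlongrightarrow> 2 * b * (p * m powr -\<alpha>)) at_top"
        by (intro tendsto_intros one_sided_ratio[OF Z m(2)])
      have small: "2 * b * (p * m powr -\<alpha>) < e / 4"
      proof -
        have "2 * b * (p * m powr -\<alpha>) \<le> 2 * b * (p + 1) * m powr -\<alpha>"
          using b0 p0 by (simp add: mult_left_mono mult_right_mono mult.assoc)
        then show ?thesis using m(1) by simp
      qed
      have "\<forall>\<^sub>F t in at_top. 2 * b * (prob {x \<in> space N. Z x > m * t} / H t) < e / 4"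
        by (rule order_tendstoD(2)[OF lim2 small])
      moreover have "\<forall>\<^sub>F t in at_top. dist (Am m t) (p *\<^sub>R (\<integral>x. hm m x \<partial>?L)) < e / 4"
        using 1 by (intro tendstoD[OF lim1]) auto
      ultimately show ?case
        using eventually_gt_at_top[of 0]
      proof eventually_elim
        case (elim t)
        have hmN: "integrable N (\<lambda>x. hm m (Z x / t))"
          by (rule integrable_const_bound[of _ b]) (use b b0 in \<open>auto simp: hm_def indicator_def\<close>)
        have ind: "integrable N (\<lambda>x. 2 * b * indicator {x \<in> space N. Z x > m * t} x)"
          by (intro integrable_mult_right integrable_real_indicator) (auto simp: less_top[symmetric])
        have "norm ((\<integral>x. h (Z x / t) \<partial>N) - (\<integral>x. hm m (Z x / t) \<partial>N)) = norm (\<integral>x. h (Z x / t) - hm m (Z x / t) \<partial>N)"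
          using hN[of t] hmN by simp
        also have "\<dots> \<le> (\<integral>x. 2 * b * indicator {x \<in> space N. Z x > m * t} x \<partial>N)"
        proof (rule order_trans[OF integral_norm_bound integral_mono])
          show "norm (h (Z x / t) - hm m (Z x / t)) \<le> 2 * b * indicator {x \<in> space N. Z x > m * t} x" if "x \<in> space N" for x
            using hb(2)[of "Z x / t" m] elim(3) that by (auto simp: indicator_def pos_less_divide_eq split: if_splits)
        qed (use hN[of t] hmN ind in auto)
        also have "\<dots> = 2 * b * prob {x \<in> space N. Z x > m * t}" by simp
        finally have "norm (A t - Am m t) \<le> 2 * b * (prob {x \<in> space N. Z x > m * t} / H t)"
          using H_pos[of t] by (simp add: A_def Am_def scaleR_diff_right[symmetric] divide_inverse mult_ac)
        then have d1: "norm (A t - Am m t) < e / 4" using elim(1) by simp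
        have "norm (p *\<^sub>R (\<integral>x. hm m x \<partial>?L) - p *\<^sub>R (\<integral>x. h x \<partial>?L)) = p * norm ((\<integral>x. h x \<partial>?L) - (\<integral>x. hm m x \<partial>?L))"
          using p0 by (simp add: scaleR_diff_right[symmetric] norm_minus_commute)
        also have "\<dots> \<le> p * (2 * b * m powr -\<alpha>)" using L_diff[OF m(2)] p0 by (rule mult_left_mono)
        finally have d2: "norm (p *\<^sub>R (\<integral>x. hm m x \<partial>?L) - p *\<^sub>R (\<integral>x. h x \<partial>?L)) < e / 4"
          using small by (simp add: mult_ac)
        have d3: "norm (Am m t - p *\<^sub>R (\<integral>x. hm m x \<partial>?L)) < e / 4" using elim(2) by (simp add: dist_norm)
        let ?u = "p *\<^sub>R (\<integral>x. hm m x \<partial>?L)" and ?v = "p *\<^sub>R (\<integral>x. h x \<partial>?L)"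
        have "norm (A t - ?v) \<le> norm (A t - Am m t) + norm (Am m t - ?v)"
          using norm_triangle_ineq[of "A t - Am m t" "Am m t - ?v"] by simp
        also have "norm (Am m t - ?v) \<le> norm (Am m t - ?u) + norm (?u - ?v)"
          using norm_triangle_ineq[of "Am m t - ?u" "?u - ?v"] by simp
        finally have "norm (A t - ?v) \<le> norm (A t - Am m t) + (norm (Am m t - ?u) + norm (?u - ?v))"
          by simp
        then show ?case using d1 d2 d3 1 by (simp add: dist_norm)
      qed
    qed
  qed
  show ?thesis
    unfolding tail_test_def h_def[symmetric] using fm hL main by simp
qed

text \<open>The condition \<open>f 0 = 0\<close> removes the points where \<Psi> vanishes, which
  belong to neither half-line.\<close>

lemma tail_test_two_sided:
  assumes f: "tail_test f" "tail_test (\<lambda>x. f (-x))" "f 0 = 0"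
  shows "((\<lambda>t. (\<integral>x. f (\<Psi> x / t) \<partial>N) /\<^sub>R H t) \<longlongrightarrow> (\<integral>x. f x \<partial>stable_levy_measure \<alpha> cp cm) /\<^sub>R (cp + cm)) at_top"
proof -
  let ?L = "stable_levy_measure \<alpha> 1 0"
  let ?I1 = "\<integral>x. indicator {0<..} x *\<^sub>R f x \<partial>?L" and ?I2 = "\<integral>x. indicator {0<..} x *\<^sub>R f (-x) \<partial>?L"
  note t1 = f(1)[unfolded tail_test_def] and t2 = f(2)[unfolded tail_test_def]
  from t1 one_sided_pos have
    i1: "\<forall>\<^sub>F t in at_top. integrable N (\<lambda>x. indicator {0<..} (\<Psi> x / t) *\<^sub>R f (\<Psi> x / t))" and
    l1: "((\<lambda>t. (\<integral>x. indicator {0<..} (\<Psi> x / t) *\<^sub>R f (\<Psi> x / t) \<partial>N) /\<^sub>R H t) \<longlongrightarrow> (cp / (cp + cm)) *\<^sub>R ?I1) at_top"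
    by auto
  from t2 one_sided_neg have
    i2: "\<forall>\<^sub>F t in at_top. integrable N (\<lambda>x. indicator {0<..} (- \<Psi> x / t) *\<^sub>R f (-(- \<Psi> x / t)))" and
    l2: "((\<lambda>t. (\<integral>x. indicator {0<..} (- \<Psi> x / t) *\<^sub>R f (-(- \<Psi> x / t)) \<partial>N) /\<^sub>R H t) \<longlongrightarrow> (cm / (cp + cm)) *\<^sub>R ?I2) at_top"
    by blast+
  have eq: "f (\<Psi> x / t) = indicator {0<..} (\<Psi> x / t) *\<^sub>R f (\<Psi> x / t) + indicator {0<..} (- \<Psi> x / t) *\<^sub>R f (-(- \<Psi> x / t))" for x t
    using f(3) by (cases "\<Psi> x / t" "0::real" rule: linorder_cases) (auto simp: indicator_def)
  have ev: "\<forall>\<^sub>F t in at_top.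
      (\<integral>x. indicator {0<..} (\<Psi> x / t) *\<^sub>R f (\<Psi> x / t) \<partial>N) /\<^sub>R H t +
        (\<integral>x. indicator {0<..} (- \<Psi> x / t) *\<^sub>R f (-(- \<Psi> x / t)) \<partial>N) /\<^sub>R H t
      = (\<integral>x. f (\<Psi> x / t) \<partial>N) /\<^sub>R H t"
    using i1 i2
  proof eventually_elim
    case (elim t)
    have "(\<integral>x. f (\<Psi> x / t) \<partial>N) = (\<integral>x. indicator {0<..} (\<Psi> x / t) *\<^sub>R f (\<Psi> x / t) \<partial>N) +
        (\<integral>x. indicator {0<..} (- \<Psi> x / t) *\<^sub>R f (-(- \<Psi> x / t)) \<partial>N)"
      unfolding Bochner_Integration.integral_add[OF elim, symmetric]
      by (rule Bochner_Integration.integral_cong[OF refl eq])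
    then show ?case by (simp only: scaleR_add_right)
  qed
  have "((\<lambda>t. (\<integral>x. f (\<Psi> x / t) \<partial>N) /\<^sub>R H t) \<longlongrightarrow> (cp / (cp + cm)) *\<^sub>R ?I1 + (cm / (cp + cm)) *\<^sub>R ?I2) at_top"
    by (rule Lim_transform_eventually[OF tendsto_add[OF l1 l2]]) (use ev in eventually_elim, simp)
  also have "(cp / (cp + cm)) *\<^sub>R ?I1 + (cm / (cp + cm)) *\<^sub>R ?I2 = (cp *\<^sub>R ?I1 + cm *\<^sub>R ?I2) /\<^sub>R (cp + cm)"
    by (simp add: scaleR_add_right divide_inverse mult.commute)
  also have "cp *\<^sub>R ?I1 + cm *\<^sub>R ?I2 = (\<integral>x. f x \<partial>stable_levy_measure \<alpha> cp cm)"
    by (rule stable_levy_split[symmetric]) (use alpha c_nonneg t1 t2 in auto)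
  finally show "((\<lambda>t. (\<integral>x. f (\<Psi> x / t) \<partial>N) /\<^sub>R H t) \<longlongrightarrow> (\<integral>x. f x \<partial>stable_levy_measure \<alpha> cp cm) /\<^sub>R (cp + cm)) at_top" .
qed

lemma tail_test_iexp_lt_1:
  assumes "\<alpha> < 1"
  shows "tail_test (\<lambda>x. iexp (\<theta> * x) - 1)"
proof (rule tail_test_bounded[where b = 2])
  \<comment> \<open>Chosen so that \<open>\<alpha> + \<delta> < 1\<close>, the condition for a
    derivative that does not vanish at 0.\<close>
  define \<delta> where "\<delta> = min \<alpha> ((1 - \<alpha>) / 2)"
  show \<delta>: "0 < \<delta>" "\<delta> \<le> \<alpha>" using alpha assms by (auto simp: \<delta>_def)
  have "\<delta> \<le> (1 - \<alpha>) / 2" unfolding \<delta>_def by (rule min.cobounded2)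
  then have "\<alpha> + \<delta> < 0 + 1" using assms by (simp add: field_simps)
  then show "integrable lborel (\<lambda>s. indicator {0<..<m} s * (norm (\<i> * \<theta> * iexp (\<theta> * s)) * potter \<alpha> \<delta> s))" for m
    by (intro integrable_potter_near_0[where K = "\<bar>\<theta>\<bar>" and e = 0]) (use \<delta> in \<open>auto simp: norm_mult\<close>)
  show "((\<lambda>x. iexp (\<theta> * x) - 1) has_vector_derivative \<i> * \<theta> * iexp (\<theta> * s)) (at s)" for s
    using has_vector_derivative_diff[OF has_vector_derivative_iexp_scaled has_vector_derivative_const] by simp
  show "norm (iexp (\<theta> * x) - 1) \<le> 2" for x by (rule iexp_lipschitz(2))
qed (auto intro!: continuous_intros)

text \<open>For \<alpha> = 1 only the even part of \<open>iexp\<close> is accessible in this way: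
  the derivative of the sine does not vanish at 0 and is not integrable there against the Potter
  weight.\<close>

lemma tail_test_cos:
  assumes "\<alpha> = 1"
  shows "tail_test (\<lambda>x. complex_of_real (cos (\<theta> * x) - 1))"
proof (rule tail_test_bounded[where b = 2 and \<delta> = "1/2"])
  have "\<bar>\<theta> * sin (\<theta> * s)\<bar> \<le> \<theta>\<^sup>2 * s powr 1" if "0 < s" for s
  proof -
    have "\<bar>\<theta>\<bar> * \<bar>sin (\<theta> * s)\<bar> \<le> \<bar>\<theta>\<bar> * \<bar>\<theta> * s\<bar>" by (intro mult_left_mono abs_sin_x_le_abs_x) auto
    also have "\<dots> = \<theta>\<^sup>2 * s" using that by (simp add: abs_mult power2_eq_square)
    finally show ?thesis using that by (simp add: abs_mult)
  qed
  then show "integrable lborel (\<lambda>s. indicator {0<..<m} s * (norm (complex_of_real (- (\<theta> * sin (\<theta> * s)))) * potter \<alpha> (1/2) s))" for m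
    using assms by (intro integrable_potter_near_0[where K = "\<theta>\<^sup>2" and e = 1]) (auto simp del: of_real_mult)
  show "((\<lambda>x. complex_of_real (cos (\<theta> * x) - 1)) has_vector_derivative complex_of_real (- (\<theta> * sin (\<theta> * s)))) (at s)" for s
    by (intro has_vector_derivative_of_real) (auto intro!: derivative_eq_intros)
  show "norm (complex_of_real (cos (\<theta> * x) - 1)) \<le> 2" for x
    using cos_le_one[of "\<theta> * x"] cos_ge_minus_one[of "\<theta> * x"] unfolding norm_of_real by simp
qed (use assms in \<open>auto intro!: continuous_intros\<close>)

lemma tail_test_iexp_gt_1:
  assumes "\<alpha> > 1"
  shows "tail_test (\<lambda>x. iexp (\<theta> * x) - 1 - \<i> * complex_of_real (\<theta> * x))"
proof (rule tail_test_unbounded)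
  \<comment> \<open>Leaves room at both ends: \<open>\<alpha> + \<delta> < 2\<close> for
    integrability at 0 and \<open>\<alpha> - \<delta> > 1\<close> at infinity.\<close>
  define \<delta> where "\<delta> = min ((\<alpha> - 1) / 2) ((2 - \<alpha>) / 2)"
  show \<delta>: "0 < \<delta>" "\<delta> \<le> \<alpha>" using alpha assms by (auto simp: \<delta>_def min_def field_simps)
  have d1: "\<delta> \<le> (\<alpha> - 1) / 2" "\<delta> \<le> (2 - \<alpha>) / 2" unfolding \<delta>_def by (rule min.cobounded1, rule min.cobounded2)
  then have \<delta>': "\<alpha> + \<delta> < 1 + 1" "1 < \<alpha> - \<delta>" using assms alpha by (auto simp: field_simps)
  let ?g = "\<lambda>s. \<i> * \<theta> * (iexp (\<theta> * s) - 1)"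
  have gm: "?g \<in> borel_measurable borel" by measurable
  have g1: "norm (?g s) \<le> \<theta>\<^sup>2 * s powr 1" if "0 < s" for s
  proof -
    have "\<bar>\<theta>\<bar> * norm (iexp (\<theta> * s) - 1) \<le> \<bar>\<theta>\<bar> * \<bar>\<theta> * s\<bar>" by (intro mult_left_mono iexp_lipschitz) auto
    also have "\<dots> = \<theta>\<^sup>2 * s" using that by (simp add: abs_mult power2_eq_square)
    finally show ?thesis using that by (simp add: norm_mult)
  qed
  have g2: "norm (?g s) \<le> \<bar>\<theta>\<bar> * 2" for s
    using mult_left_mono[OF iexp_lipschitz(2)[of "\<theta> * s"], of "\<bar>\<theta>\<bar>"] by (simp add: norm_mult)
  have "integrable lborel (\<lambda>s. indicator {0<..<1} s * (norm (?g s) * potter \<alpha> \<delta> s))"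
    by (rule integrable_potter_near_0[OF gm g1 \<delta>'(1)]) (use \<delta> in auto)
  moreover have "integrable lborel (\<lambda>s. indicator {1..} s * (norm (?g s) * potter \<alpha> \<delta> s))"
    by (rule integrable_potter_near_inf[OF gm g2 _ \<delta>'(2)]) (use \<delta> in auto)
  ultimately have "integrable lborel (\<lambda>s. indicator {0<..<1} s * (norm (?g s) * potter \<alpha> \<delta> s) + indicator {1..} s * (norm (?g s) * potter \<alpha> \<delta> s))"
    by (rule Bochner_Integration.integrable_add)
  then show "integrable lborel (\<lambda>s. indicator {0<..} s * (norm (?g s) * potter \<alpha> \<delta> s))"
    by (rule Bochner_Integration.integrable_cong[THEN iffD1, OF refl, rotated]) (auto simp: indicator_def)
  show "((\<lambda>x. iexp (\<theta> * x) - 1 - \<i> * complex_of_real (\<theta> * x)) has_vector_derivative ?g s) (at s)" for s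
  proof -
    have "((\<lambda>x. \<i> * complex_of_real (\<theta> * x)) has_vector_derivative \<i> * \<theta>) (at s)"
      by (auto intro!: derivative_eq_intros)
    from has_vector_derivative_diff[OF has_vector_derivative_diff[OF has_vector_derivative_iexp_scaled has_vector_derivative_const] this, of \<theta> 1]
    show ?thesis by (simp add: right_diff_distrib)
  qed
qed (auto intro!: continuous_intros)

end

text \<open>Compares \<open>z n\<close> with \<open>exp (z n - 1)\<close> instead of taking complex
  logarithms. Both have modulus at most 1, so their \<open>n\<close>-th powers differ by at most
  \<open>n\<close> times their distance, which is of second order in \<open>z n - 1\<close>.\<close>

lemma power_tendsto_exp:
  fixes z :: "nat \<Rightarrow> complex"
  assumes z: "\<And>n. norm (z n) \<le> 1" and lim: "(\<lambda>n. of_nat n * (z n - 1)) \<longlonglongrightarrow> w"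
  shows "(\<lambda>n. z n ^ n) \<longlonglongrightarrow> exp w"
proof -
  define e where "e n = exp (z n - 1)" for n
  have e1: "norm (e n) \<le> 1" for n
    using z[of n] complex_Re_le_cmod[of "z n"] by (simp add: e_def norm_exp_eq_Re)
  have en: "e n ^ n = exp (of_nat n * (z n - 1))" for n
    by (simp add: e_def exp_of_nat_mult)
  have z0: "(\<lambda>n. z n - 1) \<longlonglongrightarrow> 0"
  proof -
    have "(\<lambda>n. of_nat n * (z n - 1) * inverse (of_nat n)) \<longlonglongrightarrow> w * 0"
      by (intro tendsto_mult lim lim_inverse_n)
    then have "(\<lambda>n. of_nat n * (z n - 1) * inverse (of_nat n)) \<longlonglongrightarrow> 0" by simp
    then show ?thesis
      by (rule Lim_transform_eventually) (auto intro!: eventually_sequentiallyI[of 1] simp: field_simps)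
  qed
  have bd: "norm (z n ^ n - e n ^ n) \<le> 3 * (norm (of_nat n * (z n - 1)) * norm (z n - 1))" if "norm (z n - 1) \<le> 1" for n
  proof -
    have "norm (z n ^ n - e n ^ n) \<le> n * norm (z n - e n)" by (rule norm_power_diff[OF z e1])
    also have "norm (z n - e n) \<le> 3 * (norm (z n - 1))\<^sup>2"
    proof -
      have "norm (exp (z n - 1) - z n) \<le> exp (norm (z n - 1)) * (norm (z n - 1))\<^sup>2"
        using Taylor_exp_field[of "z n - 1" 1] by (simp add: power2_eq_square)
      also have "exp (norm (z n - 1)) \<le> 3"
        using that exp_le by (intro order_trans[OF _ exp_le]) simp
      finally show ?thesis by (simp add: e_def norm_minus_commute mult_right_mono)
    qed
    finally show ?thesis by (simp add: norm_mult power2_eq_square mult_left_mono mult.assoc)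
  qed
  have "(\<lambda>n. 3 * (norm (of_nat n * (z n - 1)) * norm (z n - 1))) \<longlonglongrightarrow> 3 * (norm w * norm (0::complex))"
    by (intro tendsto_intros lim z0)
  then have l0: "(\<lambda>n. 3 * (norm (of_nat n * (z n - 1)) * norm (z n - 1))) \<longlonglongrightarrow> 0" by simp
  have "\<forall>\<^sub>F n in sequentially. norm (z n - 1) < 1"
    using tendstoD[OF z0, of 1] by (simp add: dist_norm)
  then have "\<forall>\<^sub>F n in sequentially. norm (z n ^ n - e n ^ n) \<le> 3 * (norm (of_nat n * (z n - 1)) * norm (z n - 1))"
    by eventually_elim (use bd in auto)
  from Lim_null_comparison[OF this l0] have d: "(\<lambda>n. z n ^ n - e n ^ n) \<longlonglongrightarrow> 0" .
  have "(\<lambda>n. e n ^ n) \<longlonglongrightarrow> exp w" unfolding en by (intro tendsto_exp lim)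
  from tendsto_add[OF d this] show ?thesis by simp
qed

section \<open>Truncated moments\<close>

context heavy_tail
begin

lemma tail_functional_real:
  fixes k :: "real \<Rightarrow> real"
  assumes Z: "one_sided Z p" and k [measurable]: "k \<in> borel_measurable borel"
    and \<delta>: "0 < \<delta>" "\<delta> \<le> \<alpha>"
    and int: "integrable lborel (\<lambda>s. indicator {0<..} s * (norm (k s) * potter \<alpha> \<delta> s))"
  defines "h \<equiv> \<lambda>x. \<integral>s. indicator {0<..<x} s * k s \<partial>lborel"
  shows "\<forall>\<^sub>F t in at_top. integrable N (\<lambda>x. h (Z x / t))"
    and "((\<lambda>t. (\<integral>x. h (Z x / t) \<partial>N) / H t) \<longlongrightarrow> p * (\<integral>s. indicator {0<..} s * (s powr -\<alpha> * k s) \<partial>lborel)) at_top"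
proof -
  have k': "(\<lambda>s. complex_of_real (k s)) \<in> borel_measurable borel" by measurable
  have int': "integrable lborel (\<lambda>s. indicator {0<..} s * (norm (complex_of_real (k s)) * potter \<alpha> \<delta> s))"
    using int by simp
  note tf = tail_functional[OF Z k' \<delta> int']
  have h: "(\<integral>s. indicator {0<..<x} s *\<^sub>R complex_of_real (k s) \<partial>lborel) = complex_of_real (h x)" for x
  proof -
    have "indicator {0<..<x} s *\<^sub>R complex_of_real (k s) = complex_of_real (indicator {0<..<x} s * k s)" for s
      by (simp add: scaleR_conv_of_real)
    then show ?thesis unfolding h_def by (simp only: integral_complex_of_real)
  qed
  show "\<forall>\<^sub>F t in at_top. integrable N (\<lambda>x. h (Z x / t))"
    using tf(1) unfolding h by (simp only: complex_of_real_integrable_eq)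
  have J: "(\<integral>s. indicator {0<..} s *\<^sub>R (s powr -\<alpha> *\<^sub>R complex_of_real (k s)) \<partial>lborel) =
      complex_of_real (\<integral>s. indicator {0<..} s * (s powr -\<alpha> * k s) \<partial>lborel)"
  proof -
    have "indicator {0<..} s *\<^sub>R (s powr -\<alpha> *\<^sub>R complex_of_real (k s)) = complex_of_real (indicator {0<..} s * (s powr -\<alpha> * k s))" for s
      by (simp add: scaleR_conv_of_real)
    then show ?thesis by (simp only: integral_complex_of_real)
  qed
  from tendsto_Re[OF tf(4)[unfolded tf(3) J, unfolded h]]
  show "((\<lambda>t. (\<integral>x. h (Z x / t) \<partial>N) / H t) \<longlongrightarrow> p * (\<integral>s. indicator {0<..} s * (s powr -\<alpha> * k s) \<partial>lborel)) at_top"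
    by (simp add: divide_inverse mult.commute)
qed

text \<open>\<open>(min 1 x)^2\<close> is the primitive of \<open>2 * s\<close> cut off at 1, so
  \<open>tail_functional_real\<close> applies; \<alpha> < 2 is what integrability at 0
  demands.\<close>

lemma weight_square_bound:
  obtains C where "\<forall>\<^sub>F t in at_top. (\<integral>x. (min 1 (\<bar>\<Psi> x\<bar> / t))\<^sup>2 \<partial>N) \<le> C * H t"
proof -
  define k :: "real \<Rightarrow> real" where "k s = indicator {..<1} s * (2 * s)" for s
  have km: "k \<in> borel_measurable borel" unfolding k_def by measurable
  define \<delta> where "\<delta> = min \<alpha> ((2 - \<alpha>) / 2)"
  have \<delta>: "0 < \<delta>" "\<delta> \<le> \<alpha>" using alpha by (auto simp: \<delta>_def)
  have "\<delta> \<le> (2 - \<alpha>) / 2" unfolding \<delta>_def by (rule min.cobounded2)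
  then have \<delta>2: "\<alpha> + \<delta> < 1 + 1" using alpha by (simp add: field_simps)
  have "integrable lborel (\<lambda>s. indicator {0<..<1} s * (norm (k s) * potter \<alpha> \<delta> s))"
    by (rule integrable_potter_near_0[OF km _ \<delta>2, where K = 2]) (use \<delta> in \<open>auto simp: k_def\<close>)
  then have int: "integrable lborel (\<lambda>s. indicator {0<..} s * (norm (k s) * potter \<alpha> \<delta> s))"
    by (rule Bochner_Integration.integrable_cong[THEN iffD1, OF refl, rotated]) (auto simp: indicator_def k_def)
  have h: "(\<integral>s. indicator {0<..<x} s * k s \<partial>lborel) = (min 1 x)\<^sup>2" if x: "x \<ge> 0" for x
  proof -
    have "complex_of_real (\<integral>s. indicator {0<..<x} s * k s \<partial>lborel) = (\<integral>s. indicator {0<..<min x 1} s *\<^sub>R complex_of_real (2 * s) \<partial>lborel)"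
      unfolding integral_complex_of_real[symmetric] by (intro Bochner_Integration.integral_cong) (auto simp: indicator_def k_def)
    also have "\<dots> = complex_of_real ((min x 1)\<^sup>2) - complex_of_real (0\<^sup>2)"
      by (rule integral_indicator_FTC)
        (use x in \<open>auto intro!: continuous_intros has_vector_derivative_of_real derivative_eq_intros simp del: of_real_mult of_real_power\<close>)
    finally have "complex_of_real (\<integral>s. indicator {0<..<x} s * k s \<partial>lborel) = complex_of_real ((min x 1)\<^sup>2)" by simp
    then show ?thesis by (simp only: of_real_eq_iff min.commute)
  qed
  define J where "J = (\<integral>s. indicator {0<..} s * (s powr -\<alpha> * k s) \<partial>lborel)"
  have "((\<lambda>t. (\<integral>x. (\<integral>s. indicator {0<..<\<bar>\<Psi> x\<bar> / t} s * k s \<partial>lborel) \<partial>N) / H t) \<longlongrightarrow> J) at_top"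
    using tail_functional_real(2)[OF one_sided_abs km \<delta> int] by (simp add: J_def)
  then have "\<forall>\<^sub>F t in at_top. (\<integral>x. (\<integral>s. indicator {0<..<\<bar>\<Psi> x\<bar> / t} s * k s \<partial>lborel) \<partial>N) / H t < J + 1"
    by (rule order_tendstoD) simp
  then have "\<forall>\<^sub>F t in at_top. (\<integral>x. (min 1 (\<bar>\<Psi> x\<bar> / t))\<^sup>2 \<partial>N) \<le> (J + 1) * H t"
    using eventually_gt_at_top[of 0]
  proof eventually_elim
    case (elim t)
    have "(\<integral>x. (\<integral>s. indicator {0<..<\<bar>\<Psi> x\<bar> / t} s * k s \<partial>lborel) \<partial>N) = (\<integral>x. (min 1 (\<bar>\<Psi> x\<bar> / t))\<^sup>2 \<partial>N)"
      using elim(2) by (intro Bochner_Integration.integral_cong refl h) auto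
    then show ?case using elim(1) H_pos[of t] by (simp add: pos_divide_less_eq)
  qed
  then show ?thesis by (rule that)
qed

text \<open>The Potter bound at \<open>s = 1 / t\<close> bounds \<open>H\<close> from below:
  \<open>H t\<close> is at least a constant times \<open>t powr -(\<alpha> + \<delta>)\<close>, and
  \<alpha> + \<delta> < 2. For the norming this means that \<open>B n\<close> outgrows
  \<open>sqrt n\<close>.\<close>

lemma square_H_at_top: "filterlim (\<lambda>t. t\<^sup>2 * H t) at_top at_top"
proof -
  define \<delta> where "\<delta> = min \<alpha> ((2 - \<alpha>) / 2)"
  have \<delta>: "0 < \<delta>" "\<delta> \<le> \<alpha>" using alpha by (auto simp: \<delta>_def)
  have "\<delta> \<le> (2 - \<alpha>) / 2" unfolding \<delta>_def by (rule min.cobounded2)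
  then have \<delta>2: "\<alpha> + \<delta> < 2" using alpha by (simp add: field_simps)
  obtain C where C: "C > 0" "\<forall>\<^sub>F t in at_top. \<forall>s>0. H (s * t) \<le> C * potter \<alpha> \<delta> s * H t"
    using H_potter[OF \<delta>] by blast
  have "filterlim (\<lambda>t::real. t powr p) at_top at_top" if p: "p > 0" for p
  proof -
    have "filterlim (\<lambda>t. exp (p * ln t)) at_top at_top"
      by (intro filterlim_compose[OF exp_at_top] filterlim_tendsto_pos_mult_at_top[OF tendsto_const p ln_at_top])
    then show ?thesis
      by (rule filterlim_cong[THEN iffD1, OF refl refl, rotated])
        (auto intro!: eventually_at_top_linorderI[of 1] simp: powr_def)
  qed
  then have "filterlim (\<lambda>t. (H 1 / (2 * C)) * t powr (2 - (\<alpha> + \<delta>))) at_top at_top"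
    using H_pos[of 1] C(1) \<delta>2
    by (intro filterlim_tendsto_pos_mult_at_top[OF tendsto_const]) auto
  moreover have "\<forall>\<^sub>F t in at_top. (H 1 / (2 * C)) * t powr (2 - (\<alpha> + \<delta>)) \<le> t\<^sup>2 * H t"
    using C(2) eventually_ge_at_top[of 1]
  proof eventually_elim
    case (elim t)
    have "H 1 \<le> C * potter \<alpha> \<delta> (1 / t) * H t" using elim(1)[rule_format, of "1 / t"] elim(2) by simp
    also have "potter \<alpha> \<delta> (1 / t) \<le> 2 * t powr (\<alpha> + \<delta>)"
    proof -
      have "potter \<alpha> \<delta> (1 / t) = t powr (\<alpha> + \<delta>) + t powr (\<alpha> - \<delta>)"
      proof -
        have "(1 / t) powr (-u) = t powr u" for u
          using elim(2) by (simp add: powr_divide powr_minus field_simps)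
        then show ?thesis by (simp only: potter_def)
      qed
      also have "t powr (\<alpha> - \<delta>) \<le> t powr (\<alpha> + \<delta>)" using elim(2) \<delta> by (intro powr_mono) auto
      finally show ?thesis by simp
    qed
    finally have "H 1 \<le> C * (2 * t powr (\<alpha> + \<delta>)) * H t"
      using C(1) H_pos[of t] by (simp add: mult_left_mono mult_right_mono)
    then have "H 1 / (2 * C) \<le> t powr (\<alpha> + \<delta>) * H t" using C(1) by (simp add: pos_divide_le_eq mult_ac)
    then have "(H 1 / (2 * C)) * t powr (2 - (\<alpha> + \<delta>)) \<le> (t powr (\<alpha> + \<delta>) * H t) * t powr (2 - (\<alpha> + \<delta>))"
      by (rule mult_right_mono) simp
    also have "\<dots> = t powr 2 * H t" by (simp add: mult_ac powr_add[symmetric])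
    also have "t powr 2 = t\<^sup>2" using elim(2) by simp
    finally show ?case .
  qed
  ultimately show ?thesis by (rule filterlim_at_top_mono)
qed

lemma H_tendsto_0: "(H \<longlongrightarrow> 0) at_top"
proof -
  have "(\<lambda>n. prob {x \<in> space N. \<bar>\<Psi> x\<bar> > real n}) \<longlonglongrightarrow> prob (\<Inter>n. {x \<in> space N. \<bar>\<Psi> x\<bar> > real n})"
    by (rule finite_Lim_measure_decseq) (auto simp: decseq_def)
  also have "(\<Inter>n. {x \<in> space N. \<bar>\<Psi> x\<bar> > real n}) = {}"
  proof -
    have "\<exists>n. \<not> real n < \<bar>\<Psi> x\<bar>" for x using reals_Archimedean2[of "\<bar>\<Psi> x\<bar>"] less_asym by blast
    then show ?thesis by auto
  qed
  finally have l: "(\<lambda>n. H (real n)) \<longlonglongrightarrow> 0" by (simp add: H_def)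
  show ?thesis
  proof (rule tendstoI)
    fix r :: real assume "r > 0"
    from order_tendstoD(2)[OF l this] obtain n where "H (real n) < r"
      by (auto simp: eventually_sequentially)
    then have "dist (H t) 0 < r" if "t \<ge> real n" for t
      using H_anti[OF that] H_pos[of t] by simp
    then show "\<forall>\<^sub>F t in at_top. dist (H t) 0 < r"
      by (auto simp: eventually_at_top_linorder)
  qed
qed

text \<open>Cauchy-Schwarz with \<open>weight_square_bound\<close> would only give boundedness. The
  part with modulus of \<Psi> at most \<open>K\<close> contributes \<open>K / t\<close>, negligible
  by \<open>square_H_at_top\<close>; the rest lives on a set of probability \<open>H K\<close>, and
  Cauchy-Schwarz there gains the factor \<open>sqrt (H K)\<close>.\<close>

lemma weight_integral_small:
  "((\<lambda>t. (\<integral>x. min 1 (\<bar>\<Psi> x\<bar> / t) \<partial>N) / sqrt (H t)) \<longlongrightarrow> 0) at_top"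
proof (rule tendstoI, goal_cases)
  case (1 e)
  obtain C where C: "\<forall>\<^sub>F t in at_top. (\<integral>x. (min 1 (\<bar>\<Psi> x\<bar> / t))\<^sup>2 \<partial>N) \<le> C * H t"
    by (rule weight_square_bound)
  define D where "D = max C 1"
  have D: "D \<ge> C" "D > 0" by (auto simp: D_def)
  have "((\<lambda>K. sqrt D * sqrt (H K)) \<longlongrightarrow> sqrt D * sqrt 0) at_top"
    by (intro tendsto_intros H_tendsto_0)
  then have "\<forall>\<^sub>F K in at_top. sqrt D * sqrt (H K) < e / 2"
    using 1 by (intro order_tendstoD) auto
  then have "\<forall>\<^sub>F K in at_top. sqrt D * sqrt (H K) < e / 2 \<and> K > 0"
    using eventually_gt_at_top[of 0] by eventually_elim simp
  from eventually_happens[OF this] obtain K where K: "sqrt D * sqrt (H K) < e / 2" "K > 0" by auto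
  have "filterlim (\<lambda>t. sqrt (t\<^sup>2 * H t)) at_top at_top"
    by (rule filterlim_compose[OF sqrt_at_top square_H_at_top])
  then have "((\<lambda>t. K / sqrt (t\<^sup>2 * H t)) \<longlongrightarrow> 0) at_top"
    by (intro tendsto_divide_0[OF tendsto_const] filterlim_at_top_imp_at_infinity)
  then have "\<forall>\<^sub>F t in at_top. K / sqrt (t\<^sup>2 * H t) < e / 2"
    using 1 by (intro order_tendstoD) auto
  then show ?case using C eventually_gt_at_top[of 0]
  proof eventually_elim
    case (elim t)
    let ?w = "\<lambda>x. min 1 (\<bar>\<Psi> x\<bar> / t)"
    let ?A = "{x \<in> space N. \<bar>\<Psi> x\<bar> > K}"
    have w01: "0 \<le> ?w x" "?w x \<le> 1" for x using elim(3) by auto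
    have iw: "integrable N ?w" by (rule integrable_const_bound[of _ 1]) (use w01 in auto)
    have iw2: "integrable N (\<lambda>x. (?w x)\<^sup>2)"
      by (rule integrable_const_bound[of _ 1]) (use w01 in \<open>auto simp: power_le_one\<close>)
    have iA2: "integrable N (\<lambda>x. (indicator ?A x :: real)\<^sup>2)"
      by (rule integrable_const_bound[of _ 1]) (auto simp: indicator_def)
    note CS = integral_Cauchy_Schwarz[of ?w N "indicator ?A", OF _ _ iw2 iA2]
    have iwA: "integrable N (\<lambda>x. ?w x * indicator ?A x)" by (rule CS(1)) auto
    have "(\<integral>x. ?w x \<partial>N) \<le> (\<integral>x. K / t + ?w x * indicator ?A x \<partial>N)"
    proof (rule integral_mono)
      fix x assume x: "x \<in> space N"
      show "?w x \<le> K / t + ?w x * indicator ?A x"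
      proof (cases "\<bar>\<Psi> x\<bar> > K")
        case True
        then show ?thesis using elim(3) K(2) x by (simp add: indicator_def)
      next
        case False
        then have "\<bar>\<Psi> x\<bar> / t \<le> K / t" using elim(3) by (intro divide_right_mono) auto
        then show ?thesis using False by (simp add: indicator_def min.coboundedI2)
      qed
    qed (use iw iwA in auto)
    also have "\<dots> = K / t + (\<integral>x. ?w x * indicator ?A x \<partial>N)"
      using iwA by (simp add: prob_space)
    also have "(\<integral>x. ?w x * indicator ?A x \<partial>N) \<le> sqrt (\<integral>x. (?w x)\<^sup>2 \<partial>N) * sqrt (\<integral>x. (indicator ?A x)\<^sup>2 \<partial>N)"
      using CS(2) by simp
    also have "(\<integral>x. (indicator ?A x :: real)\<^sup>2 \<partial>N) = H K"
    proof -
      have "(indicator ?A x :: real)\<^sup>2 = indicator ?A x" for x by (simp add: indicator_def)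
      then show ?thesis by (simp add: H_def)
    qed
    also have "sqrt (\<integral>x. (?w x)\<^sup>2 \<partial>N) * sqrt (H K) \<le> sqrt (D * H t) * sqrt (H K)"
    proof (intro mult_right_mono real_sqrt_le_mono)
      show "(\<integral>x. (?w x)\<^sup>2 \<partial>N) \<le> D * H t"
        using H_pos[of t] by (intro order_trans[OF elim(2) mult_right_mono[OF D(1)]]) simp
    qed (use H_pos[of K] in simp)
    finally have "(\<integral>x. ?w x \<partial>N) \<le> K / t + sqrt (D * H t) * sqrt (H K)" by simp
    then have "(\<integral>x. ?w x \<partial>N) / sqrt (H t) \<le> (K / t + sqrt (D * H t) * sqrt (H K)) / sqrt (H t)"
      using H_pos[of t] by (intro divide_right_mono) auto
    also have "\<dots> = K / sqrt (t\<^sup>2 * H t) + sqrt D * sqrt (H K)"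
      using H_pos[of t] elim(3) by (simp add: add_divide_distrib real_sqrt_mult real_sqrt_abs)
    also have "\<dots> < e" using add_strict_mono[OF elim(1) K(1)] by (simp only: field_sum_of_halves)
    finally have "(\<integral>x. ?w x \<partial>N) / sqrt (H t) < e" .
    moreover have "0 \<le> (\<integral>x. ?w x \<partial>N) / sqrt (H t)"
      using w01 H_pos[of t] by (intro divide_nonneg_nonneg integral_nonneg_AE) auto
    ultimately show ?case by simp
  qed
qed

text \<open>The mean excess of the scaled modulus over \<open>a\<close> is asymptotic to
  \<open>a powr (1 - \<alpha>) / (\<alpha> - 1) * H t\<close>; for \<alpha> > 1 the coefficient
  tends to 0 as \<open>a\<close> grows.\<close>

lemma tail_mean:
  assumes \<alpha>1: "\<alpha> > 1"
  shows "integrable N \<Psi>"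
    and "\<And>e. e > 0 \<Longrightarrow> \<exists>K\<ge>1. \<forall>\<^sub>F t in at_top. (\<integral>x. indicator {K<..} (\<bar>\<Psi> x\<bar> / t) * (\<bar>\<Psi> x\<bar> / t) \<partial>N) \<le> e * H t"
proof -
  define \<delta> where "\<delta> = (\<alpha> - 1) / 2"
  have \<delta>: "0 < \<delta>" "\<delta> \<le> \<alpha>" "1 < \<alpha> - \<delta>" using \<alpha>1 by (auto simp: \<delta>_def field_simps)
  \<comment> \<open>The primitive of \<open>k a\<close> is \<open>2 * (x - a)\<close> beyond
    \<open>a\<close> and is at least \<open>x\<close> once \<open>x \<ge> 2 * a\<close>; hence the
    factor 2 and the cut-off \<open>2 * a\<close> chosen for \<open>K\<close> at the end.\<close>
  define k :: "real \<Rightarrow> real \<Rightarrow> real" where "k a s = indicator {a..} s * 2" for a s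
  have km: "k a \<in> borel_measurable borel" for a unfolding k_def by measurable
  have int: "integrable lborel (\<lambda>s. indicator {0<..} s * (norm (k a s) * potter \<alpha> \<delta> s))" if a: "a > 0" for a
  proof -
    have "integrable lborel (\<lambda>s. indicator {a..} s * (norm (k a s) * potter \<alpha> \<delta> s))"
      by (rule integrable_potter_near_inf[OF km _ a \<delta>(3), where K = 2]) (use \<delta> in \<open>auto simp: k_def\<close>)
    then show ?thesis
      by (rule Bochner_Integration.integrable_cong[THEN iffD1, OF refl, rotated]) (use a in \<open>auto simp: indicator_def k_def\<close>)
  qed
  define h where "h a x = (\<integral>s. indicator {0<..<x} s * k a s \<partial>lborel)" for a x
  have h_eq: "h a x = (if x > a then 2 * (x - a) else 0)" if a: "a > 0" for a x
  proof -
    have "h a x = (\<integral>s. 2 * indicator {a..<x} s \<partial>lborel)"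
      unfolding h_def k_def using a by (intro Bochner_Integration.integral_cong) (auto simp: indicator_def)
    also have "\<dots> = (if x > a then 2 * (x - a) else 0)" by simp
    finally show ?thesis .
  qed
  have h_ge: "h a x \<ge> indicator {2 * a<..} x * x" "h a x \<ge> 0" "\<bar>x\<bar> \<le> 2 * a + h a \<bar>x\<bar>" if "a > 0" for a x
    using that by (auto simp: h_eq indicator_def)
  have J: "(\<integral>s. indicator {0<..} s * (s powr -\<alpha> * k a s) \<partial>lborel) = 2 * a powr (1 - \<alpha>) / (\<alpha> - 1)" if a: "a > 0" for a
  proof -
    have "(\<integral>s. indicator {0<..} s * (s powr -\<alpha> * k a s) \<partial>lborel) = (\<integral>s. 2 * (indicator {a..} s *\<^sub>R s powr -\<alpha>) \<partial>lborel)"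
      using a by (intro Bochner_Integration.integral_cong) (auto simp: indicator_def k_def)
    also have "\<dots> = 2 * (\<integral>s. indicator {a..} s *\<^sub>R s powr -\<alpha> \<partial>lborel)" by (rule integral_mult_right_zero)
    also have "\<dots> = 2 * (- (a powr (-\<alpha> + 1)) / (-\<alpha> + 1))"
      using set_integrable_powr_inf(2)[of "-\<alpha>" a] \<alpha>1 a by simp
    also have "\<dots> = 2 * a powr (1 - \<alpha>) / (\<alpha> - 1)" using \<alpha>1 by (simp add: field_simps)
    finally show ?thesis .
  qed
  note tf = tail_functional_real[OF one_sided_abs km \<delta>(1,2) int, folded h_def]
  have ev1: "\<forall>\<^sub>F t in at_top. integrable N (\<lambda>x. h 1 (\<bar>\<Psi> x\<bar> / t)) \<and> t > 0"
    by (intro eventually_conj tf(1) eventually_gt_at_top) simp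
  from eventually_happens[OF ev1] obtain t where t: "integrable N (\<lambda>x. h 1 (\<bar>\<Psi> x\<bar> / t))" "t > 0" by auto
  have "integrable N (\<lambda>x. t * (2 + h 1 (\<bar>\<Psi> x\<bar> / t)))" using t by simp
  then show "integrable N \<Psi>"
  proof (rule Bochner_Integration.integrable_bound)
    show "AE x in N. norm (\<Psi> x) \<le> norm (t * (2 + h 1 (\<bar>\<Psi> x\<bar> / t)))"
    proof (rule AE_I2)
      fix x
      have "\<bar>\<bar>\<Psi> x\<bar> / t\<bar> \<le> 2 * 1 + h 1 \<bar>\<bar>\<Psi> x\<bar> / t\<bar>" by (rule h_ge) simp
      then have "\<bar>\<Psi> x\<bar> \<le> t * (2 + h 1 (\<bar>\<Psi> x\<bar> / t))" using t(2) by (simp add: pos_divide_le_eq mult.commute)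
      then show "norm (\<Psi> x) \<le> norm (t * (2 + h 1 (\<bar>\<Psi> x\<bar> / t)))" by simp
    qed
  qed simp
  show "\<exists>K\<ge>1. \<forall>\<^sub>F t in at_top. (\<integral>x. indicator {K<..} (\<bar>\<Psi> x\<bar> / t) * (\<bar>\<Psi> x\<bar> / t) \<partial>N) \<le> e * H t" if e: "e > 0" for e
  proof -
    have "((\<lambda>a. 2 * a powr (1 - \<alpha>) / (\<alpha> - 1)) \<longlongrightarrow> 2 * 0 / (\<alpha> - 1)) at_top"
      using \<alpha>1 by (intro tendsto_intros tendsto_neg_powr filterlim_ident) auto
    then have "\<forall>\<^sub>F a in at_top. 2 * a powr (1 - \<alpha>) / (\<alpha> - 1) < e"
      using e by (intro order_tendstoD) auto
    then have "\<forall>\<^sub>F a in at_top. 2 * a powr (1 - \<alpha>) / (\<alpha> - 1) < e \<and> a \<ge> 1"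
      using eventually_ge_at_top[of 1] by eventually_elim simp
    from eventually_happens[OF this] obtain a where a: "2 * a powr (1 - \<alpha>) / (\<alpha> - 1) < e" "a \<ge> 1" by auto
    have a0: "a > 0" using a by simp
    have "((\<lambda>t. (\<integral>x. h a (\<bar>\<Psi> x\<bar> / t) \<partial>N) / H t) \<longlongrightarrow> 2 * a powr (1 - \<alpha>) / (\<alpha> - 1)) at_top"
      using tf(2)[OF a0] by (simp add: J[OF a0])
    then have "\<forall>\<^sub>F t in at_top. (\<integral>x. h a (\<bar>\<Psi> x\<bar> / t) \<partial>N) / H t < e"
      using a(1) by (rule order_tendstoD)
    then have "\<forall>\<^sub>F t in at_top. (\<integral>x. indicator {2*a<..} (\<bar>\<Psi> x\<bar> / t) * (\<bar>\<Psi> x\<bar> / t) \<partial>N) \<le> e * H t"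
      using tf(1)[OF a0] eventually_gt_at_top[of 0]
    proof eventually_elim
      case (elim t)
      have "(\<integral>x. indicator {2*a<..} (\<bar>\<Psi> x\<bar> / t) * (\<bar>\<Psi> x\<bar> / t) \<partial>N) \<le> (\<integral>x. h a (\<bar>\<Psi> x\<bar> / t) \<partial>N)"
      proof (rule integral_mono_AE')
        show "AE x in N. indicator {2*a<..} (\<bar>\<Psi> x\<bar> / t) * (\<bar>\<Psi> x\<bar> / t) \<le> h a (\<bar>\<Psi> x\<bar> / t)"
          by (intro AE_I2 h_ge a0)
        show "AE x in N. 0 \<le> h a (\<bar>\<Psi> x\<bar> / t)"
          by (intro AE_I2 h_ge a0)
      qed (rule elim(2))
      also have "\<dots> \<le> e * H t" using elim(1) H_pos[of t] by (simp add: pos_divide_less_eq)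
      finally show ?case .
    qed
    then show ?thesis using a(2) by (intro exI[of _ "2 * a"]) auto
  qed
qed

end

lemma null_sequence_below:
  fixes f g :: "nat \<Rightarrow> real"
  assumes "\<And>n. 0 \<le> f n" "\<And>n. f n \<le> g n" "g \<longlonglongrightarrow> 0"
  shows "f \<longlonglongrightarrow> 0"
  by (rule Lim_null_comparison[OF always_eventually assms(3)]) (use assms(1,2) in simp)

section \<open>Stable limits of heavy-tailed functionals\<close>

locale heavy_chain = stationary_chain S P \<pi> M X + heavy_tail \<pi> \<Psi> \<alpha> cp cm
  for S :: "'s measure" and P \<pi> and M :: "'a measure" and X \<Psi> \<alpha> cp cm +
  fixes B :: "nat \<Rightarrow> real"
  assumes gap: "L2_spectral_gap P \<pi>"
    and UI: "L2_uniformly_integrable_op P \<pi>"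
    and B_top: "filterlim B at_top sequentially"
    and B_norm: "(\<lambda>n. real n * H (B n)) \<longlonglongrightarrow> cp + cm"
begin

interpretation M: prob_space M by (rule prob_M)

lemma PsiS [measurable]: "\<Psi> \<in> borel_measurable S"
  using Psi by (simp cong: measurable_cong_sets add: sets_pi)

lemma eventually_along_B: "\<forall>\<^sub>F t in at_top. Q t \<Longrightarrow> \<forall>\<^sub>F n in sequentially. Q (B n)"
  using B_top by (auto simp: filterlim_iff)

lemma B_pos: "\<forall>\<^sub>F n in sequentially. B n > 0"
  by (rule eventually_along_B) (rule eventually_gt_at_top)

text \<open>With \<open>\<bar>B n\<bar>\<close> the weight lies in \<open>[0, 1]\<close> for every \<open>n\<close>; \<open>B n\<close> is positive only eventually.\<close>

definition w :: "nat \<Rightarrow> 's \<Rightarrow> real" where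
  "w n x = min 1 (\<bar>\<Psi> x\<bar> / \<bar>B n\<bar>)"

lemma w_measurable [measurable]: "w n \<in> borel_measurable S"
  unfolding w_def by measurable

lemma w_bounds: "0 \<le> w n x" "w n x \<le> 1" "\<bar>w n x\<bar> \<le> 1"
  by (auto simp: w_def min_def)

lemma weight_square: obtains C where "\<And>n. real n * (\<integral>x. (w n x)\<^sup>2 \<partial>\<pi>) \<le> C"
proof -
  obtain C0 where C0: "\<forall>\<^sub>F t in at_top. (\<integral>x. (min 1 (\<bar>\<Psi> x\<bar> / t))\<^sup>2 \<partial>\<pi>) \<le> C0 * H t"
    by (rule weight_square_bound)
  define C where "C = max C0 0"
  have "\<forall>\<^sub>F n in sequentially. real n * H (B n) < cp + cm + 1"
    by (rule order_tendstoD(2)[OF B_norm]) simp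
  with eventually_along_B[OF C0] B_pos have "\<forall>\<^sub>F n in sequentially. real n * (\<integral>x. (w n x)\<^sup>2 \<partial>\<pi>) \<le> C * (cp + cm + 1)"
  proof eventually_elim
    case (elim n)
    have "real n * (\<integral>x. (w n x)\<^sup>2 \<partial>\<pi>) \<le> real n * (C * H (B n))"
    proof (intro mult_left_mono)
      have "(\<integral>x. (w n x)\<^sup>2 \<partial>\<pi>) \<le> C0 * H (B n)" using elim(1,2) by (simp add: w_def)
      also have "\<dots> \<le> C * H (B n)" using H_pos[of "B n"] by (intro mult_right_mono) (auto simp: C_def)
      finally show "(\<integral>x. (w n x)\<^sup>2 \<partial>\<pi>) \<le> C * H (B n)" .
    qed simp
    also have "\<dots> = C * (real n * H (B n))" by simp
    also have "\<dots> \<le> C * (cp + cm + 1)" using elim(3) by (intro mult_left_mono) (auto simp: C_def)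
    finally show ?case .
  qed
  then obtain n0 where n0: "\<And>n. n \<ge> n0 \<Longrightarrow> real n * (\<integral>x. (w n x)\<^sup>2 \<partial>\<pi>) \<le> C * (cp + cm + 1)"
    by (auto simp: eventually_sequentially)
  \<comment> \<open>For the finitely many indices below \<open>n0\<close> the bound
    \<open>w n x \<le> 1\<close> suffices.\<close>
  have "real n * (\<integral>x. (w n x)\<^sup>2 \<partial>\<pi>) \<le> max (C * (cp + cm + 1)) (real n0)" for n
  proof (cases "n \<ge> n0")
    case False
    have "(\<integral>x. (w n x)\<^sup>2 \<partial>\<pi>) \<le> (\<integral>x. 1 \<partial>\<pi>)"
      by (rule integral_mono) (use w_bounds square_integrable[of "w n" 1] in \<open>auto simp: power_le_one\<close>)
    then have "real n * (\<integral>x. (w n x)\<^sup>2 \<partial>\<pi>) \<le> real n * 1"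
      by (intro mult_left_mono) (auto simp: prob_space)
    then show ?thesis using False by simp
  qed (use n0 in \<open>simp add: le_max_iff_disj\<close>)
  then show ?thesis by (rule that)
qed

text \<open>Applied to \<open>sqrt n * w n\<close>: bounded in \<open>L2\<close> by
  \<open>weight_square\<close>, and null in \<open>L1\<close> because \<open>n * H (B n)\<close>
  converges and \<open>weight_integral_small\<close> gains over
  \<open>sqrt (H (B n))\<close>.\<close>

lemma Op_weight_square_small: "(\<lambda>n. real n * (\<integral>x. (Op (w n) x)\<^sup>2 \<partial>\<pi>)) \<longlonglongrightarrow> 0"
proof -
  obtain C where C: "\<And>n. real n * (\<integral>x. (w n x)\<^sup>2 \<partial>\<pi>) \<le> C" using weight_square by blast
  define f where "f n x = sqrt (real n) * w n x" for n x
  have "(\<lambda>n. \<integral>x. (Op (f n) x)\<^sup>2 \<partial>\<pi>) \<longlonglongrightarrow> 0"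
  proof (rule Op_square_null_of_UI[OF UI])
    show "f n \<in> borel_measurable S" for n unfolding f_def by measurable
    show "\<bar>f n x\<bar> \<le> sqrt (real n)" for n x
      using w_bounds[of n x] by (simp add: f_def abs_mult mult_left_le)
    show "(\<integral>x. (f n x)\<^sup>2 \<partial>\<pi>) \<le> C" for n
      using C[of n] by (simp add: f_def power_mult_distrib)
    have l: "(\<lambda>n. sqrt (real n * H (B n)) * ((\<integral>x. min 1 (\<bar>\<Psi> x\<bar> / B n) \<partial>\<pi>) / sqrt (H (B n)))) \<longlonglongrightarrow> sqrt (cp + cm) * 0"
      by (intro tendsto_mult tendsto_real_sqrt B_norm filterlim_compose[OF weight_integral_small B_top])
    show "(\<lambda>n. \<integral>x. \<bar>f n x\<bar> \<partial>\<pi>) \<longlonglongrightarrow> 0"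
    proof (rule Lim_transform_eventually[OF l[unfolded mult_zero_right]], use B_pos in eventually_elim)
      case (elim n)
      have "\<bar>f n x\<bar> = sqrt (real n) * min 1 (\<bar>\<Psi> x\<bar> / B n)" for x
        using w_bounds(1)[of n x] elim by (simp add: f_def abs_mult) (simp add: w_def)
      then have "(\<integral>x. \<bar>f n x\<bar> \<partial>\<pi>) = sqrt (real n) * (\<integral>x. min 1 (\<bar>\<Psi> x\<bar> / B n) \<partial>\<pi>)"
        by simp
      then show ?case using H_pos[of "B n"] by (simp add: real_sqrt_mult)
    qed
  qed
  then show ?thesis by (simp add: f_def power_mult_distrib)
qed

section \<open>The twisting factor and uncentred sums\<close>

definition G :: "real \<Rightarrow> nat \<Rightarrow> 's \<Rightarrow> complex" where
  "G \<theta> n x = iexp (\<theta> * (\<Psi> x / B n))"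

lemma G_measurable [measurable]: "G \<theta> n \<in> borel_measurable S"
  unfolding G_def by measurable

lemma G_norm: "norm (G \<theta> n x) = 1" by (simp add: G_def)

lemma G_minus_1_le_2: "norm (G \<theta> n x - 1) \<le> 2"
  unfolding G_def by (rule iexp_lipschitz)

text \<open>The constant dominates both the trivial bound 2 and the Lipschitz constant, so that one
  multiple of the weight covers small and large values.\<close>

lemma G_minus_1: "norm (G \<theta> n x - 1) \<le> max 2 \<bar>\<theta>\<bar> * w n x"
proof -
  have "norm (G \<theta> n x - 1) \<le> \<bar>\<theta> * (\<Psi> x / B n)\<bar>" "norm (G \<theta> n x - 1) \<le> 2"
    unfolding G_def by (rule iexp_lipschitz)+
  then have "norm (G \<theta> n x - 1) \<le> min 2 (\<bar>\<theta>\<bar> * (\<bar>\<Psi> x\<bar> / \<bar>B n\<bar>))" by (simp add: abs_mult)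
  also have "\<dots> \<le> min (max 2 \<bar>\<theta>\<bar>) (max 2 \<bar>\<theta>\<bar> * (\<bar>\<Psi> x\<bar> / \<bar>B n\<bar>))"
    by (intro min.mono mult_right_mono) auto
  also have "\<dots> = max 2 \<bar>\<theta>\<bar> * w n x"
  proof -
    have m: "min c (c * y) = c * min 1 y" if "c > 0" for c y :: real
      using that by (cases "y \<ge> 1") (auto simp: min_def)
    show ?thesis unfolding w_def by (rule m) (simp add: less_max_iff_disj)
  qed
  finally show ?thesis .
qed

lemma G_minus_1_square_bounded: obtains C where "\<And>n. real n * (\<integral>x. (norm (G \<theta> n x - 1))\<^sup>2 \<partial>\<pi>) \<le> C" "C \<ge> 0"
proof -
  obtain C where C: "\<And>n. real n * (\<integral>x. (w n x)\<^sup>2 \<partial>\<pi>) \<le> C" using weight_square by blast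
  let ?c = "(max 2 \<bar>\<theta>\<bar>)\<^sup>2"
  have "real n * (\<integral>x. (norm (G \<theta> n x - 1))\<^sup>2 \<partial>\<pi>) \<le> ?c * C" for n
  proof -
    have "(\<integral>x. (norm (G \<theta> n x - 1))\<^sup>2 \<partial>\<pi>) \<le> (\<integral>x. ?c * (w n x)\<^sup>2 \<partial>\<pi>)"
    proof (rule integral_mono)
      show "integrable \<pi> (\<lambda>x. (norm (G \<theta> n x - 1))\<^sup>2)"
        by (rule norm_square_integrable[of _ 2]) (auto simp: G_minus_1_le_2)
      show "integrable \<pi> (\<lambda>x. ?c * (w n x)\<^sup>2)"
        using square_integrable[of "w n" 1] w_bounds by auto
      show "(norm (G \<theta> n x - 1))\<^sup>2 \<le> ?c * (w n x)\<^sup>2" for x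
        using power_mono[OF G_minus_1, of \<theta> n x 2] by (simp add: power_mult_distrib)
    qed
    then have "real n * (\<integral>x. (norm (G \<theta> n x - 1))\<^sup>2 \<partial>\<pi>) \<le> real n * (?c * (\<integral>x. (w n x)\<^sup>2 \<partial>\<pi>))"
      by (intro mult_left_mono) auto
    also have "\<dots> = ?c * (real n * (\<integral>x. (w n x)\<^sup>2 \<partial>\<pi>))" by simp
    also have "\<dots> \<le> ?c * C" using C[of n] by (intro mult_left_mono) auto
    finally show ?thesis .
  qed
  moreover have "0 \<le> ?c * C" using C[of 0] by simp
  ultimately show ?thesis by (rule that)
qed

lemma Op_G_minus_1_square_small: "(\<lambda>n. real n * (\<integral>x. (Op (\<lambda>y. norm (G \<theta> n y - 1)) x)\<^sup>2 \<partial>\<pi>)) \<longlonglongrightarrow> 0"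
proof -
  let ?c = "(max 2 \<bar>\<theta>\<bar>)\<^sup>2"
  have "(\<integral>x. (Op (\<lambda>y. norm (G \<theta> n y - 1)) x)\<^sup>2 \<partial>\<pi>) \<le> ?c * (\<integral>x. (Op (w n) x)\<^sup>2 \<partial>\<pi>)" for n
  proof -
    have ob: "\<bar>Op (\<lambda>y. norm (G \<theta> n y - 1)) x\<bar> \<le> 2" "\<bar>Op (w n) x\<bar> \<le> 1" if "x \<in> space S" for x
      using Op_bounded[OF that, of "\<lambda>y. norm (G \<theta> n y - 1)" 2] Op_bounded[OF that, of "w n" 1] w_bounds
      by (auto simp: G_minus_1_le_2)
    have "(\<integral>x. (Op (\<lambda>y. norm (G \<theta> n y - 1)) x)\<^sup>2 \<partial>\<pi>) \<le> (\<integral>x. ?c * (Op (w n) x)\<^sup>2 \<partial>\<pi>)"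
    proof (rule integral_mono)
      show "integrable \<pi> (\<lambda>x. (Op (\<lambda>y. norm (G \<theta> n y - 1)) x)\<^sup>2)"
        by (rule square_integrable[OF _ ob(1)]) auto
      show "integrable \<pi> (\<lambda>x. ?c * (Op (w n) x)\<^sup>2)"
        using square_integrable[OF _ ob(2)] by auto
      fix x assume "x \<in> space \<pi>"
      then have x: "x \<in> space S" by (simp add: space_pi)
      have iw: "integrable (P x) (w n)"
        by (rule bounded_integrable_P[OF x, of _ 1]) (use w_bounds in auto)
      have "Op (\<lambda>y. norm (G \<theta> n y - 1)) x \<le> (\<integral>y. max 2 \<bar>\<theta>\<bar> * w n y \<partial>P x)"
      proof (rule integral_mono)
        show "integrable (P x) (\<lambda>y. norm (G \<theta> n y - 1))"
          by (rule bounded_integrable_P[OF x, of _ 2]) (auto simp: G_minus_1_le_2)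
      qed (use iw G_minus_1 in auto)
      then have "Op (\<lambda>y. norm (G \<theta> n y - 1)) x \<le> max 2 \<bar>\<theta>\<bar> * Op (w n) x" using iw by simp
      then have "(Op (\<lambda>y. norm (G \<theta> n y - 1)) x)\<^sup>2 \<le> (max 2 \<bar>\<theta>\<bar> * Op (w n) x)\<^sup>2"
        by (intro power_mono integral_nonneg_AE) auto
      then show "(Op (\<lambda>y. norm (G \<theta> n y - 1)) x)\<^sup>2 \<le> ?c * (Op (w n) x)\<^sup>2"
        by (simp add: power_mult_distrib)
    qed
    then show ?thesis by simp
  qed
  then have le: "real n * (\<integral>x. (Op (\<lambda>y. norm (G \<theta> n y - 1)) x)\<^sup>2 \<partial>\<pi>) \<le> ?c * (real n * (\<integral>x. (Op (w n) x)\<^sup>2 \<partial>\<pi>))" for n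
    using mult_left_mono[of _ _ "real n"] by (simp add: mult.left_commute)
  have "(\<lambda>n. ?c * (real n * (\<integral>x. (Op (w n) x)\<^sup>2 \<partial>\<pi>))) \<longlonglongrightarrow> ?c * 0"
    by (intro tendsto_intros Op_weight_square_small)
  then have lim: "(\<lambda>n. ?c * (real n * (\<integral>x. (Op (w n) x)\<^sup>2 \<partial>\<pi>))) \<longlonglongrightarrow> 0" by simp
  show ?thesis
    by (rule null_sequence_below[OF _ le lim]) (intro mult_nonneg_nonneg integral_nonneg_AE, auto)
qed

text \<open>The factor \<open>n\<close> in \<open>twisted_iter_mean\<close> is distributed as
  \<open>sqrt n * sqrt n\<close> over the two norms: the first product stays bounded, the second
  tends to 0.\<close>

lemma twisted_limit:
  assumes qm: "\<And>n. q n \<in> borel_measurable S" and qb: "\<And>n x. norm (q n x) \<le> 1"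
    and Q: "(\<lambda>n. real n * (\<integral>x. (norm (q n x - 1))\<^sup>2 \<partial>\<pi>)) \<longlonglongrightarrow> 0"
    and lam: "(\<lambda>n. (\<integral>x. q n x * Op (G \<theta> n) x \<partial>\<pi>) ^ n) \<longlonglongrightarrow> L"
  shows "(\<lambda>n. \<integral>x. twisted_iter P (q n) (G \<theta> n) n x \<partial>\<pi>) \<longlonglongrightarrow> L"
proof -
  obtain a where a: "0 \<le> a" "a < 1"
    "\<And>(f :: 's \<Rightarrow> real) b. f \<in> borel_measurable S \<Longrightarrow> (\<And>x. x \<in> space S \<Longrightarrow> \<bar>f x\<bar> \<le> b) \<Longrightarrow> (\<integral>x. f x \<partial>\<pi>) = 0 \<Longrightarrow>
      (\<integral>x. (Op f x)\<^sup>2 \<partial>\<pi>) \<le> a\<^sup>2 * (\<integral>x. (f x)\<^sup>2 \<partial>\<pi>)"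
    using spectral_gap_contraction[OF gap] by blast
  obtain C where C: "\<And>n. real n * (\<integral>x. (norm (G \<theta> n x - 1))\<^sup>2 \<partial>\<pi>) \<le> C" "C \<ge> 0" using G_minus_1_square_bounded[of \<theta>] by blast
  define D where "D = 8 / (1 - a)\<^sup>2"
  have D0: "D \<ge> 0" by (simp add: D_def)
  let ?Q = "\<lambda>n. \<integral>x. (norm (q n x - 1))\<^sup>2 \<partial>\<pi>"
  let ?V = "\<lambda>n. \<integral>x. (norm (G \<theta> n x - 1))\<^sup>2 \<partial>\<pi>"
  let ?U = "\<lambda>n. \<integral>x. (Op (\<lambda>y. norm (G \<theta> n y - 1)) x)\<^sup>2 \<partial>\<pi>"
  have bd: "norm ((\<integral>x. twisted_iter P (q n) (G \<theta> n) n x \<partial>\<pi>) - (\<integral>x. q n x * Op (G \<theta> n) x \<partial>\<pi>) ^ n) \<le>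
      (sqrt (real n * ?Q n) + sqrt C) * sqrt (D * (real n * ?Q n + real n * ?U n))" for n
  proof -
    have "norm ((\<integral>x. twisted_iter P (q n) (G \<theta> n) n x \<partial>\<pi>) - (\<integral>x. q n x * Op (G \<theta> n) x \<partial>\<pi>) ^ n) \<le>
        real n * ((sqrt (?Q n) + sqrt (?V n)) * sqrt (D * (?Q n + ?U n)))"
      unfolding D_def by (rule twisted_iter_mean[OF a qm qb]) (use G_norm in auto)
    also have "\<dots> = (sqrt (real n) * (sqrt (?Q n) + sqrt (?V n))) * (sqrt (real n) * sqrt (D * (?Q n + ?U n)))"
      by (simp add: mult_ac)
    also have "\<dots> = (sqrt (real n * ?Q n) + sqrt (real n * ?V n)) * sqrt (D * (real n * ?Q n + real n * ?U n))"
      by (simp add: real_sqrt_mult[symmetric] distrib_left mult_ac)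
    also have "\<dots> \<le> (sqrt (real n * ?Q n) + sqrt C) * sqrt (D * (real n * ?Q n + real n * ?U n))"
      using C(1)[of n] D0 by (intro mult_right_mono add_left_mono real_sqrt_le_mono)
        (auto intro!: mult_nonneg_nonneg add_nonneg_nonneg integral_nonneg_AE)
    finally show ?thesis .
  qed
  have "(\<lambda>n. (sqrt (real n * ?Q n) + sqrt C) * sqrt (D * (real n * ?Q n + real n * ?U n))) \<longlonglongrightarrow>
      (sqrt 0 + sqrt C) * sqrt (D * (0 + 0))"
    by (intro tendsto_intros Q Op_G_minus_1_square_small)
  then have l0: "(\<lambda>n. (sqrt (real n * ?Q n) + sqrt C) * sqrt (D * (real n * ?Q n + real n * ?U n))) \<longlonglongrightarrow> 0"
    by simp
  have "(\<lambda>n. (\<integral>x. twisted_iter P (q n) (G \<theta> n) n x \<partial>\<pi>) - (\<integral>x. q n x * Op (G \<theta> n) x \<partial>\<pi>) ^ n) \<longlonglongrightarrow> 0"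
    by (rule Lim_null_comparison[OF _ l0]) (use bd in \<open>auto intro!: always_eventually\<close>)
  from tendsto_add[OF this lam] show ?thesis by simp
qed

text \<open>Used with \<open>g = 0\<close> for plain sums and with \<open>g\<close> the negative of
  \<open>Op \<Psi>\<close> for centred ones.\<close>

lemma char_sum:
  "char (distr M borel (\<lambda>\<omega>. (\<Sum>j=1..n. \<Psi> (X j \<omega>) + g (X (j - 1) \<omega>)) / B n)) \<theta> =
    (\<integral>x. twisted_iter P (\<lambda>x. iexp (\<theta> * (g x / B n))) (G \<theta> n) n x \<partial>\<pi>)"
  if g [measurable]: "g \<in> borel_measurable S"
proof -
  have "char (distr M borel (\<lambda>\<omega>. (\<Sum>j=1..n. \<Psi> (X j \<omega>) + g (X (j - 1) \<omega>)) / B n)) \<theta> =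
      (\<integral>\<omega>. iexp (\<theta> * ((\<Sum>j=1..n. \<Psi> (X j \<omega>) + g (X (j - 1) \<omega>)) / B n)) \<partial>M)"
    unfolding char_def by (subst integral_distr) auto
  also have "\<dots> = (\<integral>\<omega>. (\<Prod>j=1..n. iexp (\<theta> * (g (X (j - 1) \<omega>) / B n)) * G \<theta> n (X j \<omega>)) \<partial>M)"
  proof (rule Bochner_Integration.integral_cong[OF refl])
    fix \<omega>
    have "\<i> * complex_of_real (\<theta> * ((\<Sum>j=1..n. \<Psi> (X j \<omega>) + g (X (j - 1) \<omega>)) / B n)) =
        (\<Sum>j=1..n. \<i> * complex_of_real (\<theta> * (g (X (j - 1) \<omega>) / B n)) + \<i> * complex_of_real (\<theta> * (\<Psi> (X j \<omega>) / B n)))"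
      by (simp add: sum_distrib_left sum_divide_distrib algebra_simps add_divide_distrib)
    then show "iexp (\<theta> * ((\<Sum>j=1..n. \<Psi> (X j \<omega>) + g (X (j - 1) \<omega>)) / B n)) =
        (\<Prod>j=1..n. iexp (\<theta> * (g (X (j - 1) \<omega>) / B n)) * G \<theta> n (X j \<omega>))"
      by (simp only: exp_sum[OF finite_atLeastAtMost] exp_add G_def)
  qed
  also have "\<dots> = (\<integral>x. twisted_iter P (\<lambda>x. iexp (\<theta> * (g x / B n))) (G \<theta> n) n x \<partial>\<pi>)"
    by (rule expectation_prod) (auto simp: G_norm)
  finally show ?thesis .
qed

lemma tail_test_seq_limit:
  assumes f: "tail_test f" "tail_test (\<lambda>x. f (-x))" "f 0 = 0"
  shows "(\<lambda>n. of_nat n * (\<integral>x. f (\<Psi> x / B n) \<partial>\<pi>)) \<longlonglongrightarrow> (\<integral>x. f x \<partial>stable_levy_measure \<alpha> cp cm)"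
proof -
  let ?I = "\<integral>x. f x \<partial>stable_levy_measure \<alpha> cp cm"
  have "(\<lambda>n. (real n * H (B n)) *\<^sub>R ((\<integral>x. f (\<Psi> x / B n) \<partial>\<pi>) /\<^sub>R H (B n))) \<longlonglongrightarrow> (cp + cm) *\<^sub>R (?I /\<^sub>R (cp + cm))"
    by (intro tendsto_intros B_norm filterlim_compose[OF tail_test_two_sided[OF f] B_top])
  moreover have "(real n * H (B n)) *\<^sub>R ((\<integral>x. f (\<Psi> x / B n) \<partial>\<pi>) /\<^sub>R H (B n)) = of_nat n * (\<integral>x. f (\<Psi> x / B n) \<partial>\<pi>)" for n
  proof -
    have "H (B n) \<noteq> 0" using H_pos[of "B n"] by simp
    then show ?thesis by (simp add: scaleR_conv_of_real)
  qed
  moreover have "(cp + cm) *\<^sub>R (?I /\<^sub>R (cp + cm)) = ?I" using c_pos by simp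
  ultimately show ?thesis by simp
qed

text \<open>With \<open>q = 1\<close> stationarity removes \<open>Op\<close> from the mean factor;
  what remains is the characteristic function of a single scaled variable, raised to the power
  \<open>n\<close> as for independent summands.\<close>

lemma limit_uncentred:
  assumes lam: "\<And>\<theta>. (\<lambda>n. (\<integral>x. G \<theta> n x \<partial>\<pi>) ^ n) \<longlonglongrightarrow> char \<mu> \<theta>" and \<mu>: "real_distribution \<mu>"
  shows "weak_conv_m (\<lambda>n. distr M borel (\<lambda>\<omega>. (\<Sum>j=1..n. \<Psi> (X j \<omega>)) / B n)) \<mu>"
proof (rule levy_continuity[OF _ \<mu>])
  show "real_distribution (distr M borel (\<lambda>\<omega>. (\<Sum>j=1..n. \<Psi> (X j \<omega>)) / B n))" for n
    by (rule M.real_distribution_distr) auto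
  fix \<theta>
  have gi: "(\<integral>x. Op (G \<theta> n) x \<partial>\<pi>) = (\<integral>x. G \<theta> n x \<partial>\<pi>)" for n
    by (rule Op_integrable(3)[OF bounded_integrable[of _ 1]]) (auto simp: G_norm)
  have "(\<lambda>n. \<integral>x. twisted_iter P (\<lambda>_. 1) (G \<theta> n) n x \<partial>\<pi>) \<longlonglongrightarrow> char \<mu> \<theta>"
    by (rule twisted_limit) (use lam gi in auto)
  moreover have "char (distr M borel (\<lambda>\<omega>. (\<Sum>j=1..n. \<Psi> (X j \<omega>)) / B n)) \<theta> =
      (\<integral>x. twisted_iter P (\<lambda>_. 1) (G \<theta> n) n x \<partial>\<pi>)" for n
    using char_sum[of "\<lambda>_. 0" n \<theta>] by simp
  ultimately show "(\<lambda>n. char (distr M borel (\<lambda>\<omega>. (\<Sum>j=1..n. \<Psi> (X j \<omega>)) / B n)) \<theta>) \<longlonglongrightarrow> char \<mu> \<theta>"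
    by simp
qed

lemma G_char_norm: "norm (\<integral>x. G \<theta> n x \<partial>\<pi>) \<le> 1"
  by (rule integral_norm_le_1) (auto simp: G_norm)

lemma limit_lt_1:
  assumes "\<alpha> < 1" "is_stable_law \<alpha> cp cm \<mu>"
  shows "weak_conv_m (\<lambda>n. distr M borel (\<lambda>\<omega>. (\<Sum>j=1..n. \<Psi> (X j \<omega>)) / B n)) \<mu>"
proof (rule limit_uncentred)
  fix \<theta>
  have t: "tail_test (\<lambda>x. iexp (\<theta> * x) - 1)" "tail_test (\<lambda>x. iexp (\<theta> * (-x)) - 1)"
    using tail_test_iexp_lt_1[OF assms(1), of \<theta>] tail_test_iexp_lt_1[OF assms(1), of "-\<theta>"] by simp_all
  have "(\<lambda>n. of_nat n * (\<integral>x. iexp (\<theta> * (\<Psi> x / B n)) - 1 \<partial>\<pi>)) \<longlonglongrightarrow> stable_exponent \<alpha> cp cm \<theta>"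
    using tail_test_seq_limit[OF t] assms(1) by (simp add: stable_exponent_def)
  moreover have "(\<integral>x. iexp (\<theta> * (\<Psi> x / B n)) - 1 \<partial>\<pi>) = (\<integral>x. G \<theta> n x \<partial>\<pi>) - 1" for n
    unfolding G_def[symmetric] using bounded_integrable[of "G \<theta> n" 1] by (simp add: G_norm prob_space)
  ultimately have "(\<lambda>n. (\<integral>x. G \<theta> n x \<partial>\<pi>) ^ n) \<longlonglongrightarrow> exp (stable_exponent \<alpha> cp cm \<theta>)"
    by (intro power_tendsto_exp G_char_norm) simp
  then show "(\<lambda>n. (\<integral>x. G \<theta> n x \<partial>\<pi>) ^ n) \<longlonglongrightarrow> char \<mu> \<theta>"
    using assms(2) by (simp add: is_stable_law_def)
qed (use assms(2) in \<open>simp add: is_stable_law_def\<close>)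

end

text \<open>Separates a part \<open>a\<close> known in \<open>L2\<close> from a part
  \<open>b\<close> known in \<open>L1\<close>: \<open>u\<close> is at most twice the larger one, and
  the minimum allows the square for the former and the modulus for the latter.\<close>

lemma min_square_abs_le:
  fixes u a b :: real
  assumes "\<bar>u\<bar> \<le> a + b" "0 \<le> a" "0 \<le> b"
  shows "min (u\<^sup>2) \<bar>u\<bar> \<le> 4 * a\<^sup>2 + 2 * b"
proof (cases "b \<le> a")
  case True
  then have "\<bar>u\<bar> \<le> 2 * a" using assms by simp
  then have "\<bar>u\<bar>\<^sup>2 \<le> (2 * a)\<^sup>2" by (intro power_mono) auto
  then have "u\<^sup>2 \<le> 4 * a\<^sup>2 + 2 * b" using assms by (simp add: power_mult_distrib)
  then show ?thesis by (rule min.coboundedI1)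
next
  case False
  then have "\<bar>u\<bar> \<le> 4 * a\<^sup>2 + 2 * b" using assms zero_le_power2[of a] by linarith
  then show ?thesis by (rule min.coboundedI2)
qed

text \<open>The same minimum controls the squared size of \<open>iexp u - 1\<close> here and its
  second-order remainder in \<open>iexp_taylor_min\<close>, so one estimate of the drift serves
  both.\<close>

lemma iexp_minus_1_square: "(norm (iexp u - 1))\<^sup>2 \<le> 4 * min (u\<^sup>2) \<bar>u\<bar>"
proof (cases "\<bar>u\<bar> \<le> 1")
  case True
  have "(norm (iexp u - 1))\<^sup>2 \<le> \<bar>u\<bar>\<^sup>2" by (intro power_mono iexp_lipschitz) auto
  then have "(norm (iexp u - 1))\<^sup>2 \<le> 4 * u\<^sup>2" unfolding power2_abs using zero_le_power2[of u] by linarith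
  moreover have "u\<^sup>2 \<le> \<bar>u\<bar>" using True by (metis abs_ge_zero mult_left_le power2_abs power2_eq_square)
  ultimately show ?thesis by (simp add: min_absorb1)
next
  case False
  have "(norm (iexp u - 1))\<^sup>2 \<le> 2\<^sup>2" by (intro power_mono iexp_lipschitz) auto
  moreover have "\<bar>u\<bar> \<le> u\<^sup>2" using False by (metis abs_ge_zero linear mult_right_mono mult_1 power2_abs power2_eq_square)
  ultimately show ?thesis using False by (simp add: min_absorb2)
qed

lemma iexp_taylor_min: "norm (iexp u - 1 - \<i> * u) \<le> 2 * min (u\<^sup>2) \<bar>u\<bar>"
proof -
  have "norm (iexp u - 1 - \<i> * u) \<le> u\<^sup>2 / 2"
    using iexp_approx1[of u 1] by (simp add: power2_eq_square diff_diff_eq)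
  then have "norm (iexp u - 1 - \<i> * u) \<le> 2 * u\<^sup>2" using zero_le_power2[of u] by linarith
  moreover have "norm (iexp u - 1 - \<i> * u) \<le> 2 * \<bar>u\<bar>"
    using iexp_approx2[of u 1] by (simp add: diff_diff_eq)
  ultimately show ?thesis by (simp add: min_def)
qed

section \<open>Centred sums for \<alpha> > 1\<close>

context heavy_chain
begin

context
  assumes \<alpha>1: "\<alpha> > 1"
begin

lemma Psi_integrable: "integrable \<pi> \<Psi>" by (rule tail_mean(1)[OF \<alpha>1])

lemma OpPsi_integrable: "integrable \<pi> (Op \<Psi>)" by (rule Op_integrable(2)[OF Psi_integrable])

definition drift :: "real \<Rightarrow> nat \<Rightarrow> 's \<Rightarrow> real" where
  "drift \<theta> n x = \<theta> * (Op \<Psi> x / B n)"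

lemma drift_measurable [measurable]: "drift \<theta> n \<in> borel_measurable S"
  unfolding drift_def by measurable

lemma drift_integrable: "integrable \<pi> (\<lambda>x. min ((drift \<theta> n x)\<^sup>2) \<bar>drift \<theta> n x\<bar>)" "integrable \<pi> (drift \<theta> n)"
proof -
  show i: "integrable \<pi> (drift \<theta> n)" unfolding drift_def using OpPsi_integrable by auto
  show "integrable \<pi> (\<lambda>x. min ((drift \<theta> n x)\<^sup>2) \<bar>drift \<theta> n x\<bar>)"
    by (rule Bochner_Integration.integrable_bound[OF i]) (auto simp: abs_of_nonneg intro!: AE_I2)
qed

text \<open>Truncate \<open>\<Psi>\<close> at level \<open>K B n\<close>: the bounded part is negligible in \<open>L\<^sup>2\<close> by uniform
  integrability, and the tail is small in \<open>L\<^sup>1\<close> for large \<open>K\<close>.\<close>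

lemma drift_small: "(\<lambda>n. real n * (\<integral>x. min ((drift \<theta> n x)\<^sup>2) \<bar>drift \<theta> n x\<bar> \<partial>\<pi>)) \<longlonglongrightarrow> 0"
proof (rule tendstoI, goal_cases)
  case (1 e)
  define c where "c = cp + cm + 1"
  have c: "c > 0" using c_pos by (simp add: c_def)
  \<comment> \<open>\<open>T\<close> stays positive for \<theta> = 0, so \<open>e'\<close> is
    defined. As \<open>c\<close> eventually bounds \<open>n * H (B n)\<close>, the tail part stays
    below \<open>e / 2\<close>.\<close>
  define T where "T = \<bar>\<theta>\<bar> + 1"
  have T: "T > 0" "\<bar>\<theta>\<bar> < T" by (auto simp: T_def)
  define e' where "e' = e / (4 * T * c)"
  have e': "e' > 0" using 1 c T by (simp add: e'_def)
  have e2: "2 * \<bar>\<theta>\<bar> * (e' * c) < e / 2"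
  proof -
    have "2 * \<bar>\<theta>\<bar> * (e' * c) < 2 * T * (e' * c)" using e' c T by (intro mult_strict_right_mono) auto
    also have "\<dots> = e / 2" using c T by (simp add: e'_def field_simps)
    finally show ?thesis .
  qed
  obtain K where K: "K \<ge> 1" "\<forall>\<^sub>F t in at_top. (\<integral>x. indicator {K<..} (\<bar>\<Psi> x\<bar> / t) * (\<bar>\<Psi> x\<bar> / t) \<partial>\<pi>) \<le> e' * H t"
    using tail_mean(2)[OF \<alpha>1 e'] by blast
  have "(\<lambda>n. 4 * (\<bar>\<theta>\<bar> * K)\<^sup>2 * (real n * (\<integral>x. (Op (w n) x)\<^sup>2 \<partial>\<pi>))) \<longlonglongrightarrow> 4 * (\<bar>\<theta>\<bar> * K)\<^sup>2 * 0"
    by (intro tendsto_intros Op_weight_square_small)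
  then have "\<forall>\<^sub>F n in sequentially. 4 * (\<bar>\<theta>\<bar> * K)\<^sup>2 * (real n * (\<integral>x. (Op (w n) x)\<^sup>2 \<partial>\<pi>)) < e / 2"
    using 1 by (intro order_tendstoD) auto
  moreover have "\<forall>\<^sub>F n in sequentially. real n * H (B n) < c"
    by (rule order_tendstoD(2)[OF B_norm]) (simp add: c_def)
  ultimately show ?case using eventually_along_B[OF K(2)] B_pos
  proof eventually_elim
    case (elim n)
    define g where "g x = indicator {K<..} (\<bar>\<Psi> x\<bar> / B n) * (\<bar>\<Psi> x\<bar> / B n)" for x
    have gm [measurable]: "g \<in> borel_measurable S" unfolding g_def by measurable
    have g0: "g x \<ge> 0" for x using elim(4) by (simp add: g_def)
    have iB: "integrable \<pi> (\<lambda>x. \<bar>\<Psi> x\<bar> / B n)" using Psi_integrable by simp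
    have gi: "integrable \<pi> g"
      by (rule Bochner_Integration.integrable_bound[OF iB]) (auto simp: g_def indicator_def intro!: AE_I2)
    \<comment> \<open>Up to level \<open>K\<close> the scaled modulus is at most \<open>K\<close>
      times its truncation at 1, because \<open>K \<ge> 1\<close>; beyond it \<open>g\<close> takes
      everything.\<close>
    have dom: "\<bar>\<Psi> x\<bar> / B n \<le> K * w n x + g x" for x
    proof -
      define y where "y = \<bar>\<Psi> x\<bar> / B n"
      have y0: "y \<ge> 0" using elim(4) by (simp add: y_def)
      have "y \<le> K * min 1 y + indicator {K<..} y * y"
      proof (cases "y > K")
        case False
        have "1 * y \<le> K * y" using K(1) y0 by (rule mult_right_mono)
        then show ?thesis using False K(1) by (auto simp: min_def)
      qed (use K(1) in auto)
      moreover have "\<bar>B n\<bar> = B n" using elim(4) by simp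
      ultimately show ?thesis unfolding w_def g_def y_def by simp
    qed
    have ae: "AE x in \<pi>. \<bar>drift \<theta> n x\<bar> \<le> \<bar>\<theta>\<bar> * K * Op (w n) x + \<bar>\<theta>\<bar> * Op g x"
      using Op_integrable(1)[OF Psi_integrable] Op_integrable(1)[OF gi] AE_space
    proof eventually_elim
      case (elim x)
      then have x: "x \<in> space S" by (simp add: space_pi)
      have iw: "integrable (P x) (w n)"
        by (rule bounded_integrable_P[OF x, of _ 1]) (use w_bounds in auto)
      have "\<bar>Op \<Psi> x\<bar> / B n \<le> (\<integral>y. \<bar>\<Psi> y\<bar> \<partial>P x) / B n"
        using \<open>0 < B n\<close> by (intro divide_right_mono integral_abs_bound) auto
      also have "\<dots> = (\<integral>y. \<bar>\<Psi> y\<bar> / B n \<partial>P x)" by simp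
      also have "\<dots> \<le> (\<integral>y. K * w n y + g y \<partial>P x)"
        by (rule integral_mono) (use elim iw dom in auto)
      also have "\<dots> = K * Op (w n) x + Op g x" using iw elim by simp
      finally have "\<bar>\<theta>\<bar> * (\<bar>Op \<Psi> x\<bar> / B n) \<le> \<bar>\<theta>\<bar> * (K * Op (w n) x + Op g x)" by (rule mult_left_mono) simp
      then show ?case using \<open>0 < B n\<close> by (simp add: drift_def abs_mult distrib_left mult_ac)
    qed
    have iOw: "integrable \<pi> (\<lambda>x. (Op (w n) x)\<^sup>2)"
      by (rule square_integrable[of _ 1]) (use Op_bounded[of _ "w n" 1] w_bounds in auto)
    have iOg: "integrable \<pi> (Op g)" by (rule Op_integrable(2)[OF gi])
    have Ow0: "Op (w n) x \<ge> 0" "Op g x \<ge> 0" for x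
      using w_bounds g0 by (auto intro!: integral_nonneg_AE)
    have "(\<integral>x. min ((drift \<theta> n x)\<^sup>2) \<bar>drift \<theta> n x\<bar> \<partial>\<pi>) \<le> (\<integral>x. 4 * (\<bar>\<theta>\<bar> * K)\<^sup>2 * (Op (w n) x)\<^sup>2 + 2 * \<bar>\<theta>\<bar> * Op g x \<partial>\<pi>)"
    proof (rule integral_mono_AE)
      show "AE x in \<pi>. min ((drift \<theta> n x)\<^sup>2) \<bar>drift \<theta> n x\<bar> \<le> 4 * (\<bar>\<theta>\<bar> * K)\<^sup>2 * (Op (w n) x)\<^sup>2 + 2 * \<bar>\<theta>\<bar> * Op g x"
        using ae
      proof eventually_elim
        case (elim x)
        from min_square_abs_le[OF elim] Ow0[of x] K(1) show ?case by (simp add: power_mult_distrib)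
      qed
    qed (use drift_integrable iOw iOg in auto)
    also have "\<dots> = 4 * (\<bar>\<theta>\<bar> * K)\<^sup>2 * (\<integral>x. (Op (w n) x)\<^sup>2 \<partial>\<pi>) + 2 * \<bar>\<theta>\<bar> * (\<integral>x. g x \<partial>\<pi>)"
      using iOw iOg Op_integrable(3)[OF gi] by simp
    also have "\<dots> \<le> 4 * (\<bar>\<theta>\<bar> * K)\<^sup>2 * (\<integral>x. (Op (w n) x)\<^sup>2 \<partial>\<pi>) + 2 * \<bar>\<theta>\<bar> * (e' * H (B n))"
      using elim(3) by (intro add_left_mono mult_left_mono) (auto simp: g_def)
    finally have "real n * (\<integral>x. min ((drift \<theta> n x)\<^sup>2) \<bar>drift \<theta> n x\<bar> \<partial>\<pi>) \<le>
        real n * (4 * (\<bar>\<theta>\<bar> * K)\<^sup>2 * (\<integral>x. (Op (w n) x)\<^sup>2 \<partial>\<pi>) + 2 * \<bar>\<theta>\<bar> * (e' * H (B n)))"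
      by (rule mult_left_mono) simp
    also have "\<dots> = 4 * (\<bar>\<theta>\<bar> * K)\<^sup>2 * (real n * (\<integral>x. (Op (w n) x)\<^sup>2 \<partial>\<pi>)) + 2 * \<bar>\<theta>\<bar> * (e' * (real n * H (B n)))"
      by (simp only: distrib_left mult_ac)
    also have "2 * \<bar>\<theta>\<bar> * (e' * (real n * H (B n))) \<le> 2 * \<bar>\<theta>\<bar> * (e' * c)"
      using elim(2) e' by (intro mult_left_mono) auto
    finally have "real n * (\<integral>x. min ((drift \<theta> n x)\<^sup>2) \<bar>drift \<theta> n x\<bar> \<partial>\<pi>) < e"
      using elim(1) e2 by linarith
    moreover have "0 \<le> real n * (\<integral>x. min ((drift \<theta> n x)\<^sup>2) \<bar>drift \<theta> n x\<bar> \<partial>\<pi>)"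
      by (intro mult_nonneg_nonneg integral_nonneg_AE) auto
    ultimately show ?case by simp
  qed
qed

definition q :: "real \<Rightarrow> nat \<Rightarrow> 's \<Rightarrow> complex" where
  "q \<theta> n x = iexp (- drift \<theta> n x)"

lemma q_measurable [measurable]: "q \<theta> n \<in> borel_measurable S"
  unfolding q_def by measurable

lemma q_minus_1_le_2: "norm (q \<theta> n x - 1) \<le> 2" unfolding q_def by (rule iexp_lipschitz)

lemma q_minus_1_square_small: "(\<lambda>n. real n * (\<integral>x. (norm (q \<theta> n x - 1))\<^sup>2 \<partial>\<pi>)) \<longlonglongrightarrow> 0"
proof (rule null_sequence_below)
  have "(\<integral>x. (norm (q \<theta> n x - 1))\<^sup>2 \<partial>\<pi>) \<le> (\<integral>x. 4 * min ((drift \<theta> n x)\<^sup>2) \<bar>drift \<theta> n x\<bar> \<partial>\<pi>)" for n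
  proof (rule integral_mono)
    show "(norm (q \<theta> n x - 1))\<^sup>2 \<le> 4 * min ((drift \<theta> n x)\<^sup>2) \<bar>drift \<theta> n x\<bar>" for x
      unfolding q_def using iexp_minus_1_square[of "- drift \<theta> n x"] by simp
    show "integrable \<pi> (\<lambda>x. (norm (q \<theta> n x - 1))\<^sup>2)"
      by (rule norm_square_integrable[OF _ q_minus_1_le_2]) auto
  qed (use drift_integrable in auto)
  then have "real n * (\<integral>x. (norm (q \<theta> n x - 1))\<^sup>2 \<partial>\<pi>) \<le> real n * (4 * (\<integral>x. min ((drift \<theta> n x)\<^sup>2) \<bar>drift \<theta> n x\<bar> \<partial>\<pi>))" for n
    by (intro mult_left_mono) auto
  then show "real n * (\<integral>x. (norm (q \<theta> n x - 1))\<^sup>2 \<partial>\<pi>) \<le>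
      4 * (real n * (\<integral>x. min ((drift \<theta> n x)\<^sup>2) \<bar>drift \<theta> n x\<bar> \<partial>\<pi>))" for n
    by (simp only: mult.left_commute)
  show "0 \<le> real n * (\<integral>x. (norm (q \<theta> n x - 1))\<^sup>2 \<partial>\<pi>)" for n
    by (intro mult_nonneg_nonneg integral_nonneg_AE) auto
  show "(\<lambda>n. 4 * (real n * (\<integral>x. min ((drift \<theta> n x)\<^sup>2) \<bar>drift \<theta> n x\<bar> \<partial>\<pi>))) \<longlonglongrightarrow> 0"
    using tendsto_mult[OF tendsto_const[of 4] drift_small] by simp
qed

text \<open>The linear term of the test function integrates under \<open>P x\<close> to the drift
  and cancels the linear term of \<open>q\<close>. Left over are the second-order remainder of
  \<open>q\<close> and the product \<open>(q - 1) * (Op G - 1)\<close>, both negligible against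
  \<open>1 / n\<close>.\<close>

lemma mean_factor_expansion:
  "norm ((\<integral>x. q \<theta> n x * Op (G \<theta> n) x \<partial>\<pi>) - 1 -
      (\<integral>x. iexp (\<theta> * (\<Psi> x / B n)) - 1 - \<i> * complex_of_real (\<theta> * (\<Psi> x / B n)) \<partial>\<pi>)) \<le>
    2 * (\<integral>x. min ((drift \<theta> n x)\<^sup>2) \<bar>drift \<theta> n x\<bar> \<partial>\<pi>) +
    sqrt (\<integral>x. (norm (q \<theta> n x - 1))\<^sup>2 \<partial>\<pi>) * sqrt (\<integral>x. (Op (\<lambda>y. norm (G \<theta> n y - 1)) x)\<^sup>2 \<partial>\<pi>)"
proof -
  define h where "h x = G \<theta> n x - 1 - \<i> * complex_of_real (\<theta> * (\<Psi> x / B n))" for x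
  define d where "d x = q \<theta> n x - 1 - \<i> * complex_of_real (- drift \<theta> n x)" for x
  have iG: "integrable \<pi> (G \<theta> n)" by (rule bounded_integrable[of _ 1]) (auto simp: G_norm)
  have iPsi: "integrable \<pi> (\<lambda>x. complex_of_real (\<theta> * (\<Psi> x / B n)))"
    using Psi_integrable by (intro integrable_of_real) auto
  have ih: "integrable \<pi> h"
    unfolding h_def using iG iPsi by (intro Bochner_Integration.integrable_diff integrable_mult_right) auto
  have Ob: "norm (Op (G \<theta> n) x) \<le> 1" if "x \<in> space S" for x
    by (rule Op_bounded[OF that]) (auto simp: G_norm)
  have Gb2: "norm (Op (G \<theta> n) x - 1) \<le> Op (\<lambda>y. norm (G \<theta> n y - 1)) x"
    "norm (Op (G \<theta> n) x - 1) \<le> 2" if x: "x \<in> space S" for x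
  proof -
    interpret px: prob_space "P x" by (rule P_prob[OF x])
    have "integrable (P x) (G \<theta> n)" by (rule bounded_integrable_P[OF x, of _ 1]) (auto simp: G_norm)
    then have "Op (G \<theta> n) x - 1 = (\<integral>y. G \<theta> n y - 1 \<partial>P x)" by (simp add: px.prob_space)
    then show "norm (Op (G \<theta> n) x - 1) \<le> Op (\<lambda>y. norm (G \<theta> n y - 1)) x" by (simp add: integral_norm_bound)
    show "norm (Op (G \<theta> n) x - 1) \<le> 2" using norm_triangle_ineq4[of "Op (G \<theta> n) x" 1] Ob[OF x] by simp
  qed
  have qn: "norm (q \<theta> n x) = 1" for x by (simp add: q_def)
  have iqG: "integrable \<pi> (\<lambda>x. q \<theta> n x * Op (G \<theta> n) x)"
    by (rule bounded_integrable[of _ 1]) (auto simp: norm_mult qn Ob)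
  have iprod: "integrable \<pi> (\<lambda>x. (q \<theta> n x - 1) * (Op (G \<theta> n) x - 1))"
  proof (rule bounded_integrable)
    show "norm ((q \<theta> n x - 1) * (Op (G \<theta> n) x - 1)) \<le> 2 * 2" if "x \<in> space S" for x
      unfolding norm_mult by (intro mult_mono q_minus_1_le_2 Gb2(2) that) auto
  qed auto
  have id: "integrable \<pi> d"
    unfolding d_def
  proof (intro Bochner_Integration.integrable_diff integrable_mult_right)
    show "integrable \<pi> (q \<theta> n)" by (rule bounded_integrable[of _ 1]) (auto simp: qn)
    show "integrable \<pi> (\<lambda>x. complex_of_real (- drift \<theta> n x))"
      using drift_integrable(2) by (intro integrable_of_real) auto
  qed auto
  \<comment> \<open>Only almost everywhere: where \<Psi> is not integrable under \<open>P x\<close>,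
    the inner integrals take the default value 0.\<close>
  have "AE x in \<pi>. q \<theta> n x * Op (G \<theta> n) x - 1 - Op h x = d x + (q \<theta> n x - 1) * (Op (G \<theta> n) x - 1)"
    using Op_integrable(1)[OF Psi_integrable] AE_space
  proof eventually_elim
    case (elim x)
    then have x: "x \<in> space S" by (simp add: space_pi)
    interpret px: prob_space "P x" by (rule P_prob[OF x])
    have "integrable (P x) (G \<theta> n)" by (rule bounded_integrable_P[OF x, of _ 1]) (auto simp: G_norm)
    moreover have "integrable (P x) (\<lambda>x. complex_of_real (\<theta> * (\<Psi> x / B n)))"
      using elim by (intro integrable_of_real) auto
    moreover have "(\<integral>y. complex_of_real (\<theta> * (\<Psi> y / B n)) \<partial>P x) = complex_of_real (drift \<theta> n x)"
      unfolding integral_complex_of_real by (simp add: drift_def)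
    ultimately have "Op h x = Op (G \<theta> n) x - 1 - \<i> * complex_of_real (drift \<theta> n x)"
      unfolding h_def by (simp add: px.prob_space del: of_real_mult of_real_divide)
    then show ?case by (simp add: d_def algebra_simps)
  qed
  then have "(\<integral>x. q \<theta> n x * Op (G \<theta> n) x - 1 - Op h x \<partial>\<pi>) = (\<integral>x. d x + (q \<theta> n x - 1) * (Op (G \<theta> n) x - 1) \<partial>\<pi>)"
    using iqG Op_integrable(2)[OF ih] id iprod
    by (intro integral_cong_AE borel_measurable_integrable) auto
  moreover have "(\<integral>x. q \<theta> n x * Op (G \<theta> n) x - 1 - Op h x \<partial>\<pi>) = (\<integral>x. q \<theta> n x * Op (G \<theta> n) x \<partial>\<pi>) - 1 - (\<integral>x. h x \<partial>\<pi>)"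
    using iqG Op_integrable(2,3)[OF ih] by (simp add: prob_space)
  moreover have "(\<integral>x. d x + (q \<theta> n x - 1) * (Op (G \<theta> n) x - 1) \<partial>\<pi>) =
      (\<integral>x. d x \<partial>\<pi>) + (\<integral>x. (q \<theta> n x - 1) * (Op (G \<theta> n) x - 1) \<partial>\<pi>)"
    by (rule Bochner_Integration.integral_add[OF id iprod])
  ultimately have "(\<integral>x. q \<theta> n x * Op (G \<theta> n) x \<partial>\<pi>) - 1 - (\<integral>x. h x \<partial>\<pi>) =
      (\<integral>x. d x \<partial>\<pi>) + (\<integral>x. (q \<theta> n x - 1) * (Op (G \<theta> n) x - 1) \<partial>\<pi>)" by simp
  also have "norm \<dots> \<le> 2 * (\<integral>x. min ((drift \<theta> n x)\<^sup>2) \<bar>drift \<theta> n x\<bar> \<partial>\<pi>) +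
    sqrt (\<integral>x. (norm (q \<theta> n x - 1))\<^sup>2 \<partial>\<pi>) * sqrt (\<integral>x. (Op (\<lambda>y. norm (G \<theta> n y - 1)) x)\<^sup>2 \<partial>\<pi>)"
  proof (intro order_trans[OF norm_triangle_ineq] add_mono)
    have "norm (\<integral>x. d x \<partial>\<pi>) \<le> (\<integral>x. 2 * min ((drift \<theta> n x)\<^sup>2) \<bar>drift \<theta> n x\<bar> \<partial>\<pi>)"
    proof (rule order_trans[OF integral_norm_bound integral_mono])
      show "norm (d x) \<le> 2 * min ((drift \<theta> n x)\<^sup>2) \<bar>drift \<theta> n x\<bar>" for x
        unfolding d_def q_def using iexp_taylor_min[of "- drift \<theta> n x"] by simp
    qed (use id drift_integrable in auto)
    then show "norm (\<integral>x. d x \<partial>\<pi>) \<le> 2 * (\<integral>x. min ((drift \<theta> n x)\<^sup>2) \<bar>drift \<theta> n x\<bar> \<partial>\<pi>)" by simp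
    have "norm (\<integral>x. (q \<theta> n x - 1) * (Op (G \<theta> n) x - 1) \<partial>\<pi>) \<le>
      sqrt (\<integral>x. (norm (q \<theta> n x - 1))\<^sup>2 \<partial>\<pi>) * sqrt (\<integral>x. (norm (Op (G \<theta> n) x - 1))\<^sup>2 \<partial>\<pi>)"
      by (rule norm_integral_mult_le[OF _ q_minus_1_le_2 _ Gb2(2)]) auto
    also have "\<dots> \<le> sqrt (\<integral>x. (norm (q \<theta> n x - 1))\<^sup>2 \<partial>\<pi>) * sqrt (\<integral>x. (Op (\<lambda>y. norm (G \<theta> n y - 1)) x)\<^sup>2 \<partial>\<pi>)"
    proof (intro mult_left_mono real_sqrt_le_mono integral_mono)
      show "integrable \<pi> (\<lambda>x. (norm (Op (G \<theta> n) x - 1))\<^sup>2)"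
        by (rule norm_square_integrable[OF _ Gb2(2)]) auto
      show "integrable \<pi> (\<lambda>x. (Op (\<lambda>y. norm (G \<theta> n y - 1)) x)\<^sup>2)"
      proof (rule square_integrable)
        show "\<bar>Op (\<lambda>y. norm (G \<theta> n y - 1)) x\<bar> \<le> 2" if "x \<in> space S" for x
          using Op_bounded[OF that, of "\<lambda>y. norm (G \<theta> n y - 1)" 2] by (auto simp: G_minus_1_le_2)
      qed auto
      show "(norm (Op (G \<theta> n) x - 1))\<^sup>2 \<le> (Op (\<lambda>y. norm (G \<theta> n y - 1)) x)\<^sup>2" if "x \<in> space \<pi>" for x
        using Gb2(1)[of x] that by (intro power_mono) (auto simp: space_pi)
    qed (auto intro!: integral_nonneg_AE)
    finally show "norm (\<integral>x. (q \<theta> n x - 1) * (Op (G \<theta> n) x - 1) \<partial>\<pi>) \<le>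
      sqrt (\<integral>x. (norm (q \<theta> n x - 1))\<^sup>2 \<partial>\<pi>) * sqrt (\<integral>x. (Op (\<lambda>y. norm (G \<theta> n y - 1)) x)\<^sup>2 \<partial>\<pi>)" .
  qed
  finally show ?thesis by (simp add: h_def G_def)
qed

lemma mean_factor_limit:
  "(\<lambda>n. of_nat n * ((\<integral>x. q \<theta> n x * Op (G \<theta> n) x \<partial>\<pi>) - 1)) \<longlonglongrightarrow> stable_exponent \<alpha> cp cm \<theta>"
proof -
  have t: "tail_test (\<lambda>x. iexp (\<theta> * x) - 1 - \<i> * complex_of_real (\<theta> * x))"
    "tail_test (\<lambda>x. iexp (\<theta> * (-x)) - 1 - \<i> * complex_of_real (\<theta> * (-x)))"
    using tail_test_iexp_gt_1[OF \<alpha>1, of \<theta>] tail_test_iexp_gt_1[OF \<alpha>1, of "-\<theta>"] by simp_all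
  let ?h = "\<lambda>n. \<integral>x. iexp (\<theta> * (\<Psi> x / B n)) - 1 - \<i> * complex_of_real (\<theta> * (\<Psi> x / B n)) \<partial>\<pi>"
  let ?lam = "\<lambda>n. \<integral>x. q \<theta> n x * Op (G \<theta> n) x \<partial>\<pi>"
  let ?k = "\<lambda>n. \<integral>x. min ((drift \<theta> n x)\<^sup>2) \<bar>drift \<theta> n x\<bar> \<partial>\<pi>"
  let ?Q = "\<lambda>n. \<integral>x. (norm (q \<theta> n x - 1))\<^sup>2 \<partial>\<pi>"
  let ?U = "\<lambda>n. \<integral>x. (Op (\<lambda>y. norm (G \<theta> n y - 1)) x)\<^sup>2 \<partial>\<pi>"
  have h: "(\<lambda>n. of_nat n * ?h n) \<longlonglongrightarrow> stable_exponent \<alpha> cp cm \<theta>"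
    using tail_test_seq_limit[OF t] \<alpha>1 by (simp add: stable_exponent_def)
  have bd: "norm (of_nat n * (?lam n - 1) - of_nat n * ?h n) \<le> 2 * (real n * ?k n) + sqrt (real n * ?Q n) * sqrt (real n * ?U n)" for n
  proof -
    have "norm (of_nat n * (?lam n - 1) - of_nat n * ?h n) = real n * norm (?lam n - 1 - ?h n)"
      by (simp only: right_diff_distrib[symmetric] norm_mult norm_of_nat)
    also have "\<dots> \<le> real n * (2 * ?k n + sqrt (?Q n) * sqrt (?U n))"
      by (intro mult_left_mono mean_factor_expansion) simp
    also have "\<dots> = 2 * (real n * ?k n) + (sqrt (real n) * sqrt (real n)) * (sqrt (?Q n) * sqrt (?U n))"
      by (simp add: distrib_left)
    also have "\<dots> = 2 * (real n * ?k n) + sqrt (real n * ?Q n) * sqrt (real n * ?U n)"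
      by (simp only: real_sqrt_mult mult_ac)
    finally show ?thesis .
  qed
  have "(\<lambda>n. 2 * (real n * ?k n) + sqrt (real n * ?Q n) * sqrt (real n * ?U n)) \<longlonglongrightarrow> 2 * 0 + sqrt 0 * sqrt 0"
    by (intro tendsto_intros drift_small q_minus_1_square_small Op_G_minus_1_square_small)
  then have l0: "(\<lambda>n. 2 * (real n * ?k n) + sqrt (real n * ?Q n) * sqrt (real n * ?U n)) \<longlonglongrightarrow> 0" by simp
  have "(\<lambda>n. of_nat n * (?lam n - 1) - of_nat n * ?h n) \<longlonglongrightarrow> 0"
    by (rule Lim_null_comparison[OF always_eventually l0]) (use bd in blast)
  from tendsto_add[OF this h] show ?thesis by simp
qed

lemma limit_gt_1:
  assumes \<mu>: "is_stable_law \<alpha> cp cm \<mu>"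
  shows "weak_conv_m (\<lambda>n. distr M borel (\<lambda>\<omega>. (\<Sum>j=1..n. \<Psi> (X j \<omega>) -
      real_cond_exp M (natural_filtration M S X (j - 1)) (\<lambda>\<omega>. \<Psi> (X j \<omega>)) \<omega>) / B n)) \<mu>"
proof -
  let ?D = "\<lambda>n. distr M borel (\<lambda>\<omega>. (\<Sum>j=1..n. \<Psi> (X j \<omega>) + (- Op \<Psi> (X (j - 1) \<omega>))) / B n)"
  \<comment> \<open>The index starts at 1, so \<open>j - 1\<close> is the true predecessor; finitely
    many almost sure identities replace the conditional expectations by
    \<open>Op \<Psi>\<close>.\<close>
  have D: "distr M borel (\<lambda>\<omega>. (\<Sum>j=1..n. \<Psi> (X j \<omega>) -
      real_cond_exp M (natural_filtration M S X (j - 1)) (\<lambda>\<omega>. \<Psi> (X j \<omega>)) \<omega>) / B n) = ?D n" for n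
  proof (rule distr_cong_AE)
    have "AE \<omega> in M. \<forall>j. real_cond_exp M (F j) (\<lambda>\<omega>. \<Psi> (X (Suc j) \<omega>)) \<omega> = Op \<Psi> (X j \<omega>)"
      unfolding AE_all_countable using cond_exp_X[OF Psi_integrable] by blast
    then show "AE \<omega> in M. (\<Sum>j=1..n. \<Psi> (X j \<omega>) - real_cond_exp M (F (j - 1)) (\<lambda>\<omega>. \<Psi> (X j \<omega>)) \<omega>) / B n =
        (\<Sum>j=1..n. \<Psi> (X j \<omega>) + (- Op \<Psi> (X (j - 1) \<omega>))) / B n"
    proof eventually_elim
      case (elim \<omega>)
      have "\<Psi> (X j \<omega>) - real_cond_exp M (F (j - 1)) (\<lambda>\<omega>. \<Psi> (X j \<omega>)) \<omega> = \<Psi> (X j \<omega>) + (- Op \<Psi> (X (j - 1) \<omega>))"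
        if "j \<in> {1..n}" for j
        using elim[rule_format, of "j - 1"] that by simp
      then have "(\<Sum>j=1..n. \<Psi> (X j \<omega>) - real_cond_exp M (F (j - 1)) (\<lambda>\<omega>. \<Psi> (X j \<omega>)) \<omega>) =
          (\<Sum>j=1..n. \<Psi> (X j \<omega>) + (- Op \<Psi> (X (j - 1) \<omega>)))"
        by (intro sum.cong refl) blast
      then show ?case by (simp only:)
    qed
    show "(\<lambda>\<omega>. (\<Sum>j=1..n. \<Psi> (X j \<omega>) - real_cond_exp M (F (j - 1)) (\<lambda>\<omega>. \<Psi> (X j \<omega>)) \<omega>) / B n) \<in> borel_measurable M"
      by measurable
  qed auto
  have "real_distribution \<mu>" using \<mu> by (simp add: is_stable_law_def)
  then show ?thesis
    unfolding D
  proof (rule levy_continuity[rotated])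
    interpret M: prob_space M by (rule prob_M)
    show "real_distribution (?D n)" for n
      by (rule M.real_distribution_distr) auto
    fix \<theta>
    have "norm (\<integral>x. q \<theta> n x * Op (G \<theta> n) x \<partial>\<pi>) \<le> 1" for n
    proof (rule integral_norm_le_1)
      show "norm (q \<theta> n x * Op (G \<theta> n) x) \<le> 1" if "x \<in> space S" for x
        using Op_bounded[OF that, of "G \<theta> n" 1] by (simp add: norm_mult q_def G_norm)
    qed auto
    then have lam: "(\<lambda>n. (\<integral>x. q \<theta> n x * Op (G \<theta> n) x \<partial>\<pi>) ^ n) \<longlonglongrightarrow> exp (stable_exponent \<alpha> cp cm \<theta>)"
      by (intro power_tendsto_exp mean_factor_limit)
    have "(\<lambda>n. \<integral>x. twisted_iter P (q \<theta> n) (G \<theta> n) n x \<partial>\<pi>) \<longlonglongrightarrow> exp (stable_exponent \<alpha> cp cm \<theta>)"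
      by (rule twisted_limit[OF _ _ q_minus_1_square_small lam]) (auto simp: q_def)
    moreover have "char (?D n) \<theta> = (\<integral>x. twisted_iter P (q \<theta> n) (G \<theta> n) n x \<partial>\<pi>)" for n
    proof -
      have "(\<lambda>x. iexp (\<theta> * (- Op \<Psi> x / B n))) = q \<theta> n"
        by (rule ext) (simp add: q_def drift_def)
      then show ?thesis using char_sum[of "\<lambda>x. - Op \<Psi> x" n \<theta>] by simp
    qed
    ultimately show "(\<lambda>n. char (?D n) \<theta>) \<longlonglongrightarrow> char \<mu> \<theta>"
      using \<mu> by (simp add: is_stable_law_def)
  qed
qed

end

end

section \<open>The case of index one\<close>

text \<open>Moving arguments are needed because two normings will be compared. On a Skorohod space
  the two exponentials differ by at most \<open>b\<close> times the distance of the variables,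
  whatever the arguments do within the bound.\<close>

lemma weak_conv_char_bounded_args:
  fixes s :: "nat \<Rightarrow> real"
  assumes \<nu>: "\<And>n. real_distribution (\<nu> n)" and \<mu>: "real_distribution \<mu>"
    and conv: "weak_conv_m \<nu> \<mu>" and s: "\<And>n. \<bar>s n\<bar> \<le> b"
  shows "(\<lambda>n. char (\<nu> n) (s n) - char \<mu> (s n)) \<longlonglongrightarrow> 0"
proof -
  from Skorohod[OF \<nu> \<mu> conv] obtain \<Omega> :: "real measure" and Y :: "nat \<Rightarrow> real \<Rightarrow> real" and Z :: "real \<Rightarrow> real" where
    \<Omega>: "prob_space \<Omega>" and Y: "\<And>n. Y n \<in> \<Omega> \<rightarrow>\<^sub>M borel" "\<And>n. distr \<Omega> borel (Y n) = \<nu> n"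
    and Z: "Z \<in> \<Omega> \<rightarrow>\<^sub>M lborel" "distr \<Omega> borel Z = \<mu>"
    and lim: "\<And>x. x \<in> space \<Omega> \<Longrightarrow> (\<lambda>n. Y n x) \<longlonglongrightarrow> Z x"
    by blast
  interpret \<Omega>: prob_space \<Omega> by (rule \<Omega>)
  note Y(1) [measurable]
  have Zm [measurable]: "Z \<in> \<Omega> \<rightarrow>\<^sub>M borel" using Z(1) by simp
  have c: "char (\<nu> n) (s n) = (\<integral>x. iexp (s n * Y n x) \<partial>\<Omega>)" "char \<mu> (s n) = (\<integral>x. iexp (s n * Z x) \<partial>\<Omega>)" for n
    unfolding char_def Y(2)[symmetric] Z(2)[symmetric] by (subst integral_distr; simp)+
  have i: "integrable \<Omega> (\<lambda>x. iexp (s n * Y n x))" "integrable \<Omega> (\<lambda>x. iexp (s n * Z x))" for n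
    by (rule \<Omega>.integrable_const_bound[of _ 1]; simp)+
  have "(\<lambda>n. \<integral>x. iexp (s n * Y n x) - iexp (s n * Z x) \<partial>\<Omega>) \<longlonglongrightarrow> (\<integral>x. 0 \<partial>\<Omega>)"
  proof (rule integral_dominated_convergence[where w = "\<lambda>_. 2"])
    show "AE x in \<Omega>. norm (iexp (s n * Y n x) - iexp (s n * Z x)) \<le> 2" for n
      by (intro AE_I2 order_trans[OF norm_triangle_ineq4]) simp
    show "AE x in \<Omega>. (\<lambda>n. iexp (s n * Y n x) - iexp (s n * Z x)) \<longlonglongrightarrow> 0"
    proof (rule AE_I2)
      fix x assume x: "x \<in> space \<Omega>"
      have "(\<lambda>n. b * \<bar>Y n x - Z x\<bar>) \<longlonglongrightarrow> b * \<bar>Z x - Z x\<bar>"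
        by (intro tendsto_intros lim x)
      then have l0: "(\<lambda>n. b * \<bar>Y n x - Z x\<bar>) \<longlonglongrightarrow> 0" by simp
      have "norm (iexp (s n * Y n x) - iexp (s n * Z x)) \<le> b * \<bar>Y n x - Z x\<bar>" for n
      proof -
        have "iexp (s n * Y n x) - iexp (s n * Z x) = iexp (s n * Z x) * (iexp (s n * (Y n x - Z x)) - 1)"
          by (simp add: right_diff_distrib exp_add[symmetric])
        also have "norm \<dots> \<le> \<bar>s n * (Y n x - Z x)\<bar>"
          unfolding norm_mult using iexp_lipschitz(1)[of "s n * (Y n x - Z x)"] by simp
        also have "\<dots> \<le> b * \<bar>Y n x - Z x\<bar>" unfolding abs_mult by (intro mult_right_mono s) simp
        finally show ?thesis .
      qed
      then show "(\<lambda>n. iexp (s n * Y n x) - iexp (s n * Z x)) \<longlonglongrightarrow> 0"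
        by (intro Lim_null_comparison[OF always_eventually l0]) blast
    qed
  qed auto
  then show ?thesis using i by (simp add: c)
qed

lemma char_iid_sum:
  assumes \<rho>: "real_distribution \<rho>"
  shows "real_distribution (distr (\<Pi>\<^sub>M j\<in>{1..n}. \<rho>) borel (\<lambda>y. (\<Sum>j=1..n. y j) / a))"
    and "char (distr (\<Pi>\<^sub>M j\<in>{1..n}. \<rho>) borel (\<lambda>y. (\<Sum>j=1..n. y j) / a)) s = char \<rho> (s / a) ^ n"
proof -
  interpret r: real_distribution \<rho> by (rule \<rho>)
  interpret p: product_prob_space "\<lambda>_. \<rho>" "{1..n}" ..
  interpret fp: finite_product_prob_space "\<lambda>_. \<rho>" "{1..n}" by unfold_locales auto
  have m: "(\<lambda>y. y j) \<in> borel_measurable (\<Pi>\<^sub>M j\<in>{1..n}. \<rho>)" if "j \<in> {1..n}" for j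
  proof -
    have "(\<lambda>y. y j) \<in> (\<Pi>\<^sub>M j\<in>{1..n}. \<rho>) \<rightarrow>\<^sub>M \<rho>" using that by (rule measurable_component_singleton)
    then show ?thesis by (simp cong: measurable_cong_sets)
  qed
  have sm: "(\<lambda>y. (\<Sum>j=1..n. y j) / a) \<in> borel_measurable (\<Pi>\<^sub>M j\<in>{1..n}. \<rho>)"
    by (intro borel_measurable_divide borel_measurable_sum m) auto
  show "real_distribution (distr (\<Pi>\<^sub>M j\<in>{1..n}. \<rho>) borel (\<lambda>y. (\<Sum>j=1..n. y j) / a))"
    by (rule p.real_distribution_distr[OF sm])
  have "char (distr (\<Pi>\<^sub>M j\<in>{1..n}. \<rho>) borel (\<lambda>y. (\<Sum>j=1..n. y j) / a)) s =
      (\<integral>y. iexp (s * ((\<Sum>j=1..n. y j) / a)) \<partial>(\<Pi>\<^sub>M j\<in>{1..n}. \<rho>))"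
    unfolding char_def by (rule integral_distr[OF sm]) simp
  also have "\<dots> = (\<integral>y. (\<Prod>j=1..n. iexp (s / a * y j)) \<partial>(\<Pi>\<^sub>M j\<in>{1..n}. \<rho>))"
  proof (rule Bochner_Integration.integral_cong[OF refl])
    fix y
    have "\<i> * complex_of_real (s * ((\<Sum>j=1..n. y j) / a)) = (\<Sum>j=1..n. \<i> * complex_of_real (s / a * y j))"
      by (simp add: sum_distrib_left sum_divide_distrib)
    then show "iexp (s * ((\<Sum>j=1..n. y j) / a)) = (\<Prod>j=1..n. iexp (s / a * y j))"
      by (simp only: exp_sum[OF finite_atLeastAtMost])
  qed
  also have "\<dots> = (\<Prod>j=1..n. (\<integral>x. iexp (s / a * x) \<partial>\<rho>))"
  proof (rule p.product_integral_prod)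
    show "integrable \<rho> (\<lambda>x. iexp (s / a * x))"
      by (rule r.integrable_const_bound[of _ 1]) (simp_all cong: measurable_cong_sets)
  qed simp
  finally show "char (distr (\<Pi>\<^sub>M j\<in>{1..n}. \<rho>) borel (\<lambda>y. (\<Sum>j=1..n. y j) / a)) s = char \<rho> (s / a) ^ n"
    by (simp add: char_def)
qed

text \<open>A converse of \<open>power_tendsto_exp\<close> for real bases, by squeezing between
  \<open>1 - x \<le> - ln x\<close> and \<open>x * (- ln x) \<le> 1 - x\<close>.\<close>

lemma one_minus_limit_of_power_limit:
  fixes x :: "nat \<Rightarrow> real"
  assumes x: "\<And>n. 0 \<le> x n" "\<And>n. x n \<le> 1" and x1: "x \<longlonglongrightarrow> 1" and lim: "(\<lambda>n. x n ^ n) \<longlonglongrightarrow> exp (- c)"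
  shows "(\<lambda>n. real n * (1 - x n)) \<longlonglongrightarrow> c"
proof -
  have pos: "\<forall>\<^sub>F n in sequentially. x n > 0" by (rule order_tendstoD(1)[OF x1]) simp
  have "(\<lambda>n. - ln (x n ^ n)) \<longlonglongrightarrow> - ln (exp (- c))" by (intro tendsto_intros lim) simp
  then have L: "(\<lambda>n. - ln (x n ^ n)) \<longlonglongrightarrow> c" by simp
  have L': "(\<lambda>n. x n * - ln (x n ^ n)) \<longlonglongrightarrow> c" using tendsto_mult[OF x1 L] by simp
  show ?thesis
  proof (rule tendsto_sandwich[OF _ _ L' L])
    show "\<forall>\<^sub>F n in sequentially. real n * (1 - x n) \<le> - ln (x n ^ n)"
      using pos
    proof eventually_elim
      case (elim n)
      have "1 - x n \<le> - ln (x n)" using ln_le_minus_one[OF elim] by simp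
      then have "real n * (1 - x n) \<le> real n * - ln (x n)" by (rule mult_left_mono) simp
      then show ?case using elim by (simp add: ln_realpow)
    qed
    show "\<forall>\<^sub>F n in sequentially. x n * - ln (x n ^ n) \<le> real n * (1 - x n)"
      using pos
    proof eventually_elim
      case (elim n)
      have "ln (inverse (x n)) \<le> inverse (x n) - 1" using elim by (intro ln_le_minus_one) simp
      then have "- ln (x n) \<le> inverse (x n) - 1" using elim by (simp add: ln_inverse)
      then have "x n * - ln (x n) \<le> x n * (inverse (x n) - 1)" using elim by (intro mult_left_mono) auto
      also have "\<dots> = 1 - x n" using elim by (simp add: right_diff_distrib)
      finally have "real n * (x n * - ln (x n)) \<le> real n * (1 - x n)" by (rule mult_left_mono) simp
      then show ?case using elim by (simp add: ln_realpow mult_ac)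
    qed
  qed
qed

section \<open>Comparison of normings for \<alpha> = 1\<close>

context heavy_tail
begin

definition \<phi> :: "real \<Rightarrow> complex" where "\<phi> s = char (distr N borel \<Psi>) s"

lemma phi_eq: "\<phi> s = (\<integral>x. iexp (s * \<Psi> x) \<partial>N)"
  unfolding \<phi>_def char_def by (rule integral_distr) auto

lemma phi_norm_le: "norm (\<phi> s) \<le> 1"
proof -
  interpret r: real_distribution "distr N borel \<Psi>" by (rule real_distribution_distr) simp
  show ?thesis unfolding \<phi>_def by (rule r.cmod_char_le_1)
qed

lemma one_minus_Re_phi: "1 - Re (\<phi> (1 / t)) = (\<integral>x. 1 - cos (\<Psi> x / t) \<partial>N)"
  and Im_phi: "Im (\<phi> (1 / t)) = (\<integral>x. sin (\<Psi> x / t) \<partial>N)"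
proof -
  have i: "integrable N (\<lambda>x. iexp (1 / t * \<Psi> x))" by (rule integrable_const_bound[of _ 1]) auto
  have ReIm: "Re (iexp (1 / t * \<Psi> x)) = cos (\<Psi> x / t)" "Im (iexp (1 / t * \<Psi> x)) = sin (\<Psi> x / t)" for x
    by (simp_all add: Re_exp Im_exp Re_divide_of_real Im_divide_of_real)
  have ci: "integrable N (\<lambda>x. cos (\<Psi> x / t))" by (rule integrable_const_bound[of _ 1]) auto
  have "Re (\<phi> (1 / t)) = (\<integral>x. Re (iexp (1 / t * \<Psi> x)) \<partial>N)" unfolding phi_eq by (rule integral_Re[OF i, symmetric])
  then show "1 - Re (\<phi> (1 / t)) = (\<integral>x. 1 - cos (\<Psi> x / t) \<partial>N)"
    unfolding ReIm using ci by (simp add: prob_space)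
  have "Im (\<phi> (1 / t)) = (\<integral>x. Im (iexp (1 / t * \<Psi> x)) \<partial>N)" unfolding phi_eq by (rule integral_Im[OF i, symmetric])
  then show "Im (\<phi> (1 / t)) = (\<integral>x. sin (\<Psi> x / t) \<partial>N)"
    unfolding ReIm .
qed

text \<open>Enlarging a norming by a factor \<open>r > 1\<close> multiplies the limit of
  \<open>n * H\<close> by \<open>r powr -\<alpha> < 1\<close>. By monotonicity neither sequence can
  therefore exceed \<open>r\<close> times the other infinitely often.\<close>

lemma same_tail_imp_asymptotic:
  assumes a: "filterlim a at_top sequentially" "(\<lambda>n. real n * H (a n)) \<longlonglongrightarrow> cp + cm"
    and B: "filterlim B at_top sequentially" "(\<lambda>n. real n * H (B n)) \<longlonglongrightarrow> cp + cm"
  shows "(\<lambda>n. a n / B n) \<longlonglongrightarrow> 1"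
proof -
  have up: "\<forall>\<^sub>F n in sequentially. u n \<le> r * v n"
    if u: "(\<lambda>n. real n * H (u n)) \<longlonglongrightarrow> cp + cm" and v: "filterlim v at_top sequentially" "(\<lambda>n. real n * H (v n)) \<longlonglongrightarrow> cp + cm"
      and r: "r > 1" for u v :: "nat \<Rightarrow> real" and r :: real
  proof -
    have "(\<lambda>n. (real n * H (v n)) * (H (r * v n) / H (v n))) \<longlonglongrightarrow> (cp + cm) * r powr -\<alpha>"
      using r by (intro tendsto_mult v filterlim_compose[OF H_ratio v(1)]) auto
    moreover have "(real n * H (v n)) * (H (r * v n) / H (v n)) = real n * H (r * v n)" for n
      using H_pos[of "v n"] by simp
    ultimately have l: "(\<lambda>n. real n * H (r * v n)) \<longlonglongrightarrow> (cp + cm) * r powr -\<alpha>" by simp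
    have "r powr -\<alpha> < 1" using r alpha by (simp add: powr_less_one)
    then have "(cp + cm) * r powr -\<alpha> < cp + cm" using c_pos by simp
    then obtain m where m: "(cp + cm) * r powr -\<alpha> < m" "m < cp + cm" using dense by blast
    from order_tendstoD(2)[OF l m(1)] order_tendstoD(1)[OF u m(2)]
    show ?thesis
    proof eventually_elim
      case (elim n)
      show ?case
      proof (rule ccontr)
        assume "\<not> u n \<le> r * v n"
        then have "H (u n) \<le> H (r * v n)" by (intro H_anti) simp
        then have "real n * H (u n) \<le> real n * H (r * v n)" by (rule mult_left_mono) simp
        then show False using elim by simp
      qed
    qed
  qed
  have Bp: "\<forall>\<^sub>F n in sequentially. B n > 0" using B(1) by (auto simp: filterlim_at_top_dense)
  show ?thesis
  proof (rule order_tendstoI)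
    fix y :: real assume y: "1 < y"
    then obtain r where r: "1 < r" "r < y" using dense by blast
    from up[OF a(2) B r(1)] Bp show "\<forall>\<^sub>F n in sequentially. a n / B n < y"
    proof eventually_elim
      case (elim n)
      then have "a n / B n \<le> r" by (simp add: pos_divide_le_eq)
      then show ?case using r by simp
    qed
  next
    fix y :: real assume y: "y < 1"
    define z where "z = max y (1 / 2)"
    have z: "0 < z" "z < 1" "y \<le> z" using y by (auto simp: z_def)
    then have "1 < 1 / z" by simp
    then obtain r where r: "1 < r" "r < 1 / z" using dense by blast
    have rz: "z < 1 / r" using r z by (simp add: field_simps)
    from up[OF B(2) a r(1)] Bp show "\<forall>\<^sub>F n in sequentially. y < a n / B n"
    proof eventually_elim
      case (elim n)
      then have "1 / r \<le> a n / B n" using r by (simp add: field_simps)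
      then show ?case using rz z by simp
    qed
  qed
qed

text \<open>The norming \<open>a\<close> supplied by the domain of attraction is unknown. Its tail behaviour
  \<open>n H (a n) \<longlonglongrightarrow> cp + cm\<close> is read off from \<open>\<bar>\<phi> (1 / a n)\<bar>\<^sup>2\<^sup>n\<close>, in which the possibly divergent
  truncated means are invisible; this forces \<open>a n \<sim> B n\<close>.\<close>

lemma attraction_norming:
  assumes \<alpha>1: "\<alpha> = 1" and \<mu>: "is_stable_law \<alpha> cp cm \<mu>"
    and attr: "in_strict_domain_of_attraction (distr N borel \<Psi>) \<mu>"
    and B: "filterlim B at_top sequentially" "(\<lambda>n. real n * H (B n)) \<longlonglongrightarrow> cp + cm"
  shows "(\<lambda>n. \<phi> (\<theta> / B n) ^ n) \<longlonglongrightarrow> char \<mu> \<theta>"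
proof -
  let ?\<rho> = "distr N borel \<Psi>"
  have \<rho>: "real_distribution ?\<rho>" by (rule real_distribution_distr) simp
  interpret \<mu>: real_distribution \<mu> using \<mu> by (simp add: is_stable_law_def)
  have char_\<mu>: "char \<mu> s = exp (stable_exponent \<alpha> cp cm s)" for s using \<mu> by (simp add: is_stable_law_def)
  obtain a :: "nat \<Rightarrow> real" where a: "\<And>n. a n > 0"
    and conv: "weak_conv_m (\<lambda>n. distr (\<Pi>\<^sub>M j\<in>{1..n}. ?\<rho>) borel (\<lambda>y. (\<Sum>j=1..n. y j) / a n)) \<mu>"
    using attr unfolding in_strict_domain_of_attraction_def by blast
  \<comment> \<open>Arguments that vary with \<open>n\<close> are essential: they let \<phi> be
    evaluated at \<open>1 / t\<close> when excluding bounded \<open>a n\<close>, and at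
    \<open>\<theta> / B n\<close> at the end.\<close>
  have unif: "(\<lambda>n. \<phi> (s n / a n) ^ n - char \<mu> (s n)) \<longlonglongrightarrow> 0" if "\<And>n. \<bar>s n\<bar> \<le> b" for s b
    using weak_conv_char_bounded_args[where s = s and b = b, OF char_iid_sum(1)[OF \<rho>] \<mu>.real_distribution_axioms conv that]
    unfolding char_iid_sum(2)[OF \<rho>] \<phi>_def .

  define U where "U t = 1 - Re (\<phi> (1 / t))" for t
  define V where "V t = Im (\<phi> (1 / t))" for t
  define J where "J = (\<integral>x. cos (1 * x) - 1 \<partial>stable_levy_measure \<alpha> cp cm)"
  have exp1: "stable_exponent \<alpha> cp cm 1 = complex_of_real J" using \<alpha>1 by (simp add: stable_exponent_def J_def)
  have U_lim: "((\<lambda>t. U t / H t) \<longlongrightarrow> - J / (cp + cm)) at_top"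
  proof -
    have t: "tail_test (\<lambda>x. complex_of_real (cos (1 * x) - 1))" "tail_test (\<lambda>x. complex_of_real (cos (1 * (-x)) - 1))"
      using tail_test_cos[OF \<alpha>1, of 1] by simp_all
    have "((\<lambda>t. Re ((\<integral>x. complex_of_real (cos (1 * (\<Psi> x / t)) - 1) \<partial>N) /\<^sub>R H t)) \<longlongrightarrow>
        Re ((\<integral>x. complex_of_real (cos (1 * x) - 1) \<partial>stable_levy_measure \<alpha> cp cm) /\<^sub>R (cp + cm))) at_top"
      by (intro tendsto_Re tail_test_two_sided[OF t]) simp
    then have "((\<lambda>t. (\<integral>x. cos (\<Psi> x / t) - 1 \<partial>N) / H t) \<longlongrightarrow> J / (cp + cm)) at_top"
      unfolding integral_complex_of_real J_def by (simp add: divide_inverse mult.commute)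
    from tendsto_minus[OF this]
    have "((\<lambda>t. - (\<integral>x. cos (\<Psi> x / t) - 1 \<partial>N) / H t) \<longlongrightarrow> - J / (cp + cm)) at_top" by simp
    moreover have "- (\<integral>x. cos (\<Psi> x / t) - 1 \<partial>N) = U t" for t
      using Bochner_Integration.integral_minus[of N "\<lambda>x. cos (\<Psi> x / t) - 1"] by (simp only: U_def one_minus_Re_phi minus_diff_eq)
    ultimately show ?thesis by (simp only:)
  qed
  \<comment> \<open>The cosine is non-positive between \<open>pi / 2\<close> and \<open>pi\<close>,
    so \<open>U t\<close> is at least the mass of the modulus of \<Psi> between
    \<open>pi / 2 * t\<close> and \<open>pi * t\<close>, whose ratio to \<open>H t\<close> has a
    positive limit.\<close>
  have J: "J < 0"
  proof -
    have iU: "integrable N (\<lambda>x. 1 - cos (\<Psi> x / t))" for t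
    proof (rule integrable_const_bound[of _ 2])
      show "AE x in N. norm (1 - cos (\<Psi> x / t)) \<le> 2"
      proof (rule AE_I2)
        fix x
        show "norm (1 - cos (\<Psi> x / t)) \<le> 2"
          using cos_le_one[of "\<Psi> x / t"] cos_ge_minus_one[of "\<Psi> x / t"] by simp
      qed
    qed simp
    have "((\<lambda>t. H (pi / 2 * t) / H t - H (pi * t) / H t) \<longlongrightarrow> (pi / 2) powr -\<alpha> - pi powr -\<alpha>) at_top"
      by (intro tendsto_diff H_ratio) auto
    moreover have "\<forall>\<^sub>F t in at_top. H (pi / 2 * t) / H t - H (pi * t) / H t \<le> U t / H t"
      using eventually_gt_at_top[of 0]
    proof eventually_elim
      case (elim t)
      let ?A = "\<lambda>r. {x \<in> space N. \<bar>\<Psi> x\<bar> > r * t}"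
      have iA: "integrable N (indicator (?A r) :: _ \<Rightarrow> real)" for r
        by (intro integrable_real_indicator) (auto simp: less_top[symmetric])
      have "H (pi / 2 * t) - H (pi * t) = (\<integral>x. indicator (?A (pi / 2)) x - indicator (?A pi) x \<partial>N)"
      proof -
        have "(\<integral>x. indicator (?A r) x \<partial>N) = H (r * t)" for r by (simp add: H_def)
        then show ?thesis unfolding Bochner_Integration.integral_diff[OF iA iA] by (simp only:)
      qed
      also have "\<dots> \<le> (\<integral>x. 1 - cos (\<Psi> x / t) \<partial>N)"
      proof (rule integral_mono)
        fix x assume x: "x \<in> space N"
        show "indicator (?A (pi / 2)) x - indicator (?A pi) x \<le> 1 - cos (\<Psi> x / t)"
        proof (cases "pi / 2 * t < \<bar>\<Psi> x\<bar> \<and> \<bar>\<Psi> x\<bar> \<le> pi * t")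
          case True
          then have y: "pi / 2 \<le> \<bar>\<Psi> x / t\<bar>" "\<bar>\<Psi> x / t\<bar> \<le> pi"
            using elim by (auto simp: abs_divide pos_divide_le_eq pos_le_divide_eq)
          have "cos \<bar>\<Psi> x / t\<bar> \<le> cos (pi / 2)" using y by (intro cos_monotone_0_pi_le) auto
          then have "cos (\<Psi> x / t) \<le> 0" unfolding cos_abs_real by simp
          then show ?thesis using True x by (simp add: indicator_def)
        next
          case False
          have "(indicator (?A (pi / 2)) x :: real) - indicator (?A pi) x \<le> 0"
            using False x elim mult_right_mono[of "pi / 2" pi t] by (auto simp: indicator_def)
          then show ?thesis using cos_le_one[of "\<Psi> x / t"] by linarith
        qed
      next
        show "integrable N (\<lambda>x. indicator (?A (pi / 2)) x - indicator (?A pi) x :: real)"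
          by (rule Bochner_Integration.integrable_diff[OF iA iA])
      qed (rule iU)
      also have "\<dots> = U t" by (simp add: U_def one_minus_Re_phi)
      finally show ?case using H_pos[of t] by (simp add: diff_divide_distrib[symmetric] divide_right_mono)
    qed
    ultimately have "(pi / 2) powr -\<alpha> - pi powr -\<alpha> \<le> - J / (cp + cm)"
      by (rule tendsto_le[OF trivial_limit_at_top_linorder U_lim])
    moreover have "(pi / 2) powr -\<alpha> - pi powr -\<alpha> > 0"
      using \<alpha>1 by (simp add: powr_minus field_simps)
    ultimately have "0 < - J / (cp + cm)" by simp
    then show ?thesis using c_pos by (simp add: divide_less_0_iff)
  qed
  define \<kappa> where "\<kappa> = - J / (cp + cm)"
  have \<kappa>: "\<kappa> > 0" using J c_pos by (simp add: \<kappa>_def divide_neg_pos)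
  \<comment> \<open>The truncated means enter through the sine alone. Its mean is bounded by the
    weight integral, hence of smaller order than \<open>sqrt (H t)\<close>, and squaring makes it
    negligible against \<open>H t\<close>.\<close>
  have V_lim: "((\<lambda>t. (V t)\<^sup>2 / H t) \<longlongrightarrow> 0) at_top"
  proof (rule Lim_null_comparison)
    have "((\<lambda>t. ((\<integral>x. min 1 (\<bar>\<Psi> x\<bar> / t) \<partial>N) / sqrt (H t))\<^sup>2) \<longlongrightarrow> 0\<^sup>2) at_top"
      by (intro tendsto_power weight_integral_small)
    then show "((\<lambda>t. ((\<integral>x. min 1 (\<bar>\<Psi> x\<bar> / t) \<partial>N) / sqrt (H t))\<^sup>2) \<longlongrightarrow> 0) at_top" by simp
    show "\<forall>\<^sub>F t in at_top. norm ((V t)\<^sup>2 / H t) \<le> ((\<integral>x. min 1 (\<bar>\<Psi> x\<bar> / t) \<partial>N) / sqrt (H t))\<^sup>2"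
      using eventually_gt_at_top[of 0]
    proof eventually_elim
      case (elim t)
      have "\<bar>V t\<bar> \<le> (\<integral>x. \<bar>sin (\<Psi> x / t)\<bar> \<partial>N)" unfolding V_def Im_phi by (rule integral_abs_bound)
      also have "\<dots> \<le> (\<integral>x. min 1 (\<bar>\<Psi> x\<bar> / t) \<partial>N)"
      proof (rule integral_mono)
        show "integrable N (\<lambda>x. \<bar>sin (\<Psi> x / t)\<bar>)" by (rule integrable_const_bound[of _ 1]) auto
        show "integrable N (\<lambda>x. min 1 (\<bar>\<Psi> x\<bar> / t))"
          using elim by (intro integrable_const_bound[of _ 1]) auto
        show "\<bar>sin (\<Psi> x / t)\<bar> \<le> min 1 (\<bar>\<Psi> x\<bar> / t)" for x
          using abs_sin_x_le_abs_x[of "\<Psi> x / t"] elim by (simp add: abs_divide)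
      qed
      finally have "\<bar>V t\<bar>\<^sup>2 \<le> (\<integral>x. min 1 (\<bar>\<Psi> x\<bar> / t) \<partial>N)\<^sup>2" by (intro power_mono) auto
      then show ?case using H_pos[of t] by (simp add: power_divide divide_right_mono)
    qed
  qed
  \<comment> \<open>Since \<open>W = 2 * U - U^2 - V^2\<close>, only \<open>U\<close> counts to
    first order, and \<open>W\<close> is asymptotic to a known multiple of \<open>H\<close>.\<close>
  define W where "W t = 1 - (norm (\<phi> (1 / t)))\<^sup>2" for t
  have W_lim: "((\<lambda>t. W t / H t) \<longlongrightarrow> 2 * \<kappa>) at_top"
  proof -
    have H0: "((\<lambda>t. U t / H t * (U t / H t) * H t) \<longlongrightarrow> \<kappa> * \<kappa> * 0) at_top"
      by (intro tendsto_mult U_lim[folded \<kappa>_def] H_tendsto_0)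
    have "((\<lambda>t. 2 * (U t / H t) - U t / H t * (U t / H t) * H t - (V t)\<^sup>2 / H t) \<longlongrightarrow> 2 * \<kappa> - \<kappa> * \<kappa> * 0 - 0) at_top"
      by (intro tendsto_diff tendsto_mult[OF tendsto_const] U_lim[folded \<kappa>_def] H0 V_lim)
    moreover have "2 * (U t / H t) - U t / H t * (U t / H t) * H t - (V t)\<^sup>2 / H t = W t / H t" for t
    proof -
      have W: "W t = 2 * U t - (U t)\<^sup>2 - (V t)\<^sup>2"
        unfolding W_def U_def V_def cmod_power2 by (simp add: power2_eq_square algebra_simps)
      have "H t \<noteq> 0" using H_pos[of t] by simp
      then show ?thesis unfolding W by (simp add: diff_divide_distrib power2_eq_square)
    qed
    ultimately show ?thesis by simp
  qed
  \<comment> \<open>Suppose \<open>a n \<le> A\<close> infinitely often and evaluate at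
    \<open>s n = a n / t\<close> for these \<open>n\<close>. Then
    \<open>\<phi> (s n / a n) ^ n\<close> is a power of a fixed number of modulus below 1, whereas
    \<open>char \<mu>\<close> never vanishes and so is bounded away from 0 on a compact interval.
    For the other \<open>n\<close> the value 0 keeps \<open>s\<close> bounded.\<close>
  have a_top: "filterlim a at_top sequentially"
  proof (rule ccontr)
    assume "\<not> filterlim a at_top sequentially"
    then obtain A where A: "\<exists>\<^sub>F n in sequentially. a n \<le> A"
      by (auto simp: filterlim_at_top_dense not_eventually not_less)
    have "\<forall>\<^sub>F t in at_top. W t / H t > 0"
      by (rule order_tendstoD(1)[OF W_lim]) (use \<kappa> in simp)
    then have "\<forall>\<^sub>F t in at_top. W t / H t > 0 \<and> t > 0"
      using eventually_gt_at_top[of 0] by eventually_elim simp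
    from eventually_happens[OF this] obtain t where t: "W t / H t > 0" "t > 0" by auto
    then have "W t > 0" using H_pos[of t] by (simp add: zero_less_divide_iff)
    then have "(norm (\<phi> (1 / t)))\<^sup>2 < 1" by (simp add: W_def)
    then have phi1: "norm (\<phi> (1 / t)) < 1" by (simp add: power2_less_1_iff abs_square_less_1)
    define s where "s n = (if a n \<le> A then a n / t else 0)" for n
    have sb: "0 \<le> s n" "s n \<le> \<bar>A\<bar> / t" for n
      using a[of n] t by (auto simp: s_def divide_right_mono)
    have "continuous_on {0..\<bar>A\<bar> / t} (\<lambda>u. norm (char \<mu> u))"
      using \<mu>.isCont_char by (intro continuous_on_norm continuous_at_imp_continuous_on) blast
    moreover have "{0..\<bar>A\<bar> / t} \<noteq> {}" using t by simp
    ultimately obtain u where u: "\<forall>y\<in>{0..\<bar>A\<bar> / t}. norm (char \<mu> u) \<le> norm (char \<mu> y)"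
      using continuous_attains_inf[OF compact_Icc] by blast
    define m where "m = norm (char \<mu> u)"
    have m: "m > 0" by (simp add: m_def char_\<mu>)
    have "(\<lambda>n. \<phi> (s n / a n) ^ n - char \<mu> (s n)) \<longlonglongrightarrow> 0"
      by (rule unif[of _ "\<bar>A\<bar> / t"]) (use sb in auto)
    from tendstoD[OF this, of "m / 2"] m
    have e1: "\<forall>\<^sub>F n in sequentially. norm (\<phi> (s n / a n) ^ n - char \<mu> (s n)) < m / 2" by simp
    have "(\<lambda>n. norm (\<phi> (1 / t)) ^ n) \<longlonglongrightarrow> 0" using phi1 by (intro LIMSEQ_power_zero) simp
    then have e2: "\<forall>\<^sub>F n in sequentially. norm (\<phi> (1 / t)) ^ n < m / 2" using m by (intro order_tendstoD) auto
    from frequently_eventually_frequently[OF A eventually_conj[OF e1 e2]]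
    obtain n where n: "a n \<le> A" "norm (\<phi> (s n / a n) ^ n - char \<mu> (s n)) < m / 2" "norm (\<phi> (1 / t)) ^ n < m / 2"
      by (auto dest!: frequently_ex)
    have "s n / a n = 1 / t" using n(1) a[of n] by (simp add: s_def)
    then have "norm (\<phi> (s n / a n) ^ n) < m / 2" using n(3) by (simp add: norm_power)
    moreover have "m \<le> norm (char \<mu> (s n))" unfolding m_def by (rule bspec[OF u]) (use sb in auto)
    moreover have "norm (char \<mu> (s n)) \<le> norm (\<phi> (s n / a n) ^ n) + norm (\<phi> (s n / a n) ^ n - char \<mu> (s n))"
      using norm_triangle_ineq3[of "char \<mu> (s n)" "\<phi> (s n / a n) ^ n"] by (simp add: norm_minus_commute)
    ultimately show False using n(2) by simp
  qed
  have Wa: "(\<lambda>n. W (a n) / H (a n)) \<longlonglongrightarrow> 2 * \<kappa>" by (rule filterlim_compose[OF W_lim a_top])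
  have "(\<lambda>n. W (a n) / H (a n) * H (a n)) \<longlonglongrightarrow> 2 * \<kappa> * 0"
    by (intro tendsto_mult Wa filterlim_compose[OF H_tendsto_0 a_top])
  then have W0: "(\<lambda>n. W (a n)) \<longlonglongrightarrow> 0" using H_pos by (simp add: less_imp_neq[symmetric])
  have "(\<lambda>n. real n * (1 - (norm (\<phi> (1 / a n)))\<^sup>2)) \<longlonglongrightarrow> - 2 * J"
  proof (rule one_minus_limit_of_power_limit)
    have "(norm (\<phi> (1 / a n)))\<^sup>2 \<le> 1\<^sup>2" for n by (intro power_mono phi_norm_le) simp
    then show "(norm (\<phi> (1 / a n)))\<^sup>2 \<le> 1" for n by simp
    show "(\<lambda>n. (norm (\<phi> (1 / a n)))\<^sup>2) \<longlonglongrightarrow> 1"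
      using tendsto_diff[OF tendsto_const[of 1] W0] by (simp add: W_def)
    have "(\<lambda>n. \<phi> (1 / a n) ^ n - char \<mu> 1) \<longlonglongrightarrow> 0"
      by (rule unif[of "\<lambda>_. 1" 1]) simp
    then have "(\<lambda>n. \<phi> (1 / a n) ^ n) \<longlonglongrightarrow> char \<mu> 1" by (rule Lim_null[THEN iffD2])
    then have "(\<lambda>n. (norm (\<phi> (1 / a n) ^ n))\<^sup>2) \<longlonglongrightarrow> (norm (char \<mu> 1))\<^sup>2"
      by (intro tendsto_intros)
    moreover have "(norm (char \<mu> 1))\<^sup>2 = exp (- (- 2 * J))"
      by (simp add: char_\<mu> exp1 norm_exp_eq_Re power2_eq_square exp_add[symmetric])
    moreover have "(norm (\<phi> (1 / a n) ^ n))\<^sup>2 = ((norm (\<phi> (1 / a n)))\<^sup>2) ^ n" for n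
      by (simp add: norm_power power_mult[symmetric] mult.commute)
    ultimately show "(\<lambda>n. ((norm (\<phi> (1 / a n)))\<^sup>2) ^ n) \<longlonglongrightarrow> exp (- (- 2 * J))" by simp
  qed simp
  then have nW: "(\<lambda>n. real n * W (a n)) \<longlonglongrightarrow> - 2 * J" by (simp add: W_def)
  have a_norm: "(\<lambda>n. real n * H (a n)) \<longlonglongrightarrow> cp + cm"
  proof -
    have "(\<lambda>n. (real n * W (a n)) / (W (a n) / H (a n))) \<longlonglongrightarrow> (- 2 * J) / (2 * \<kappa>)"
      using \<kappa> by (intro tendsto_divide nW Wa) simp
    also have "(- 2 * J) / (2 * \<kappa>) = cp + cm" using J c_pos by (simp add: \<kappa>_def)
    finally have l: "(\<lambda>n. (real n * W (a n)) / (W (a n) / H (a n))) \<longlonglongrightarrow> cp + cm" .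
    have "\<forall>\<^sub>F n in sequentially. W (a n) / H (a n) > 0"
      by (rule order_tendstoD(1)[OF Wa]) (use \<kappa> in simp)
    then have "\<forall>\<^sub>F n in sequentially. (real n * W (a n)) / (W (a n) / H (a n)) = real n * H (a n)"
      by eventually_elim auto
    then show ?thesis by (rule Lim_transform_eventually[OF l])
  qed
  have ratio1: "(\<lambda>n. a n / B n) \<longlonglongrightarrow> 1"
    by (rule same_tail_imp_asymptotic[OF a_top a_norm B])
  \<comment> \<open>As \<open>s n / a n = \<theta> / B n\<close> and \<open>s n\<close> tends to
    \<theta>, evaluating here passes from the unknown norming to \<open>B\<close>.\<close>
  define s where "s n = \<theta> * (a n / B n)" for n
  have s_lim: "s \<longlonglongrightarrow> \<theta>" unfolding s_def using tendsto_mult[OF tendsto_const[of \<theta>] ratio1] by simp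
  then obtain b where b: "\<And>n. \<bar>s n\<bar> \<le> b"
    using convergent_imp_Bseq[OF convergentI[OF s_lim]] by (auto simp: Bseq_def)
  have "(\<lambda>n. \<phi> (s n / a n) ^ n - char \<mu> (s n)) \<longlonglongrightarrow> 0" by (rule unif[OF b])
  moreover have "(\<lambda>n. char \<mu> (s n)) \<longlonglongrightarrow> char \<mu> \<theta>"
    by (rule isCont_tendsto_compose[OF \<mu>.isCont_char s_lim])
  ultimately have "(\<lambda>n. \<phi> (s n / a n) ^ n - char \<mu> (s n) + char \<mu> (s n)) \<longlonglongrightarrow> 0 + char \<mu> \<theta>"
    by (rule tendsto_add)
  moreover have "s n / a n = \<theta> / B n" for n using a[of n] by (simp add: s_def)
  ultimately show ?thesis by simp
qed

end

section \<open>The limit theorem\<close>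

theorem theorem3p1:
  fixes M :: "'a measure" and S :: "'s measure"
    and P :: "'s \<Rightarrow> 's measure" and \<pi> :: "'s measure"
    and X :: "nat \<Rightarrow> 'a \<Rightarrow> 's" and \<Psi> :: "'s \<Rightarrow> real"
    and \<alpha> cp cm :: real and \<mu> :: "real measure"
    and l :: "real \<Rightarrow> real" and B :: "nat \<Rightarrow> real"
  assumes "prob_space M"
    and kernel: "P \<in> S \<rightarrow>\<^sub>M prob_algebra S"
    and stationary: "stationary_for S P \<pi>"
    and chain: "homogeneous_markov_chain M S P X"
    and initial: "distr M S (X 0) = \<pi>"
    and gap: "L2_spectral_gap P \<pi>"
    and two_UI: "L2_uniformly_integrable_op P \<pi>"
    and "0 < \<alpha>" and "\<alpha> < 2"
    and "cp \<ge> 0" and "cm \<ge> 0" and "cp + cm > 0"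
    and stable: "is_stable_law \<alpha> cp cm \<mu>"
    and Psi: "\<Psi> \<in> borel_measurable S"
    and tail: "\<And>t. t > 0 \<Longrightarrow> measure \<pi> {x \<in> space S. \<bar>\<Psi> x\<bar> > t} = t powr (-\<alpha>) * l t"
    and slow: "slowly_varying l"
    and right_tail: "((\<lambda>t. measure \<pi> {x \<in> space S. \<Psi> x > t} /
                           measure \<pi> {x \<in> space S. \<bar>\<Psi> x\<bar> > t})
                       \<longlongrightarrow> cp / (cp + cm)) at_top"
    and left_tail: "((\<lambda>t. measure \<pi> {x \<in> space S. \<Psi> x < -t} /
                          measure \<pi> {x \<in> space S. \<bar>\<Psi> x\<bar> > t})
                      \<longlongrightarrow> cm / (cp + cm)) at_top"
    and attraction_1: "\<alpha> = 1 \<Longrightarrow> in_strict_domain_of_attraction (distr \<pi> borel \<Psi>) \<mu>"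
    and B_top: "filterlim B at_top sequentially"
    and B_norm: "(\<lambda>n. real n / B n powr \<alpha> * l (B n)) \<longlonglongrightarrow> cp + cm"
  shows "(\<alpha> < 1 \<or> \<alpha> = 1 \<and> cp = cm \<longrightarrow>
            weak_conv_m (\<lambda>n. distr M borel (\<lambda>\<omega>. (\<Sum>j=1..n. \<Psi> (X j \<omega>)) / B n)) \<mu>) \<and>
         (\<alpha> > 1 \<longrightarrow>
            weak_conv_m
              (\<lambda>n. distr M borel (\<lambda>\<omega>.
                 (\<Sum>j=1..n. \<Psi> (X j \<omega>) -
                    real_cond_exp M (natural_filtration M S X (j - 1)) (\<lambda>\<omega>. \<Psi> (X j \<omega>)) \<omega>) / B n)) \<mu>)"
proof -
  interpret stationary_kernel S P \<pi> by unfold_locales (rule kernel, rule stationary)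
  interpret stationary_chain S P \<pi> M X
    by (intro stationary_chain.intro stationary_kernel_axioms stationary_chain_axioms.intro
        \<open>prob_space M\<close> chain initial)
  have tail': "measure \<pi> {x \<in> space \<pi>. \<bar>\<Psi> x\<bar> > t} = t powr (-\<alpha>) * l t" if "t > 0" for t
    using tail[OF that] by (simp add: space_pi)
  interpret heavy_tail \<pi> \<Psi> \<alpha> cp cm
  proof unfold_locales
    show "\<Psi> \<in> borel_measurable \<pi>" using Psi by (simp cong: measurable_cong_sets add: sets_pi)
    show "((\<lambda>t. measure \<pi> {x \<in> space \<pi>. r * t < \<bar>\<Psi> x\<bar>} / measure \<pi> {x \<in> space \<pi>. t < \<bar>\<Psi> x\<bar>})
        \<longlongrightarrow> r powr -\<alpha>) at_top" if r: "r > 0" for r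
    proof -
      have "((\<lambda>t. r powr -\<alpha> * (l (r * t) / l t)) \<longlongrightarrow> r powr -\<alpha> * 1) at_top"
        using slow r by (intro tendsto_intros) (auto simp: slowly_varying_def)
      then have lim: "((\<lambda>t. r powr -\<alpha> * (l (r * t) / l t)) \<longlongrightarrow> r powr -\<alpha>) at_top" by simp
      show ?thesis
      proof (rule Lim_transform_eventually[OF lim], use eventually_gt_at_top[of 0] in eventually_elim)
        case (elim t)
        have "measure \<pi> {x \<in> space \<pi>. r * t < \<bar>\<Psi> x\<bar>} = (r * t) powr (-\<alpha>) * l (r * t)"
          by (rule tail') (use r elim in simp)
        then show ?case using tail'[OF elim] r elim by (simp add: powr_mult)
      qed
    qed
  qed (use assms right_tail left_tail in \<open>auto simp: space_pi\<close>)
  \<comment> \<open>The tail formula is given for positive arguments only, so the two sequences are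
    identified once \<open>B n > 0\<close>.\<close>
  have H_norm: "(\<lambda>n. real n * H (B n)) \<longlonglongrightarrow> cp + cm"
  proof (rule Lim_transform_eventually[OF B_norm])
    have "\<forall>\<^sub>F n in sequentially. B n > 0"
      using B_top by (auto simp: filterlim_at_top_dense)
    then show "\<forall>\<^sub>F n in sequentially. real n / B n powr \<alpha> * l (B n) = real n * H (B n)"
      by eventually_elim (simp add: H_def tail' powr_minus divide_inverse)
  qed
  interpret heavy_chain S P \<pi> M X \<Psi> \<alpha> cp cm B
    by (intro heavy_chain.intro stationary_chain_axioms heavy_tail_axioms heavy_chain_axioms.intro
        gap two_UI B_top H_norm)
  have \<mu>: "real_distribution \<mu>" using stable by (simp add: is_stable_law_def)
  show ?thesis
  proof (intro conjI impI)
    assume "\<alpha> < 1 \<or> \<alpha> = 1 \<and> cp = cm"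
    then show "weak_conv_m (\<lambda>n. distr M borel (\<lambda>\<omega>. (\<Sum>j=1..n. \<Psi> (X j \<omega>)) / B n)) \<mu>"
    proof (elim disjE conjE)
      assume "\<alpha> < 1"
      then show ?thesis by (rule limit_lt_1[OF _ stable])
    next
      assume \<alpha>1: "\<alpha> = 1"
      have "(\<integral>x. G \<theta> n x \<partial>\<pi>) = \<phi> (\<theta> / B n)" for \<theta> n
        by (simp add: phi_eq G_def)
      with attraction_norming[OF \<alpha>1 stable attraction_1[OF \<alpha>1] B_top H_norm]
      show ?thesis by (intro limit_uncentred \<mu>) (simp only:)
    qed
  qed (rule limit_gt_1[OF _ stable])
qed

end
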